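(* Let $y(x;\sigma,J,\theta_1,\theta_2,\theta_3,\theta_\infty)$ be a generic solution of the Painlevé VI equation with $\sigma,J\neq 0$, and let $\Phi(u;\Phi_0)$ be a corresponding generic solution of the $3\times 3$ isomonodromy equation, with boundary value $\Phi_0$. Then there exists a unique $K^0=\mathrm{diag}(k_1^0,k_2^0,1)$ with $k_1^0,k_2^0\in\mathbb{C}\setminus\{0\}$ such that the entries of the $3\times 3$ matrix $\Phi_0'=(K^0)^{-1}\Phi_0K^0$ are $$(\Phi_0')_{ii}=-\theta_i\quad(i=1,2,3),\qquad (\Phi_0')_{12}=\frac{\theta_1-\theta_2-\sigma}{2},\qquad (\Phi_0')_{21}=\frac{-\theta_1+\theta_2-\sigma}{2},$$ $$(\Phi_0')_{13}=\tfrac12(-\theta_3-\theta_\infty+\sigma)-\tfrac{1}{8\sigma^2J}(\theta_1-\theta_2-\sigma)(\theta_1+\theta_2-\sigma)(\theta_3+\theta_\infty+\sigma),$$ $$(\Phi_0')_{31}=\tfrac{J}{2}(\theta_3-\theta_\infty+\sigma)-\tfrac{1}{8\sigma^2}(-\theta_1+\theta_2-\sigma)(\theta_1+\theta_2+\sigma)(\theta_3-\theta_\infty-\sigma),$$ $$(\Phi_0')_{23}=\tfrac12(-\theta_3-\theta_\infty+\sigma)-\tfrac{1}{8\sigma^2J}(\theta_1-\theta_2+\sigma)(\theta_1+\theta_2-\sigma)(\theta_3+\theta_\infty+\sigma),$$ $$(\Phi_0')_{32}=\tfrac{J}{2}(-\theta_3+\theta_\infty-\sigma)-\tfrac{1}{8\sigma^2}(\theta_1-\theta_2-\sigma)(\theta_1+\theta_2+\sigma)(\theta_3-\theta_\infty-\sigma).$$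 Furthermore, the boundary condition $|\mathrm{Re}(\lambda^{(2)}_1-\lambda^{(2)}_2)|<1$ for $\Phi_0$, where $\lambda_1^{(2)},\lambda_2^{(2)}$ are the eigenvalues of the upper left $2\times2$ submatrix of $\Phi_0$, becomes Jimbo's boundary condition $0\le \mathrm{Re}(\sigma)<1$ for $\sigma$ (with the eigenvalues labelled so that $\mathrm{Re}\,\lambda_1^{(2)}\ge\mathrm{Re}\,\lambda_2^{(2)}$, one has $\sigma=\lambda_1^{(2)}-\lambda_2^{(2)}$).
   Context: **Painlevé VI.** With parameters $\theta_1,\theta_2,\theta_3,\theta_\infty\in\mathbb{C}$, PVI is $$\frac{d^2y}{dx^2}=\frac12\Big[\frac1y+\frac1{y-1}+\frac1{y-x}\Big]\Big(\frac{dy}{dx}\Big)^2-\Big[\frac1x+\frac1{x-1}+\frac1{y-x}\Big]\frac{dy}{dx}+\frac{y(y-1)(y-x)}{x^2(x-1)^2}\Big[\frac{(\theta_\infty-1)^2}{2}-\frac{\theta_1^2}{2}\frac{x}{y^2}+\frac{\theta_3^2}{2}\frac{x-1}{(y-1)^2}+\frac{1-\theta_2^2}{2}\frac{x(x-1)}{(y-x)^2}\Big].$$ $y(x;\sigma,J,\theta_1,\theta_2,\theta_3,\theta_\infty)$ denotes a generic solution, i.e. one with the following behaviour as $x\to0$ (on a fixed branch of $\log x$), where $0\le\mathrm{Re}(\sigma)<1$: $y(x)\sim Jx^{1-\sigma}(1+O(x^\epsilon))$ for some small $\epsilon>0$ if $\mathrm{Re}(\sigma)>0$; $y(x)\sim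 Jx^{1-\sigma}+J_1x^{1+\sigma}+J_2x+O(x^{2-\sigma})$ if $\mathrm{Re}(\sigma)=0$, $\sigma\ne0$, with $J_1=\frac{(\sigma^2-(\theta_1-\theta_2)^2)(\sigma^2-(\theta_1+\theta_2)^2)}{16\sigma^4J}$, $J_2=\frac{\theta_1^2-\theta_2^2+\sigma^2}{2\sigma^2}$. **Isomonodromy equation ($n=3$).** For $\Phi(u)=(\phi_{ij}(u))$, a $3\times3$ matrix function of $u=(u_1,u_2,u_3)$ with distinct $u_i$: $\partial_{u_k}\phi_{kk}=0$; $\ \partial_{u_k}\phi_{ij}=\big(\frac1{u_k-u_j}-\frac1{u_k-u_i}\big)\phi_{ik}\phi_{kj}$ for $i,j\ne k$; $\ \partial_{u_k}\phi_{ik}=\sum_{j\ne k}\frac{\delta_{ij}\phi_{kk}-\phi_{ij}}{u_k-u_j}\phi_{jk}$ for $i\neq k$; $\ \partial_{u_k}\phi_{kj}=\sum_{i\ne k}\phi_{ki}\frac{\phi_{ij}-\delta_{ij}\phi_{kk}}{u_k-u_i}$ for $j\ne k$. Let $\delta\Phi$ be the (constant) diagonal part of $\Phi$, and for a matrix $A$ let $\delta_kA$ be the matrix with $(\delta_kA)_{ij}=A_{ij}$ if $1\le i,j\le k$ or $i=j$, and $0$ otherwise. **Boundary value.** Almost every (``generic'') solution $\Phi=\Phi_3$ has a boundary value: there are a matrix function $\Phi_2(u_1,u_2)$ and a constant matrix $\Phi_0$ with $\lim_{u_3\to\infty}\delta_2\Phi=\delta_2\Phi_2$, $\ \lim_{u_3\to\infty}\big(\frac{u_3-u_2}{u_2-u_1}\big)^{\delta_2\Phi_2}\Phi\big(\frac{u_3-u_2}{u_2-u_1}\big)^{-\delta_2\Phi_2}=\Phi_2$,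 $\ (u_2-u_1)^{\delta_1\Phi_0}\Phi_2(u_2-u_1)^{-\delta_1\Phi_0}=\Phi_0$ (so $\delta_1\Phi_0=\delta\Phi$), and the eigenvalues of the upper left $2\times2$ submatrix of $\Phi_0$ satisfy $|\mathrm{Re}(\lambda_1^{(2)}-\lambda_2^{(2)})|<1$ (the boundary condition). $\Phi_0$ determines $\Phi$, which is written $\Phi(u;\Phi_0)$. **Correspondence.** Consider solutions $\Phi$ with $\delta\Phi=-\mathrm{diag}(\theta_1,\theta_2,\theta_3)$ and distinct eigenvalues $0,\ \frac{\theta_\infty-\theta_1-\theta_2-\theta_3}2,\ \frac{-\theta_\infty-\theta_1-\theta_2-\theta_3}2$. These, up to conjugation by constant matrices $\mathrm{diag}(k_1^0,k_2^0,1)$, correspond one-to-one to PVI solutions $y(x)$ as follows. Put $x=\frac{u_2-u_1}{u_3-u_1}$, $\Omega(x)=(u_3-u_1)^{\delta\Phi}\Phi(u)(u_3-u_1)^{-\delta\Phi}$ and $$f(\theta_1,\theta_2,\theta_3,\theta_\infty;x,y)=(x-x^2)\tfrac{dy}{dx}+(1-\theta_\infty)y^2+[(\theta_2+\theta_\infty)x+\theta_1-\theta_2-1]y-\theta_1x .$$ Then $\Omega_{12}=\frac{k_1}{k_2}\frac{f(\theta_1,\theta_2,\theta_3,\theta_\infty;x,y)}{2(1-x)y}$, $\ \Omega_{21}=\frac{k_2}{k_1}\frac{f(-\theta_1,-\theta_2,\theta_3,\theta_\infty;x,y)}{2(y-x)}$, $\Omega_{13}=k_1\frac{f(\theta_1,\theta_1-\theta_3-\theta_\infty,\theta_3,\theta_\infty;x,y)}{2(x-1)y}$,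 $\ \Omega_{31}=\frac1{k_1}\frac{f(-\theta_1,-\theta_1+\theta_3-\theta_\infty,\theta_3,\theta_\infty;x,y)}{2x(y-1)}$, $\Omega_{23}=k_2\frac{f(-\theta_2+\theta_3+\theta_\infty,-\theta_2,\theta_3,\theta_\infty;x,y)}{2(x-y)}$, $\ \Omega_{32}=\frac1{k_2}\frac{f(\theta_2-\theta_3+\theta_\infty,\theta_2,\theta_3,\theta_\infty;x,y)}{2x(1-y)}$, where $k_i(x)=k_i^0\exp\big(\int^xl_i(\xi)d\xi\big)$, $k_i^0\in\mathbb{C}\setminus\{0\}$, $l_1=\frac{f(\theta_1,\theta_2,\theta_3,\theta_1+\theta_3-\theta_2;x,y)}{2x(1-x)(1-y)y}$, $\ l_2=\frac{f(-\theta_1,-\theta_2,\theta_3,\theta_3+\theta_2-\theta_1;x,y)}{2x(y-1)(x-y)}+\frac{\theta_2-\theta_3}{x-1}$. A ``corresponding'' solution $\Phi$ is any member of the class attached to $y$.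
   Formalization: In the isomonodromy equation the sign of ∂_{u_k}φ_ij for i,j≠k is corrected to (1/(u_k−u_i) − 1/(u_k−u_j))φ_ikφ_kj; with the printed sign the system is incompatible with the Painlevé VI correspondence unless the products φ_ikφ_kj (i≠j) vanish. *)

theory Defs
  imports "HOL-Analysis.Analysis" "HOL-Library.Landau_Symbols"
begin

text \<open>
  Branches. \<open>clog a\<close> is the branch of the logarithm with argument in \<open>(a - \<pi>, a + \<pi>]\<close>,
  i.e. cut in the direction opposite to \<open>a\<close>; \<open>sector a d\<close> is the open sector of half-opening \<open>d\<close>
  around the direction \<open>a\<close>, so that \<open>sector a pi\<close> is the plane with that cut removed.
\<close>

definition clog :: "real \<Rightarrow> complex \<Rightarrow> complex"
  where "clog a z = Ln (z * cis (- a)) + \<i> * of_real a"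

definition cpow :: "real \<Rightarrow> complex \<Rightarrow> complex \<Rightarrow> complex"
  where "cpow a z s = exp (s * clog a z)"

definition sector :: "real \<Rightarrow> real \<Rightarrow> complex set"
  where "sector a d = {z. z \<noteq> 0 \<and> \<bar>Im (clog a z) - a\<bar> < d}"


section \<open>Painleve VI\<close>

definition PVI_rhs ::
  "complex \<Rightarrow> complex \<Rightarrow> complex \<Rightarrow> complex \<Rightarrow> complex \<Rightarrow> complex \<Rightarrow> complex \<Rightarrow> complex"
  where "PVI_rhs th1 th2 th3 thinf x y p =
    1/2 * (1/y + 1/(y - 1) + 1/(y - x)) * p\<^sup>2
    - (1/x + 1/(x - 1) + 1/(y - x)) * p
    + y * (y - 1) * (y - x) / (x\<^sup>2 * (x - 1)\<^sup>2) *
      ((thinf - 1)\<^sup>2 / 2 - th1\<^sup>2 / 2 * (x / y\<^sup>2) + th3\<^sup>2 / 2 * ((x - 1) / (y - 1)\<^sup>2)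
       + (1 - th2\<^sup>2) / 2 * (x * (x - 1) / (y - x)\<^sup>2))"

text \<open>
  The equation is singular where \<open>y \<in> {0, 1, x}\<close>. Solutions may pass through these values at
  isolated points (for \<open>Re \<sigma> = 0\<close> such points can accumulate at 0), but not identically.
\<close>

definition PVI_solution ::
  "complex \<Rightarrow> complex \<Rightarrow> complex \<Rightarrow> complex \<Rightarrow> complex set \<Rightarrow> (complex \<Rightarrow> complex) \<Rightarrow> bool"
  where "PVI_solution th1 th2 th3 thinf S y \<longleftrightarrow>
    y holomorphic_on S \<and>
    (\<exists>x\<in>S. y x \<notin> {0, 1, x}) \<and>
    (\<forall>x\<in>S. y x \<notin> {0, 1, x} \<longrightarrow>
       deriv (deriv y) x = PVI_rhs th1 th2 th3 thinf x (y x) (deriv y x))"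

definition PVI_J1 :: "complex \<Rightarrow> complex \<Rightarrow> complex \<Rightarrow> complex \<Rightarrow> complex"
  where "PVI_J1 sg J th1 th2 =
    (sg\<^sup>2 - (th1 - th2)\<^sup>2) * (sg\<^sup>2 - (th1 + th2)\<^sup>2) / (16 * sg ^ 4 * J)"

definition PVI_J2 :: "complex \<Rightarrow> complex \<Rightarrow> complex \<Rightarrow> complex"
  where "PVI_J2 sg th1 th2 = (th1\<^sup>2 - th2\<^sup>2 + sg\<^sup>2) / (2 * sg\<^sup>2)"

text \<open>
  The generic solution \<open>y(x; \<sigma>, J, \<theta>)\<close>, on the part \<open>|x| < r\<close> of the sector \<open>sector a d\<close>.
\<close>

definition PVI_generic_solution ::
  "real \<Rightarrow> real \<Rightarrow> real \<Rightarrow> complex \<Rightarrow> complex \<Rightarrow> complex \<Rightarrow> complex \<Rightarrow> complex \<Rightarrow> complex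
   \<Rightarrow> (complex \<Rightarrow> complex) \<Rightarrow> bool"
  where "PVI_generic_solution a d r sg J th1 th2 th3 thinf y \<longleftrightarrow>
    PVI_solution th1 th2 th3 thinf (sector a d \<inter> ball 0 r) y \<and>
    0 \<le> Re sg \<and> Re sg < 1 \<and>
    (Re sg > 0 \<longrightarrow>
      (\<exists>e::real. e > 0 \<and>
        (\<lambda>x. y x - J * cpow a x (1 - sg))
          \<in> O[at 0 within sector a d](\<lambda>x. cpow a x (1 - sg + of_real e)))) \<and>
    (Re sg = 0 \<and> sg \<noteq> 0 \<longrightarrow>
      (\<lambda>x. y x - (J * cpow a x (1 - sg) + PVI_J1 sg J th1 th2 * cpow a x (1 + sg)
                   + PVI_J2 sg th1 th2 * x))
        \<in> O[at 0 within sector a d](\<lambda>x. cpow a x (2 - sg)))"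


section \<open>Matrices\<close>

text \<open>
  \<open>matrix_pow L A\<close> is \<open>z\<^sup>A = exp (A log z)\<close>, where \<open>L\<close> is the chosen value of \<open>log z\<close>.
  (On \<open>complex^3^3\<close> the type class operations \<open>*\<close> and \<open>^\<close> act entrywise, hence \<open>**\<close>.)
\<close>

definition matrix_exp :: "complex^3^3 \<Rightarrow> complex^3^3"
  where "matrix_exp A = (\<Sum>n. (1 / fact n) *\<^sub>R (((**) A ^^ n) (mat 1)))"

definition matrix_pow :: "complex \<Rightarrow> complex^3^3 \<Rightarrow> complex^3^3"
  where "matrix_pow L A = matrix_exp (mat L ** A)"

definition diag3 :: "complex \<Rightarrow> complex \<Rightarrow> complex \<Rightarrow> complex^3^3"
  where "diag3 p q s = vector [vector [p, 0, 0], vector [0, q, 0], vector [0, 0, s]]"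

text \<open>In the type \<open>3\<close> the index \<open>3\<close> equals \<open>0\<close>, so its order is not the one wanted here.\<close>

definition index3 :: "3 \<Rightarrow> nat"
  where "index3 i = (if i = 1 then 1 else if i = 2 then 2 else 3)"

definition delta :: "nat \<Rightarrow> complex^3^3 \<Rightarrow> complex^3^3"
  where "delta k A =
    (\<chi> i j. if (index3 i \<le> k \<and> index3 j \<le> k) \<or> i = j then A $ i $ j else 0)"

definition eigenvalues :: "complex^'n^'n \<Rightarrow> complex set"
  where "eigenvalues A = {l. \<exists>v. v \<noteq> 0 \<and> A *v v = l *s v}"

definition upper_left2 :: "complex^3^3 \<Rightarrow> complex^2^2"
  where "upper_left2 A = vector [vector [A$1$1, A$1$2], vector [A$2$1, A$2$2]]"


section \<open>The isomonodromy equation\<close>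

text \<open>
  \<open>isomonodromy_rhs u A k i j\<close> is the prescribed value of the derivative of \<open>\<phi>\<^sub>i\<^sub>j\<close> in \<open>u\<^sub>k\<close>.
  The sign of the coefficient for \<open>i, j \<noteq> k\<close> is the one for which all cases together are the
  commutator equation of the lemma below. With the opposite sign they would be incompatible:
  the three partial derivatives of \<open>\<phi>\<^sub>1\<^sub>2\<close> would add up to
  \<open>2 (1 / (u\<^sub>3 - u\<^sub>2) - 1 / (u\<^sub>3 - u\<^sub>1)) \<phi>\<^sub>1\<^sub>3 \<phi>\<^sub>3\<^sub>2\<close> instead of 0, although \<open>\<Phi>\<close> depends only on the
  differences of the \<open>u\<^sub>i\<close>.
\<close>

definition isomonodromy_rhs :: "complex^3 \<Rightarrow> complex^3^3 \<Rightarrow> 3 \<Rightarrow> 3 \<Rightarrow> 3 \<Rightarrow> complex"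
  where "isomonodromy_rhs u A k i j =
    (if i = k \<and> j = k then 0
     else if i \<noteq> k \<and> j \<noteq> k then
       (1 / (u$k - u$i) - 1 / (u$k - u$j)) * (A$i$k * A$k$j)
     else if i \<noteq> k then
       (\<Sum>m \<in> UNIV - {k}. ((if i = m then A$k$k else 0) - A$i$m) / (u$k - u$m) * A$m$k)
     else
       (\<Sum>m \<in> UNIV - {k}. A$k$m * ((A$m$j - (if m = j then A$k$k else 0)) / (u$k - u$m))))"

lemma isomonodromy_rhs_eq_commutator:
  fixes u :: "complex^3" and A :: "complex^3^3" and k i j :: 3
  defines "V \<equiv> (\<chi> p q. if p = q then 0
                  else (of_bool (p = k) - of_bool (q = k)) / (u$p - u$q) * A$p$q)"
  assumes "inj (($) u)"
  shows "isomonodromy_rhs u A k i j = (V ** A - A ** V) $ i $ j"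
proof -
  have ne: "u$1 \<noteq> u$2" "u$1 \<noteq> u$3" "u$2 \<noteq> u$3"
    using assms(2) by (auto dest!: injD[of "($) u"])
  have ne': "u$2 - u$1 = - (u$1 - u$2)" "u$3 - u$1 = - (u$1 - u$3)" "u$3 - u$2 = - (u$2 - u$3)"
    by simp_all
  obtain p q s where pqs: "p = inverse (u$1 - u$2)" "q = inverse (u$1 - u$3)" "s = inverse (u$2 - u$3)"
    by blast
  have U: "UNIV - {1::3} = {2,3}" "UNIV - {2::3} = {1,3}" "UNIV - {3::3} = {1,2}"
    using UNIV_3 by auto
  show ?thesis
    using exhaust_3[of k] exhaust_3[of i] exhaust_3[of j]
    by (elim disjE; simp only: isomonodromy_rhs_def V_def U matrix_matrix_mult_def;
        simp add: sum_3 divide_inverse ne' pqs[symmetric] inverse_minus_eq algebra_simps del: minus_diff_eq)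
qed

definition isomonodromy_solution :: "(complex^3) set \<Rightarrow> (complex^3 \<Rightarrow> complex^3^3) \<Rightarrow> bool"
  where "isomonodromy_solution U Phi \<longleftrightarrow>
    continuous_on U Phi \<and>
    (\<forall>u\<in>U. inj (($) u) \<and>
      (\<forall>k i j. ((\<lambda>z. Phi (\<chi> l. if l = k then z else u$l) $ i $ j)
        has_field_derivative isomonodromy_rhs u (Phi u) k i j) (at (u$k))))"

definition xvar :: "complex^3 \<Rightarrow> complex"
  where "xvar u = (u$2 - u$1) / (u$3 - u$1)"

text \<open>
  The simply connected domain on which \<open>\<Phi>\<close> is single-valued. The branches of the logarithms of
  \<open>u\<^sub>3 - u\<^sub>1\<close>, \<open>u\<^sub>2 - u\<^sub>1\<close> and \<open>x\<close> are \<open>clog b\<close>, \<open>clog (a + b)\<close> and \<open>clog a\<close>, and they are compatible: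
  \<open>log x = log (u\<^sub>2 - u\<^sub>1) - log (u\<^sub>3 - u\<^sub>1)\<close>.
\<close>

definition config :: "real \<Rightarrow> real \<Rightarrow> real \<Rightarrow> real \<Rightarrow> (complex^3) set"
  where "config a b d r = {u.
    u$3 - u$1 \<in> sector b pi \<and> u$2 - u$1 \<in> sector (a + b) pi \<and>
    xvar u \<in> sector a d \<inter> ball 0 r \<and>
    clog a (xvar u) = clog (a + b) (u$2 - u$1) - clog b (u$3 - u$1)}"


section \<open>Boundary values\<close>

text \<open>
  The logarithm of \<open>(u\<^sub>3 - u\<^sub>2) / (u\<^sub>2 - u\<^sub>1) = (1 - x) / x\<close>, for the branch of \<open>log (u\<^sub>3 - u\<^sub>2)\<close> with
  \<open>log (u\<^sub>3 - u\<^sub>2) - log (u\<^sub>3 - u\<^sub>1) \<rightarrow> 0\<close> as \<open>u\<^sub>3 \<rightarrow> \<infinity>\<close>.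
\<close>

definition log_ratio :: "real \<Rightarrow> complex^3 \<Rightarrow> complex"
  where "log_ratio a u = Ln (1 - xvar u) - clog a (xvar u)"

definition has_boundary_value ::
  "real \<Rightarrow> real \<Rightarrow> real \<Rightarrow> real \<Rightarrow> (complex^3 \<Rightarrow> complex^3^3) \<Rightarrow> complex^3^3 \<Rightarrow> bool"
  where "has_boundary_value a b d r Phi Phi0 \<longleftrightarrow>
    (\<exists>Phi2 :: complex \<Rightarrow> complex \<Rightarrow> complex^3^3.
      \<forall>u1 u2. u2 - u1 \<in> sector (a + b) pi \<longrightarrow>
        (let F = inf at_infinity (principal {u3. vector [u1, u2, u3] \<in> config a b d r});
             D2 = delta 2 (Phi2 u1 u2);
             D1 = delta 1 Phi0
         in ((\<lambda>u3. delta 2 (Phi (vector [u1, u2, u3]))) \<longlongrightarrow> D2) F \<and>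
            ((\<lambda>u3. matrix_pow (log_ratio a (vector [u1, u2, u3])) D2
                    ** Phi (vector [u1, u2, u3])
                    ** matrix_pow (log_ratio a (vector [u1, u2, u3])) (- D2))
               \<longlongrightarrow> Phi2 u1 u2) F \<and>
            matrix_pow (clog (a + b) (u2 - u1)) D1 ** Phi2 u1 u2
              ** matrix_pow (clog (a + b) (u2 - u1)) (- D1) = Phi0))"


section \<open>The correspondence between Painleve VI and the isomonodromy equation\<close>

text \<open>The third parameter does not occur; it is kept to match the usual notation.\<close>

definition pvi_f ::
  "complex \<Rightarrow> complex \<Rightarrow> complex \<Rightarrow> complex \<Rightarrow> (complex \<Rightarrow> complex) \<Rightarrow> complex \<Rightarrow> complex"
  where "pvi_f th1 th2 th3 thinf y x =
    (x - x\<^sup>2) * deriv y x + (1 - thinf) * (y x)\<^sup>2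
    + ((th2 + thinf) * x + th1 - th2 - 1) * y x - th1 * x"

definition pvi_l1 ::
  "complex \<Rightarrow> complex \<Rightarrow> complex \<Rightarrow> (complex \<Rightarrow> complex) \<Rightarrow> complex \<Rightarrow> complex"
  where "pvi_l1 th1 th2 th3 y x =
    pvi_f th1 th2 th3 (th1 + th3 - th2) y x / (2 * x * (1 - x) * (1 - y x) * y x)"

definition pvi_l2 ::
  "complex \<Rightarrow> complex \<Rightarrow> complex \<Rightarrow> (complex \<Rightarrow> complex) \<Rightarrow> complex \<Rightarrow> complex"
  where "pvi_l2 th1 th2 th3 y x =
    pvi_f (- th1) (- th2) th3 (th3 + th2 - th1) y x / (2 * x * (y x - 1) * (x - y x))
    + (th2 - th3) / (x - 1)"

definition Omega_of :: "real \<Rightarrow> (complex^3 \<Rightarrow> complex^3^3) \<Rightarrow> complex^3 \<Rightarrow> complex^3^3"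
  where "Omega_of b Phi u =
    matrix_pow (clog b (u$3 - u$1)) (delta 1 (Phi u)) ** Phi u
      ** matrix_pow (clog b (u$3 - u$1)) (- delta 1 (Phi u))"

definition PVI_isomonodromy_class ::
  "complex \<Rightarrow> complex \<Rightarrow> complex \<Rightarrow> complex \<Rightarrow> (complex^3) set \<Rightarrow> (complex^3 \<Rightarrow> complex^3^3) \<Rightarrow> bool"
  where "PVI_isomonodromy_class th1 th2 th3 thinf U Phi \<longleftrightarrow>
    distinct [0, (thinf - th1 - th2 - th3) / 2, (- thinf - th1 - th2 - th3) / 2] \<and>
    isomonodromy_solution U Phi \<and>
    (\<forall>u\<in>U. delta 1 (Phi u) = - diag3 th1 th2 th3 \<and>
      eigenvalues (Phi u) = {0, (thinf - th1 - th2 - th3) / 2, (- thinf - th1 - th2 - th3) / 2})"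

text \<open>
  \<open>k\<^sub>i = k\<^sub>i\<^sup>0 exp (\<integral> l\<^sub>i)\<close> with \<open>k\<^sub>i\<^sup>0 \<noteq> 0\<close> is expressed by \<open>k\<^sub>i' = l\<^sub>i k\<^sub>i\<close> and \<open>k\<^sub>i \<noteq> 0\<close>, off the isolated
  points with \<open>y \<in> {0, 1, x}\<close>, whose complement in the sector is connected.
\<close>

definition corresponds ::
  "real \<Rightarrow> real \<Rightarrow> real \<Rightarrow> real \<Rightarrow> complex \<Rightarrow> complex \<Rightarrow> complex \<Rightarrow> complex
   \<Rightarrow> (complex \<Rightarrow> complex) \<Rightarrow> (complex^3 \<Rightarrow> complex^3^3) \<Rightarrow> bool"
  where "corresponds a b d r th1 th2 th3 thinf y Phi \<longleftrightarrow>
    PVI_isomonodromy_class th1 th2 th3 thinf (config a b d r) Phi \<and>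
    (\<exists>k1 k2 :: complex \<Rightarrow> complex.
      (\<forall>x \<in> sector a d \<inter> ball 0 r. y x \<notin> {0, 1, x} \<longrightarrow>
         k1 x \<noteq> 0 \<and> k2 x \<noteq> 0 \<and>
         (k1 has_field_derivative pvi_l1 th1 th2 th3 y x * k1 x) (at x) \<and>
         (k2 has_field_derivative pvi_l2 th1 th2 th3 y x * k2 x) (at x)) \<and>
      (\<forall>u \<in> config a b d r. let x = xvar u; Om = Omega_of b Phi u in
         y x \<notin> {0, 1, x} \<longrightarrow>
         Om$1$2 = k1 x / k2 x * (pvi_f th1 th2 th3 thinf y x / (2 * (1 - x) * y x)) \<and>
         Om$2$1 = k2 x / k1 x * (pvi_f (- th1) (- th2) th3 thinf y x / (2 * (y x - x))) \<and>
         Om$1$3 = k1 x * (pvi_f th1 (th1 - th3 - thinf) th3 thinf y x / (2 * (x - 1) * y x)) \<and>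
         Om$3$1 = 1 / k1 x *
           (pvi_f (- th1) (- th1 + th3 - thinf) th3 thinf y x / (2 * x * (y x - 1))) \<and>
         Om$2$3 = k2 x * (pvi_f (- th2 + th3 + thinf) (- th2) th3 thinf y x / (2 * (x - y x))) \<and>
         Om$3$2 = 1 / k2 x *
           (pvi_f (th2 - th3 + thinf) th2 th3 thinf y x / (2 * x * (1 - y x)))))"

end

theory Submission
  imports Defs "HOL-Complex_Analysis.Cauchy_Integral_Formula"
begin

text \<open>
  The idea is to follow two eigenvectors of \<open>\<Phi>\<close> into the limit that defines the boundary value.
  The formulas of the correspondence say that \<open>(k\<^sub>1, k\<^sub>2, 1)\<close> is a right eigenvector of \<open>\<Omega>\<close> for
  \<open>\<mu> = (- \<theta>\<^sub>1 - \<theta>\<^sub>2 - \<theta>\<^sub>3 - \<theta>\<^sub>\<infinity>) / 2\<close>, that \<open>((1 - x) y / k\<^sub>1, (x - y) / k\<^sub>2, x (y - 1))\<close> is a left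
  eigenvector for \<open>\<mu>' = (\<theta>\<^sub>\<infinity> - \<theta>\<^sub>1 - \<theta>\<^sub>2 - \<theta>\<^sub>3) / 2\<close>, and that the two are orthogonal
  (\<open>normalised_Omega_right_eigenvector\<close>, \<open>normalised_Omega_left_eigenvector\<close>).

  Put \<open>x = e\<^sup>w\<close> and \<open>s = x\<^sup>\<sigma>\<close>. The prescribed behaviour of \<open>y\<close> reads \<open>y x\<^sup>\<sigma>\<^sup>-\<^sup>1 = m\<^sub>1(s) q\<^sub>1(s) + O(|x|\<^sup>\<epsilon>)\<close>
  with factors that are linear in \<open>s\<close>, and Cauchy's inequality on discs of fixed size in the
  \<open>w\<close>-plane lets one differentiate it. The boundary value can be computed along a ray of
  constant argument, which can be chosen such that the factors stay away from 0 even for \<open>Re \<sigma> = 0\<close>, where \<open>s\<close> does not tend to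
  0 and zeros of \<open>y\<close> may accumulate at \<open>x = 0\<close>. On this ray the linear differential equations of the
  \<open>k\<^sub>i\<close> integrate to \<open>k\<^sub>1 \<sim> \<kappa>\<^sub>1 x\<^sup>(\<^sup>\<theta>\<^sup>1\<^sup>-\<^sup>\<theta>\<^sup>2\<^sup>-\<^sup>\<sigma>\<^sup>)\<^sup>/\<^sup>2 m\<^sub>1(s)\<close> and \<open>k\<^sub>2 \<sim> \<kappa>\<^sub>2 x\<^sup>(\<^sup>\<theta>\<^sup>2\<^sup>-\<^sup>\<theta>\<^sup>1\<^sup>-\<^sup>\<sigma>\<^sup>)\<^sup>/\<^sup>2 m\<^sub>2(s)\<close> with nonzero
  constants \<open>\<kappa>\<^sub>1, \<kappa>\<^sub>2\<close> (\<open>k_limits\<close>). These constants are the entries of \<open>K\<^sup>0\<close>.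

  The upper left block of the boundary value is then a limit that can be read off. Its
  eigenvalues \<open>(- \<theta>\<^sub>1 - \<theta>\<^sub>2 \<plusminus> \<sigma>) / 2\<close> differ by \<open>\<sigma> \<noteq> 0\<close>, so that the powers in the definition of the
  boundary value are explicit in an eigenbasis. In this basis the leading asymptotics give one
  component of each of the two eigenvectors, namely the dominant one when \<open>Re \<sigma> > 0\<close>. The other two
  components are determined by orthogonality and the third row of the eigenvalue equation, two
  equations whose determinant is a nonzero multiple of \<open>\<sigma>\<close>. This is the content of
  \<open>limit_matrix_from_eigenvectors\<close>, and it is the source of those terms of the boundary value that the
  leading behaviour of \<open>y\<close> does not show when \<open>Re \<sigma> > 0\<close>. The eigenvector equations with known
  eigenvectors determine the remaining column and row of the boundary value (\<open>boundary_value_of_ray\<close>).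

  Finally \<open>K\<^sup>0\<close> is unique because the nonzero off-diagonal entries of the normalised boundary value
  connect the indices 1, 2, 3 for all parameter values (\<open>boundary_matrix_connected\<close>).
\<close>

section \<open>Logarithmic coordinates on a sector, and an asymptotically constant equation\<close>

lemma clog_exp:
  assumes "\<bar>Im w - a\<bar> < pi"
  shows "clog a (exp w) = w"
proof -
  have "exp w * cis (- a) = exp (w - \<i> * of_real a)"
    by (simp add: cis_conv_exp exp_diff exp_minus field_simps)
  moreover have "Ln (exp (w - \<i> * of_real a)) = w - \<i> * of_real a"
    by (rule Ln_exp) (use assms in auto)
  ultimately show ?thesis by (simp add: clog_def)
qed

lemma exp_in_sector:
  assumes "\<bar>Im w - a\<bar> < d" "d \<le> pi"
  shows "exp w \<in> sector a d"
  using assms clog_exp[of w a] by (simp add: sector_def)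

lemma cpow_exp:
  assumes "\<bar>Im w - a\<bar> < pi"
  shows "cpow a (exp w) s = exp (s * w)"
  using assms by (simp add: cpow_def clog_exp)

lemma open_sector:
  assumes "d \<le> pi"
  shows "open (sector a d)"
proof -
  let ?g = "\<lambda>z. z * cis (- a)"
  have 1: "open (?g -` (- \<real>\<^sub>\<le>\<^sub>0))"
    by (intro open_vimage) (auto intro!: continuous_intros)
  have 2: "continuous_on (?g -` (- \<real>\<^sub>\<le>\<^sub>0)) (\<lambda>z. Im (Ln (?g z)))"
    by (auto intro!: continuous_intros)
  have "sector a d = (?g -` (- \<real>\<^sub>\<le>\<^sub>0)) \<inter> (\<lambda>z. Im (Ln (?g z))) -` {- d<..<d}"
  proof (intro set_eqI iffI)
    fix z assume z: "z \<in> sector a d"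
    then have b: "\<bar>Im (Ln (?g z))\<bar> < d" "z \<noteq> 0" by (auto simp: sector_def clog_def)
    have "?g z \<notin> \<real>\<^sub>\<le>\<^sub>0"
    proof
      assume "?g z \<in> \<real>\<^sub>\<le>\<^sub>0"
      then have "Im (Ln (?g z)) = pi"
        using b(2) by (metis (no_types) Im_Ln_eq_pi cis_neq_zero complex_nonpos_Reals_iff complex_surj
              mult_eq_0_iff order_le_less zero_complex.code)
      then show False using b assms by auto
    qed
    then show "z \<in> (?g -` (- \<real>\<^sub>\<le>\<^sub>0)) \<inter> (\<lambda>z. Im (Ln (?g z))) -` {- d<..<d}"
      using b by auto
  qed (auto simp: sector_def clog_def)
  then show ?thesis using continuous_open_preimage[OF 2 1, of "{- d<..<d}"] by simp
qed

lemma tendsto_exp_scaled_at_bot: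
  fixes eps :: real
  assumes "eps > 0"
  shows "((\<lambda>t. exp (eps * t)) \<longlongrightarrow> 0) at_bot"
proof -
  have "filterlim (\<lambda>t. eps * t) at_bot at_bot"
    using assms by (intro filterlim_tendsto_pos_mult_at_bot[OF tendsto_const]) (auto simp: filterlim_ident)
  then show ?thesis by (rule filterlim_compose[OF exp_at_bot])
qed

text \<open>
  Since \<open>e\<close> is integrable towards \<open>- \<infinity>\<close>, far enough to the left \<open>\<phi>\<close> cannot change by more than a
  quarter of its supremum. This bounds \<open>\<phi>\<close> from above and below by multiples of one of its values;
  the first bound turns the equation into a Cauchy condition and the second keeps the limit away
  from 0.
\<close>
lemma perturbed_constant_has_limit:
  fixes phi e :: "real \<Rightarrow> complex"
  assumes eps: "eps > 0"
    and der: "eventually (\<lambda>t. (phi has_vector_derivative e t * phi t) (at t)) at_bot"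
    and nz: "eventually (\<lambda>t. phi t \<noteq> 0) at_bot"
    and e: "e \<in> O[at_bot](\<lambda>t. complex_of_real (exp (eps * t)))"
  shows "\<exists>c. c \<noteq> 0 \<and> (phi \<longlongrightarrow> c) at_bot"
proof -
  from e obtain C where C: "C > 0"
    and eC: "eventually (\<lambda>t. norm (e t) \<le> C * exp (eps * t)) at_bot"
    by (elim landau_o.bigE) (auto simp del: of_real_exp)
  \<comment> \<open>an antiderivative of the bound for \<open>e\<close>, vanishing at \<open>- \<infinity>\<close>\<close>
  define B where "B t = C / eps * exp (eps * t)" for t
  have Bpos: "B t > 0" for t using C eps by (simp add: B_def)
  have Bmono: "B t \<le> B t'" if "t \<le> t'" for t t'
    using that C eps by (simp add: B_def divide_right_mono mult_left_mono)
  have Blim: "(B \<longlongrightarrow> 0) at_bot"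
    unfolding B_def by (intro tendsto_mult_right_zero tendsto_exp_scaled_at_bot eps)
  have B4: "eventually (\<lambda>t. B t < 1/4) at_bot" by (rule order_tendstoD(2)[OF Blim]) simp
  have "eventually (\<lambda>t. (phi has_vector_derivative e t * phi t) (at t) \<and> phi t \<noteq> 0 \<and>
           norm (e t) \<le> C * exp (eps * t) \<and> B t < 1/4) at_bot"
    using der nz eC B4 by eventually_elim auto
  then obtain t0 where t0: "\<And>t. t \<le> t0 \<Longrightarrow> (phi has_vector_derivative e t * phi t) (at t)"
      "\<And>t. t \<le> t0 \<Longrightarrow> norm (e t) \<le> C * exp (eps * t)" "B t0 < 1/4" "phi t0 \<noteq> 0"
    by (auto simp: eventually_at_bot_linorder)
  have cont: "continuous_on {t..t'} phi" if "t' \<le> t0" for t t'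
    using that t0(1) by (intro continuous_at_imp_continuous_on ballI)
      (meson atLeastAtMost_iff has_vector_derivative_continuous order_trans)
  have diff: "norm (phi t' - phi t) \<le> M * B t'"
    if "t \<le> t'" "t' \<le> t0" "\<And>z. t \<le> z \<Longrightarrow> z \<le> t' \<Longrightarrow> norm (phi z) \<le> M" for t t' M
  proof (cases "t = t'")
    case True
    have "0 \<le> M" using that(3)[of t] that(1) norm_ge_zero order_trans by blast
    then show ?thesis using True Bpos[of t'] by simp
  next
    case False
    have M: "0 \<le> M" using that(3)[of t] that(1) norm_ge_zero order_trans by blast
    have "norm (phi t' - phi t) \<le> M * B t' - M * B t"
    proof (rule differentiable_bound_general[where f' = "\<lambda>z. e z * phi z" and \<phi>' = "\<lambda>z. M * (C * exp (eps * z))"])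
      show "t < t'" using that False by simp
      show "continuous_on {t..t'} phi" using cont that by simp
      show "continuous_on {t..t'} (\<lambda>z. M * B z)" unfolding B_def by (intro continuous_intros)
    next
      fix z assume z: "t < z" "z < t'"
      show "(phi has_vector_derivative e z * phi z) (at z)" using t0(1) z that by simp
      show "((\<lambda>z. M * B z) has_vector_derivative M * (C * exp (eps * z))) (at z)"
        unfolding B_def has_real_derivative_iff_has_vector_derivative[symmetric]
        using eps by (auto intro!: derivative_eq_intros)
      have "norm (e z) * norm (phi z) \<le> (C * exp (eps * z)) * M"
        using t0(2)[of z] that(2,3) z C by (intro mult_mono) auto
      then show "norm (e z * phi z) \<le> M * (C * exp (eps * z))"
        by (simp add: norm_mult mult.commute)
    qed
    then show ?thesis using M Bpos[of t] by (smt (verit) mult_nonneg_nonneg)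
  qed
  have bd: "norm (phi t) \<le> 2 * norm (phi t0)" if "t \<le> t0" for t
  proof -
    have "\<exists>z\<in>{t..t0}. \<forall>z'\<in>{t..t0}. norm (phi z') \<le> norm (phi z)"
      using that cont[of t0 t] by (intro continuous_attains_sup) (auto intro: continuous_on_norm)
    then obtain z where z: "z \<in> {t..t0}" "\<And>z'. z' \<in> {t..t0} \<Longrightarrow> norm (phi z') \<le> norm (phi z)"
      by blast
    have "norm (phi t0 - phi z) \<le> norm (phi z) * B t0"
      using diff[of z t0 "norm (phi z)"] z by auto
    also have "\<dots> \<le> norm (phi z) * (1/4)" using t0(3) by (intro mult_left_mono) auto
    finally have "norm (phi z) \<le> 2 * norm (phi t0)"
      using norm_triangle_ineq2[of "phi z" "phi t0"] norm_ge_zero[of "phi z"]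
      unfolding norm_minus_commute[of "phi z"] by linarith
    then show ?thesis using z(2)[of t] that by auto
  qed
  define M where "M = 2 * norm (phi t0)"
  have close: "norm (phi t' - phi t) \<le> M * B t'" if "t \<le> t'" "t' \<le> t0" for t t'
    using diff[OF that, of M] bd that unfolding M_def by simp
  have lower: "norm (phi t) \<ge> norm (phi t0) / 2" if "t \<le> t0" for t
  proof -
    have "norm (phi t0 - phi t) \<le> M * B t0" using close that by simp
    also have "\<dots> \<le> M * (1/4)" using t0(3) by (intro mult_left_mono) (auto simp: M_def)
    finally show ?thesis
      using norm_triangle_ineq2[of "phi t0" "phi t"] by (simp add: M_def)
  qed
  have MB: "((\<lambda>t. M * B t) \<longlongrightarrow> 0) at_bot" by (rule tendsto_mult_right_zero[OF Blim])
  have neg: "filterlim (\<lambda>n. - real n) at_bot sequentially"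
    using filterlim_real_sequentially by (simp add: filterlim_uminus_at_bot)
  have MBn: "(\<lambda>n. M * B (- real n)) \<longlonglongrightarrow> 0" by (rule filterlim_compose[OF MB neg])
  have "Cauchy (\<lambda>n. phi (- real n))"
  proof (rule metric_CauchyI)
    fix r :: real assume r: "0 < r"
    have "eventually (\<lambda>n. M * B (- real n) < r \<and> - real n \<le> t0) sequentially"
      using order_tendstoD(2)[OF MBn r] neg unfolding filterlim_at_bot by (auto intro: eventually_conj)
    then obtain N where N: "\<And>n. n \<ge> N \<Longrightarrow> M * B (- real n) < r \<and> - real n \<le> t0"
      by (auto simp: eventually_sequentially)
    have *: "dist (phi (- real m)) (phi (- real n)) < r" if "m \<ge> N" "n \<ge> m" for m n
      using close[of "- real n" "- real m"] N[of m] that by (simp add: dist_norm)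
    show "\<exists>N. \<forall>m\<ge>N. \<forall>n\<ge>N. dist (phi (- real m)) (phi (- real n)) < r"
      using * by (intro exI[of _ N]) (metis dist_commute nat_le_linear)
  qed
  then obtain c where c: "(\<lambda>n. phi (- real n)) \<longlonglongrightarrow> c"
    using Cauchy_convergent_iff convergent_def by blast
  have est: "norm (phi t - c) \<le> M * B t" if "t \<le> t0" for t
  proof (rule tendsto_upperbound)
    show "((\<lambda>n. norm (phi t - phi (- real n))) \<longlongrightarrow> norm (phi t - c)) sequentially"
      by (intro tendsto_intros c)
    show "eventually (\<lambda>n. norm (phi t - phi (- real n)) \<le> M * B t) sequentially"
      using neg that close unfolding filterlim_at_bot by (force elim: eventually_mono)
  qed simp
  have lim: "(phi \<longlongrightarrow> c) at_bot"
  proof (subst tendsto_dist_iff, rule tendsto_sandwich[OF _ _ tendsto_const MB])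
    show "eventually (\<lambda>t. dist (phi t) c \<le> M * B t) at_bot"
      using est by (auto simp: eventually_at_bot_linorder dist_norm)
  qed auto
  have "norm c \<ge> norm (phi t0) / 2"
  proof (rule tendsto_lowerbound)
    show "((\<lambda>t. norm (phi t)) \<longlongrightarrow> norm c) at_bot" by (intro tendsto_intros lim)
    show "eventually (\<lambda>t. norm (phi t0) / 2 \<le> norm (phi t)) at_bot"
      using lower by (auto simp: eventually_at_bot_linorder)
  qed simp
  then have "c \<noteq> 0" using t0(4) by auto
  then show ?thesis using lim by blast
qed

section \<open>The generic solution in the logarithmic coordinate\<close>

text \<open>
  In the logarithmic coordinate the discs for Cauchy's inequality have a fixed radius, over which
  the bound \<open>exp (\<epsilon> Re w)\<close> changes only by a constant factor.
\<close>
lemma deriv_on_strip_bigo: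
  fixes F :: "complex \<Rightarrow> complex"
  assumes hol: "F holomorphic_on {w. \<bar>Im w - a\<bar> < d \<and> Re w < t0}"
    and bound: "\<And>w. \<bar>Im w - a\<bar> < d \<Longrightarrow> Re w < t0 \<Longrightarrow> norm (F w) \<le> C * exp (eps * Re w)"
    and a': "\<bar>a' - a\<bar> < d" and eps: "eps > 0" and C: "C \<ge> 0"
  shows "(\<lambda>t. deriv F (Complex t a')) \<in> O[at_bot](\<lambda>t. complex_of_real (exp (eps * t)))"
proof -
  define rho where "rho = (d - \<bar>a' - a\<bar>) / 2"
  have rho: "rho > 0" using a' by (simp add: rho_def)
  have in_strip: "\<bar>Im w - a\<bar> < d \<and> Re w < t0 \<and> Re w \<le> t + rho"
    if "w \<in> cball (Complex t a') rho" "t < t0 - rho" for w t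
  proof -
    have n: "norm (Complex t a' - w) \<le> rho" using that by (simp add: dist_norm)
    have "\<bar>t - Re w\<bar> \<le> rho" "\<bar>a' - Im w\<bar> \<le> rho"
      using abs_Re_le_cmod[of "Complex t a' - w"] abs_Im_le_cmod[of "Complex t a' - w"] n by auto
    moreover have "2 * rho = d - \<bar>a' - a\<bar>" by (simp add: rho_def)
    ultimately show ?thesis using that(2) rho by (intro conjI; linarith)
  qed
  have "norm (deriv F (Complex t a')) \<le> (C * exp (eps * rho) / rho) * exp (eps * t)"
    if t: "t < t0 - rho" for t
  proof -
    have sub: "cball (Complex t a') rho \<subseteq> {w. \<bar>Im w - a\<bar> < d \<and> Re w < t0}"
      using in_strip t by blast
    have "norm ((deriv ^^ 1) F (Complex t a')) \<le> fact 1 * (C * exp (eps * (t + rho))) / rho ^ 1"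
    proof (rule Cauchy_inequality)
      show "F holomorphic_on ball (Complex t a') rho"
        using hol sub ball_subset_cball by (meson holomorphic_on_subset order_trans)
      show "continuous_on (cball (Complex t a') rho) F"
        using hol sub by (meson holomorphic_on_subset holomorphic_on_imp_continuous_on)
      fix x assume "norm (Complex t a' - x) = rho"
      then have x: "\<bar>Im x - a\<bar> < d \<and> Re x < t0 \<and> Re x \<le> t + rho"
        using in_strip[of x t] t by (simp add: dist_norm)
      then have "norm (F x) \<le> C * exp (eps * Re x)" using bound by blast
      also have "\<dots> \<le> C * exp (eps * (t + rho))"
        using x eps C by (intro mult_left_mono) auto
      finally show "norm (F x) \<le> C * exp (eps * (t + rho))" .
    qed (rule rho)
    then show ?thesis by (simp add: exp_add algebra_simps)
  qed
  then have "eventually (\<lambda>t. norm (deriv F (Complex t a'))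
      \<le> (C * exp (eps * rho) / rho) * norm (complex_of_real (exp (eps * t)))) at_bot"
    by (auto simp del: of_real_exp simp: eventually_at_bot_dense)
  then show ?thesis by (rule bigoI)
qed

text \<open>
  Along a ray \<open>x\<^sup>\<sigma>\<close> tends to 0 if \<open>Re \<sigma> > 0\<close>. If \<open>\<sigma>\<close> is imaginary it moves on a circle, whose radius
  depends injectively on the direction of the ray; all but finitely many radii avoid the zeros of
  finitely many functions \<open>1 + b x\<^sup>\<sigma>\<close>.
\<close>
lemma direction_avoiding_zeros:
  fixes sg :: complex
  assumes sg: "sg \<noteq> 0" "Re sg \<ge> 0" and fin: "finite B" and d: "d > 0"
  obtains a' where "\<bar>a' - a\<bar> < d"
    "\<And>b. b \<in> B \<Longrightarrow> \<exists>eta>0. eventually (\<lambda>t. norm (1 + b * exp (sg * Complex t a')) \<ge> eta) at_bot"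
    "\<exists>M. eventually (\<lambda>t. norm (exp (sg * Complex t a')) \<le> M) at_bot"
proof (cases "Re sg = 0")
  case True
  define tau where "tau = Im sg"
  have tau: "tau \<noteq> 0" using True sg by (auto simp: tau_def complex_eq_iff)
  have n: "norm (exp (sg * Complex t a')) = exp (- tau * a')" for t a'
    using True by (simp add: tau_def)
  \<comment> \<open>the directions for which a zero \<open>- 1 / b\<close> lies on the circle\<close>
  define bad where "bad = (\<lambda>b. - ln (1 / norm b) / tau) ` B"
  have "infinite {a - d <..< a + d}" using d by (simp add: infinite_Ioo)
  then obtain a' where a': "a' \<in> {a - d <..< a + d}" "a' \<notin> bad"
    using fin unfolding bad_def by (meson finite_imageI finite_subset subsetI)
  show thesis
  proof
    show "\<bar>a' - a\<bar> < d" using a' by auto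
    show "\<exists>M. eventually (\<lambda>t. norm (exp (sg * Complex t a')) \<le> M) at_bot"
      unfolding n by (intro exI[of _ "exp (- tau * a')"]) simp
    fix b assume b: "b \<in> B"
    define eta where "eta = \<bar>1 - norm b * exp (- tau * a')\<bar>"
    have "eta \<noteq> 0"
    proof
      assume "eta = 0"
      then have e: "norm b * exp (- tau * a') = 1" by (simp add: eta_def)
      then have "norm b > 0" by (metis less_le mult_zero_left norm_ge_zero zero_neq_one)
      then have "exp (- tau * a') = 1 / norm b" using e by (simp add: field_simps)
      then have "- tau * a' = ln (1 / norm b)" by (metis ln_exp)
      then have "a' = - ln (1 / norm b) / tau" using tau by (simp add: field_simps)
      then show False using a' b by (auto simp: bad_def)
    qed
    then have "eta > 0" by (simp add: eta_def)
    moreover have "norm (1 + b * exp (sg * Complex t a')) \<ge> eta" for t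
    proof -
      have "\<bar>norm (1::complex) - norm (- (b * exp (sg * Complex t a')))\<bar> \<le>
          norm (1 - (- (b * exp (sg * Complex t a'))))" by (rule norm_triangle_ineq3)
      then show ?thesis unfolding eta_def norm_minus_cancel norm_mult n by simp
    qed
    ultimately show "\<exists>eta>0. eventually (\<lambda>t. norm (1 + b * exp (sg * Complex t a')) \<ge> eta) at_bot"
      by (intro exI[of _ eta]) simp
  qed
next
  case False
  then have pos: "Re sg > 0" using sg by simp
  have "((\<lambda>t. exp (sg * Complex t a)) \<longlongrightarrow> 0) at_bot"
  proof (subst tendsto_norm_zero_iff[symmetric])
    have "((\<lambda>t. exp (Re sg * t)) \<longlongrightarrow> 0) at_bot"
      by (rule tendsto_exp_scaled_at_bot[OF pos])
    then have "((\<lambda>t. exp (Re sg * t) * exp (- Im sg * a)) \<longlongrightarrow> 0) at_bot"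
      by (rule tendsto_mult_left_zero)
    then show "((\<lambda>t. norm (exp (sg * Complex t a))) \<longlongrightarrow> 0) at_bot"
      unfolding norm_exp_eq_Re exp_add[symmetric] by simp
  qed
  note lim = this
  show thesis
  proof
    show "\<bar>a - a\<bar> < d" using d by simp
    have "eventually (\<lambda>t. norm (exp (sg * Complex t a)) < 1) at_bot"
      using order_tendstoD(2)[OF tendsto_norm[OF lim], of 1] by simp
    then show "\<exists>M. eventually (\<lambda>t. norm (exp (sg * Complex t a)) \<le> M) at_bot"
      by (intro exI[of _ 1]) (auto elim: eventually_mono)
    fix b
    have "((\<lambda>t. norm (1 + b * exp (sg * Complex t a))) \<longlongrightarrow> norm (1 + b * 0)) at_bot"
      by (intro tendsto_intros lim)
    then have "eventually (\<lambda>t. norm (1 + b * exp (sg * Complex t a)) > 1/2) at_bot"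
      by (rule order_tendstoD) simp
    then show "\<exists>eta>0. eventually (\<lambda>t. norm (1 + b * exp (sg * Complex t a)) \<ge> eta) at_bot"
      by (intro exI[of _ "1/2"]) (auto elim: eventually_mono)
  qed
qed

text \<open>
  The expansion \<open>y x\<^sup>\<sigma>\<^sup>-\<^sup>1 \<approx> J + J\<^sub>2 s + J\<^sub>1 s\<^sup>2\<close> with \<open>s = x\<^sup>\<sigma>\<close> splits into linear factors, and so does
  \<open>(y - x) x\<^sup>\<sigma>\<^sup>-\<^sup>1\<close>. Here \<open>m1\<close> and \<open>m2\<close> describe the right eigenvector \<open>(k\<^sub>1, k\<^sub>2)\<close>, and \<open>q1\<close> and \<open>q2\<close> the left
  one: in the eigenbasis of the upper left block of the boundary value, \<open>alpha\<close> is the coordinate of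
  the right eigenvector that is not visible in the leading asymptotics for \<open>Re \<sigma> > 0\<close>, and \<open>beta\<close> is,
  up to the factor \<open>- 2 \<sigma>\<close>, the corresponding coordinate of the left eigenvector.
\<close>
locale jimbo_data =
  fixes sg J th1 th2 :: complex
  assumes sg_nz: "sg \<noteq> 0" and J_nz: "J \<noteq> 0"
begin

definition "alpha = (th1 + th2 - sg) / (4 * sg\<^sup>2 * J)"
definition "beta = (th1 + th2 + sg) / (4 * sg\<^sup>2)"
definition "m1 s = 1 + alpha * (th1 - th2 - sg) * s"
definition "m2 s = 1 + alpha * (th1 - th2 + sg) * s"
definition "q1 s = J + beta * (th1 - th2 + sg) * s"
definition "q2 s = J + beta * (th1 - th2 - sg) * s"

lemma m1_q1: "m1 s * q1 s = J + PVI_J2 sg th1 th2 * s + PVI_J1 sg J th1 th2 * s\<^sup>2"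
  using sg_nz J_nz unfolding m1_def q1_def alpha_def beta_def PVI_J1_def PVI_J2_def
  by (simp add: divide_simps) algebra

lemma m2_q2: "m2 s * q2 s = m1 s * q1 s - s"
  using sg_nz J_nz unfolding m1_def q1_def m2_def q2_def alpha_def beta_def
  by (simp add: divide_simps) algebra

text \<open>
  One estimate for both cases in the definition of a generic solution. For \<open>Re \<sigma> > 0\<close> the terms
  \<open>J\<^sub>2 s + J\<^sub>1 s\<^sup>2\<close> are themselves an error, of the order of \<open>|x|\<close> to the power \<open>Re \<sigma>\<close>. The bound \<open>\<epsilon> < 1 - Re \<sigma>\<close> makes \<open>y\<close> itself
  of order \<open>|x|\<^sup>\<epsilon>\<close>, and \<open>x\<close> as well because \<open>Re \<sigma> \<ge> 0\<close>.
\<close>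
lemma generic_solution_log_coordinate:
  assumes d: "d \<le> pi" and gen: "PVI_generic_solution a d r sg J th1 th2 th3 thinf y"
  obtains eps C t0 where "0 < eps" "eps < 1 - Re sg" "C \<ge> 0"
    "\<And>w. \<bar>Im w - a\<bar> < d \<Longrightarrow> Re w < t0 \<Longrightarrow>
       norm (exp ((sg - 1) * w) * y (exp w) - m1 (exp (sg * w)) * q1 (exp (sg * w)))
         \<le> C * exp (eps * Re w)"
proof -
  have transfer: "\<exists>c t0. c > 0 \<and> (\<forall>w. \<bar>Im w - a\<bar> < d \<and> Re w < t0 \<longrightarrow>
      norm (f (exp w)) \<le> c * norm (exp (e * w)))"
    if O: "f \<in> O[at 0 within sector a d](\<lambda>x. cpow a x e)" for f and e :: complex
  proof -
    obtain c where c: "c > 0"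
      "eventually (\<lambda>x. norm (f x) \<le> c * norm (cpow a x e)) (at 0 within sector a d)"
      using O by (elim landau_o.bigE)
    then obtain del where del: "del > 0"
      "\<And>x. x \<in> sector a d \<Longrightarrow> x \<noteq> 0 \<Longrightarrow> norm x < del \<Longrightarrow> norm (f x) \<le> c * norm (cpow a x e)"
      by (auto simp: eventually_at)
    have "norm (f (exp w)) \<le> c * norm (exp (e * w))" if "\<bar>Im w - a\<bar> < d" "Re w < ln del" for w
    proof -
      have "norm (exp w) < del" using that(2) del(1) by (metis exp_less_cancel_iff exp_ln norm_exp_eq_Re)
      then show ?thesis using del(2)[of "exp w"] exp_in_sector[of w a d] cpow_exp[of w a e] that d
        by auto
    qed
    then show ?thesis using c by blast
  qed
  have sg01: "0 \<le> Re sg" "Re sg < 1" using gen by (auto simp: PVI_generic_solution_def)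
  show thesis
  proof (cases "Re sg = 0")
    case True
    then have "(\<lambda>x. y x - (J * cpow a x (1 - sg) + PVI_J1 sg J th1 th2 * cpow a x (1 + sg)
                   + PVI_J2 sg th1 th2 * x))
        \<in> O[at 0 within sector a d](\<lambda>x. cpow a x (2 - sg))"
      using gen sg_nz by (auto simp: PVI_generic_solution_def)
    from transfer[OF this] obtain c t0 where c: "c > 0"
      "\<And>w. \<bar>Im w - a\<bar> < d \<Longrightarrow> Re w < t0 \<Longrightarrow>
        norm (y (exp w) - (J * cpow a (exp w) (1 - sg) + PVI_J1 sg J th1 th2 * cpow a (exp w) (1 + sg)
                   + PVI_J2 sg th1 th2 * exp w)) \<le> c * norm (exp ((2 - sg) * w))" by blast
    have main: "norm (exp ((sg - 1) * w) * y (exp w) - m1 (exp (sg * w)) * q1 (exp (sg * w)))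
         \<le> c * exp (1/2 * Re w)" if w: "\<bar>Im w - a\<bar> < d" "Re w < min t0 0" for w
    proof -
      let ?R = "y (exp w) - (J * exp ((1 - sg) * w) + PVI_J1 sg J th1 th2 * exp ((1 + sg) * w)
                   + PVI_J2 sg th1 th2 * exp w)"
      have w': "\<bar>Im w - a\<bar> < pi" using w d by simp
      have x: "exp ((sg - 1) * w) * exp ((1 - sg) * w) = 1"
        "exp ((sg - 1) * w) * exp ((1 + sg) * w) = (exp (sg * w))\<^sup>2"
        "exp ((sg - 1) * w) * exp w = exp (sg * w)"
        "exp ((sg - 1) * w) * exp ((2 - sg) * w) = exp w"
        by (simp_all add: algebra_simps power2_eq_square flip: exp_add)
      have alg: "E * Y - (J + j2 * s + j1 * s\<^sup>2) = E * (Y - (J * A + j1 * B + j2 * X))"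
        if "E * A = 1" "E * B = s\<^sup>2" "E * X = s" for E A B X Y s j1 j2 :: complex
        using that by algebra
      have "exp ((sg - 1) * w) * y (exp w) - m1 (exp (sg * w)) * q1 (exp (sg * w))
        = exp ((sg - 1) * w) * ?R"
        unfolding m1_q1 by (rule alg[OF x(1-3)])
      also have "norm \<dots> \<le> norm (exp ((sg - 1) * w)) * (c * norm (exp ((2 - sg) * w)))"
        unfolding norm_mult using c(2)[of w] w
        by (intro mult_left_mono) (auto simp: cpow_exp[OF w'])
      also have "\<dots> = c * norm (exp ((sg - 1) * w) * exp ((2 - sg) * w))"
        by (simp add: norm_mult)
      also have "\<dots> = c * exp (Re w)" unfolding x by simp
      also have "\<dots> \<le> c * exp (1/2 * Re w)" using w c by (intro mult_left_mono) auto
      finally show ?thesis .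
    qed
    show thesis by (rule that[of "1/2" c "min t0 0"]) (use main c True in auto)
  next
    case False
    then have pos: "Re sg > 0" using sg01 by simp
    then obtain e :: real where e: "e > 0" "(\<lambda>x. y x - J * cpow a x (1 - sg))
          \<in> O[at 0 within sector a d](\<lambda>x. cpow a x (1 - sg + of_real e))"
      using gen by (auto simp: PVI_generic_solution_def)
    from transfer[OF e(2)] obtain c t0 where c: "c > 0"
      "\<And>w. \<bar>Im w - a\<bar> < d \<Longrightarrow> Re w < t0 \<Longrightarrow>
        norm (y (exp w) - J * cpow a (exp w) (1 - sg)) \<le> c * norm (exp ((1 - sg + of_real e) * w))"
      by blast
    define eps where "eps = min (min e (Re sg)) ((1 - Re sg) / 2)"
    \<comment> \<open>a bound for \<open>|s|\<close> on the part \<open>|x| < 1\<close> of the sector\<close>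
    define K where "K = exp (\<bar>Im sg\<bar> * (\<bar>a\<bar> + pi))"
    define N where "N = norm (PVI_J2 sg th1 th2) + norm (PVI_J1 sg J th1 th2) * K"
    have K: "K > 0" by (simp add: K_def)
    have N: "N \<ge> 0" using K by (simp add: N_def)
    have main: "norm (exp ((sg - 1) * w) * y (exp w) - m1 (exp (sg * w)) * q1 (exp (sg * w)))
         \<le> (c + K * N) * exp (eps * Re w)" if w: "\<bar>Im w - a\<bar> < d" "Re w < min t0 0" for w
    proof -
      have w': "\<bar>Im w - a\<bar> < pi" using w d by simp
      have x: "exp ((sg - 1) * w) * exp ((1 - sg) * w) = 1"
        "exp ((sg - 1) * w) * exp ((1 - sg + of_real e) * w) = exp (of_real e * w)"
        by (simp_all add: algebra_simps flip: exp_add)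
      have le: "exp (e' * Re w) \<le> exp (eps * Re w)" if "eps \<le> e'" for e'
        using that w by (simp add: mult_right_mono_neg)
      let ?s = "exp (sg * w)"
      have "Re (sg * w) \<le> Re sg * Re w + \<bar>Im sg\<bar> * (\<bar>a\<bar> + pi)"
      proof -
        have "- (Im sg * Im w) \<le> \<bar>Im sg * Im w\<bar>" by simp
        also have "\<dots> \<le> \<bar>Im sg\<bar> * (\<bar>a\<bar> + pi)"
          unfolding abs_mult using w' by (intro mult_left_mono) auto
        finally show ?thesis by simp
      qed
      then have s: "norm ?s \<le> K * exp (Re sg * Re w)"
        by (simp add: K_def add.commute flip: exp_add)
      also have "\<dots> \<le> K * 1" using w pos K by (intro mult_left_mono) (auto simp: mult_pos_neg less_imp_le)
      finally have s1: "norm ?s \<le> K" by simp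
      have s2: "norm ?s \<le> K * exp (eps * Re w)"
        using s le[of "Re sg"] K by (smt (verit) eps_def mult_left_mono)
      have A: "norm (exp ((sg - 1) * w) * (y (exp w) - J * exp ((1 - sg) * w))) \<le> c * exp (eps * Re w)"
      proof -
        have "norm (exp ((sg - 1) * w) * (y (exp w) - J * exp ((1 - sg) * w)))
          \<le> norm (exp ((sg - 1) * w)) * (c * norm (exp ((1 - sg + of_real e) * w)))"
          unfolding norm_mult using c(2)[of w] w
          by (intro mult_left_mono) (auto simp: cpow_exp[OF w'])
        also have "\<dots> = c * norm (exp ((sg - 1) * w) * exp ((1 - sg + of_real e) * w))"
          by (simp add: norm_mult)
        also have "\<dots> = c * exp (e * Re w)" unfolding x by simp
        also have "\<dots> \<le> c * exp (eps * Re w)"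
          using le[of e] c by (intro mult_left_mono) (auto simp: eps_def)
        finally show ?thesis .
      qed
      have "norm (PVI_J2 sg th1 th2 + PVI_J1 sg J th1 th2 * ?s) \<le> N"
        unfolding N_def using s1
        by (intro norm_triangle_le add_mono) (auto simp: norm_mult mult_left_mono)
      then have Bd: "norm (?s * (PVI_J2 sg th1 th2 + PVI_J1 sg J th1 th2 * ?s))
          \<le> (K * exp (eps * Re w)) * N"
        unfolding norm_mult using s2 K by (intro mult_mono) auto
      have alg: "E * Y - (J + j2 * s + j1 * s\<^sup>2) = E * (Y - J * A) - s * (j2 + j1 * s)"
        if "E * A = 1" for E A Y s j1 j2 :: complex
        using that by algebra
      have "exp ((sg - 1) * w) * y (exp w) - m1 ?s * q1 ?s
        = exp ((sg - 1) * w) * (y (exp w) - J * exp ((1 - sg) * w))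
          - ?s * (PVI_J2 sg th1 th2 + PVI_J1 sg J th1 th2 * ?s)"
        unfolding m1_q1 by (rule alg[OF x(1)])
      also have "norm \<dots> \<le> c * exp (eps * Re w) + (K * exp (eps * Re w)) * N"
        using norm_triangle_ineq4 A Bd by (rule order_trans[OF _ add_mono])
      finally show ?thesis by (simp add: algebra_simps)
    qed
    have "eps > 0" "eps < 1 - Re sg" using e pos sg01 by (auto simp: eps_def min_def)
    moreover have "c + K * N \<ge> 0" using c K N by simp
    ultimately show thesis by (rule that[of eps "c + K * N" "min t0 0"]) (use main in auto)
  qed
qed

end

section \<open>Asymptotics with an exponentially small error along a ray\<close>

text \<open>
  Functions of \<open>t = log |x| \<rightarrow> - \<infinity>\<close> on a ray, up to errors of order \<open>|x|\<^sup>\<epsilon>\<close>. Unlike mere convergence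
  of differences, such errors are integrable in \<open>t\<close>, which the differential equations of the \<open>k\<^sub>i\<close>
  require.
\<close>
definition exp_small :: "real \<Rightarrow> (real \<Rightarrow> complex) \<Rightarrow> bool"
  where "exp_small eps f \<longleftrightarrow> f \<in> O[at_bot](\<lambda>t. complex_of_real (exp (eps * t)))"

definition exp_close :: "real \<Rightarrow> (real \<Rightarrow> complex) \<Rightarrow> (real \<Rightarrow> complex) \<Rightarrow> bool"
  where "exp_close eps f g \<longleftrightarrow> exp_small eps (\<lambda>t. f t - g t)"

text \<open>
  Division needs a lower bound; boundedness of \<open>1 / f\<close> would not do, because \<open>1 / 0 = 0\<close>.
\<close>
definition apart_zero :: "(real \<Rightarrow> complex) \<Rightarrow> bool"
  where "apart_zero f \<longleftrightarrow> (\<exists>eta>0. eventually (\<lambda>t. norm (f t) \<ge> eta) at_bot)"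

abbreviation bdd :: "(real \<Rightarrow> complex) \<Rightarrow> bool"
  where "bdd f \<equiv> f \<in> O[at_bot](\<lambda>_. 1)"

lemma exp_small_tendsto:
  assumes "exp_small eps f" "eps > 0"
  shows "(f \<longlongrightarrow> 0) at_bot"
proof -
  obtain c where "eventually (\<lambda>t. norm (f t) \<le> c * exp (eps * t)) at_bot"
    using assms(1) unfolding exp_small_def by (elim landau_o.bigE) (auto simp del: of_real_exp)
  moreover have "((\<lambda>t. c * exp (eps * t)) \<longlongrightarrow> 0) at_bot"
    by (intro tendsto_mult_right_zero tendsto_exp_scaled_at_bot assms)
  ultimately show ?thesis by (rule Lim_null_comparison)
qed

lemma tendsto_bdd:
  assumes "(f \<longlongrightarrow> c) at_bot"
  shows "bdd f"
proof (rule bigoI)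
  have "eventually (\<lambda>t. norm (f t) < norm c + 1) at_bot"
    by (rule order_tendstoD(2)[OF tendsto_norm[OF assms]]) simp
  then show "eventually (\<lambda>t. norm (f t) \<le> (norm c + 1) * norm (1::complex)) at_bot"
    by eventually_elim simp
qed

lemma bdd_add: "bdd f \<Longrightarrow> bdd g \<Longrightarrow> bdd (\<lambda>t. f t + g t)"
  by (rule sum_in_bigo)
lemma bdd_diff: "bdd f \<Longrightarrow> bdd g \<Longrightarrow> bdd (\<lambda>t. f t - g t)"
  by (rule sum_in_bigo)
lemma bdd_mult: "bdd f \<Longrightarrow> bdd g \<Longrightarrow> bdd (\<lambda>t. f t * g t)"
  by (rule landau_o.big.mult_in_1)
lemma bdd_const: "bdd (\<lambda>_. c)"
  by simp
lemmas bdd_intros = bdd_add bdd_diff bdd_mult bdd_const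

lemma bdd_null_mult:
  assumes "bdd f" "(g \<longlongrightarrow> 0) at_bot"
  shows "((\<lambda>t. f t * g t) \<longlongrightarrow> 0) at_bot"
proof -
  obtain c where "eventually (\<lambda>t. norm (f t) \<le> c) at_bot"
    using assms(1) by (elim landau_o.bigE) auto
  then have "eventually (\<lambda>t. norm (f t * g t) \<le> c * norm (g t)) at_bot"
    by eventually_elim (auto simp: norm_mult mult_right_mono)
  moreover have "((\<lambda>t. c * norm (g t)) \<longlongrightarrow> 0) at_bot"
    by (intro tendsto_mult_right_zero tendsto_norm_zero assms)
  ultimately show ?thesis by (rule Lim_null_comparison)
qed

lemma apart_zero_nz: "apart_zero f \<Longrightarrow> eventually (\<lambda>t. f t \<noteq> 0) at_bot"
  unfolding apart_zero_def by (auto elim!: eventually_mono)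

lemma apart_zero_const: "c \<noteq> 0 \<Longrightarrow> apart_zero (\<lambda>_. c)"
  unfolding apart_zero_def by (intro exI[of _ "norm c"]) auto

lemma apart_zero_mult:
  assumes "apart_zero f" "apart_zero g"
  shows "apart_zero (\<lambda>t. f t * g t)"
proof -
  obtain x y where xy: "x > 0" "y > 0" "eventually (\<lambda>t. norm (f t) \<ge> x) at_bot"
      "eventually (\<lambda>t. norm (g t) \<ge> y) at_bot"
    using assms unfolding apart_zero_def by blast
  have "eventually (\<lambda>t. norm (f t * g t) \<ge> x * y) at_bot"
    using xy(3,4) by eventually_elim (use xy(1,2) in \<open>auto simp: norm_mult intro!: mult_mono\<close>)
  then show ?thesis using xy unfolding apart_zero_def by (intro exI[of _ "x * y"]) auto
qed

lemma apart_zero_perturb: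
  assumes "apart_zero g" "((\<lambda>t. f t - g t) \<longlongrightarrow> 0) at_bot"
  shows "apart_zero f"
proof -
  obtain x where x: "x > 0" "eventually (\<lambda>t. norm (g t) \<ge> x) at_bot"
    using assms unfolding apart_zero_def by blast
  have "eventually (\<lambda>t. norm (f t - g t) < x / 2) at_bot"
    using order_tendstoD(2)[OF tendsto_norm_zero[OF assms(2)], of "x/2"] x by simp
  with x(2) have "eventually (\<lambda>t. norm (f t) \<ge> x / 2) at_bot"
  proof eventually_elim
    case (elim t)
    then show ?case using norm_triangle_ineq2[of "g t" "f t"] by (simp add: norm_minus_commute)
  qed
  then show ?thesis using x unfolding apart_zero_def by (intro exI[of _ "x / 2"]) auto
qed

lemma bdd_inverse:
  assumes "apart_zero f"
  shows "bdd (\<lambda>t. 1 / f t)"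
proof -
  obtain x where x: "x > 0" "eventually (\<lambda>t. norm (f t) \<ge> x) at_bot"
    using assms unfolding apart_zero_def by blast
  have "eventually (\<lambda>t. norm (1 / f t) \<le> (1 / x) * norm (1::complex)) at_bot"
    using x(2) by eventually_elim (use x(1) in \<open>auto simp: norm_divide divide_simps\<close>)
  then show ?thesis by (rule bigoI)
qed

lemma bdd_divide: "bdd f \<Longrightarrow> apart_zero g \<Longrightarrow> bdd (\<lambda>t. f t / g t)"
  using bdd_mult[OF _ bdd_inverse] by (simp add: divide_inverse)

lemma exp_small_bdd: "exp_small eps f \<Longrightarrow> eps > 0 \<Longrightarrow> bdd f"
  by (rule tendsto_bdd[OF exp_small_tendsto])

lemma exp_small_add: "exp_small eps f \<Longrightarrow> exp_small eps g \<Longrightarrow> exp_small eps (\<lambda>t. f t + g t)"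
  unfolding exp_small_def by (rule sum_in_bigo)

lemma exp_small_diff: "exp_small eps f \<Longrightarrow> exp_small eps g \<Longrightarrow> exp_small eps (\<lambda>t. f t - g t)"
  unfolding exp_small_def by (rule sum_in_bigo)

lemma exp_small_mult: "exp_small eps f \<Longrightarrow> bdd g \<Longrightarrow> exp_small eps (\<lambda>t. f t * g t)"
  unfolding exp_small_def using landau_o.big.mult[of f _ _ g "\<lambda>_. 1"] by simp

lemma exp_small_mult': "bdd g \<Longrightarrow> exp_small eps f \<Longrightarrow> exp_small eps (\<lambda>t. g t * f t)"
  using exp_small_mult[of eps f g] by (simp add: mult.commute)

lemma exp_close_refl: "exp_close eps f f"
  by (simp add: exp_close_def exp_small_def)

lemma exp_close_zero: "exp_close eps f (\<lambda>_. 0) \<longleftrightarrow> exp_small eps f"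
  by (simp add: exp_close_def)

lemma exp_close_bdd:
  assumes "exp_close eps f g" "eps > 0" "bdd g" shows "bdd f"
  using bdd_add[OF exp_small_bdd[OF assms(1)[unfolded exp_close_def] assms(2)] assms(3)] by simp

lemma exp_close_add:
  assumes "exp_close eps f f'" "exp_close eps g g'"
  shows "exp_close eps (\<lambda>t. f t + g t) (\<lambda>t. f' t + g' t)"
  using exp_small_add[OF assms[unfolded exp_close_def]] by (simp add: exp_close_def algebra_simps)

lemma exp_close_diff:
  assumes "exp_close eps f f'" "exp_close eps g g'"
  shows "exp_close eps (\<lambda>t. f t - g t) (\<lambda>t. f' t - g' t)"
  using exp_small_diff[OF assms[unfolded exp_close_def]] by (simp add: exp_close_def algebra_simps)

lemma exp_close_mult:
  assumes eps: "eps > 0" and f: "exp_close eps f f'" and g: "exp_close eps g g'"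
    and b: "bdd f'" "bdd g'"
  shows "exp_close eps (\<lambda>t. f t * g t) (\<lambda>t. f' t * g' t)"
proof -
  have "exp_small eps (\<lambda>t. (f t - f' t) * g t + f' t * (g t - g' t))"
    using f g b exp_close_bdd[OF g eps b(2)] unfolding exp_close_def
    by (intro exp_small_add exp_small_mult exp_small_mult')
  then show ?thesis by (simp add: exp_close_def algebra_simps)
qed

lemma exp_close_apart:
  assumes "exp_close eps f g" "eps > 0" "apart_zero g" shows "apart_zero f"
  using assms by (intro apart_zero_perturb[OF assms(3)] exp_small_tendsto) (auto simp: exp_close_def)

lemma exp_close_divide:
  assumes eps: "eps > 0" and f: "exp_close eps f f'" and g: "exp_close eps g g'"
    and b: "bdd f'" "apart_zero g'"
  shows "exp_close eps (\<lambda>t. f t / g t) (\<lambda>t. f' t / g' t)"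
proof -
  have ag: "apart_zero g" by (rule exp_close_apart[OF g eps b(2)])
  have "exp_small eps (\<lambda>t. (f t - f' t) * (1 / g t) - (g t - g' t) * ((f' t / g' t) * (1 / g t)))"
    using f g b ag unfolding exp_close_def
    by (intro exp_small_diff[OF exp_small_mult[of _ "\<lambda>t. f t - f' t"] exp_small_mult[of _ "\<lambda>t. g t - g' t"]]
        bdd_inverse bdd_mult bdd_divide)
  moreover have "eventually (\<lambda>t. (f t - f' t) * (1 / g t) - (g t - g' t) * ((f' t / g' t) * (1 / g t))
      = f t / g t - f' t / g' t) at_bot"
    using apart_zero_nz[OF ag] apart_zero_nz[OF b(2)] by eventually_elim (simp add: field_simps)
  ultimately show ?thesis
    unfolding exp_close_def exp_small_def by (simp cong: landau_o.big.in_cong)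
qed

lemma exp_close_cong:
  assumes "exp_close eps f g" "eventually (\<lambda>t. f t = f' t) at_bot" "eventually (\<lambda>t. g t = g' t) at_bot"
  shows "exp_close eps f' g'"
proof -
  have "eventually (\<lambda>t. f t - g t = f' t - g' t) at_bot"
    using assms(2,3) by eventually_elim simp
  from landau_o.big.in_cong[OF this] show ?thesis
    using assms(1) unfolding exp_close_def exp_small_def by simp
qed

lemma exp_close_tendsto: "exp_close eps f g \<Longrightarrow> eps > 0 \<Longrightarrow> ((\<lambda>t. f t - g t) \<longlongrightarrow> 0) at_bot"
  unfolding exp_close_def by (rule exp_small_tendsto)

lemma exp_small_exp_mult_ray:
  assumes "eps \<le> Re c"
  shows "exp_small eps (\<lambda>t. exp (c * Complex t a'))"
  unfolding exp_small_def
proof (rule bigoI)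
  show "eventually (\<lambda>t. norm (exp (c * Complex t a'))
      \<le> exp (- Im c * a') * norm (complex_of_real (exp (eps * t)))) at_bot"
    using eventually_le_at_bot[of 0]
  proof eventually_elim
    case (elim t)
    have "Re c * t \<le> eps * t" using elim assms by (rule mult_right_mono_neg[rotated])
    then have "Re (c * Complex t a') \<le> - Im c * a' + eps * t" by simp
    then show ?case unfolding norm_exp_eq_Re norm_of_real abs_exp_cancel exp_add[symmetric] by simp
  qed
qed

text \<open>
  The information on \<open>y\<close> that is used from here on: its leading behaviour and that of \<open>x y'\<close> on a ray
  of argument \<open>a'\<close> on which the linear factors stay away from 0. The comparison function for
  \<open>x\<^sup>\<sigma> y'\<close> is \<open>\<sigma> s G'(s) + (1 - \<sigma>) G(s)\<close> with \<open>G = m\<^sub>1 q\<^sub>1\<close>, the result of differentiating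
  \<open>x\<^sup>1\<^sup>-\<^sup>\<sigma> G(x\<^sup>\<sigma>)\<close> term by term.
\<close>
locale generic_ray = jimbo_data +
  fixes y :: "complex \<Rightarrow> complex" and a' eps :: real
  assumes eps: "eps > 0" "eps < 1 - Re sg" and Re_sg: "Re sg \<ge> 0"
    and s_bdd: "bdd (\<lambda>t. exp (sg * Complex t a'))"
    and ap: "apart_zero (\<lambda>t. m1 (exp (sg * Complex t a')))"
      "apart_zero (\<lambda>t. m2 (exp (sg * Complex t a')))"
      "apart_zero (\<lambda>t. q1 (exp (sg * Complex t a')))"
      "apart_zero (\<lambda>t. q2 (exp (sg * Complex t a')))"
    and p_close0: "exp_close eps (\<lambda>t. exp ((sg - 1) * Complex t a') * y (exp (Complex t a')))
        (\<lambda>t. m1 (exp (sg * Complex t a')) * q1 (exp (sg * Complex t a')))"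
    and r_close0: "exp_close eps
        (\<lambda>t. exp ((sg - 1) * Complex t a') * (exp (Complex t a') * deriv y (exp (Complex t a'))))
        (\<lambda>t. sg * exp (sg * Complex t a') * (PVI_J2 sg th1 th2 + 2 * PVI_J1 sg J th1 th2 * exp (sg * Complex t a'))
             + (1 - sg) * (m1 (exp (sg * Complex t a')) * q1 (exp (sg * Complex t a'))))"
begin

definition "X t = exp (Complex t a')"
definition "s t = exp (sg * Complex t a')"
text \<open>
  \<open>y\<close> and \<open>x y'\<close>, scaled by \<open>x\<^sup>\<sigma>\<^sup>-\<^sup>1\<close> so that they are bounded.
\<close>
definition "p t = exp ((sg - 1) * Complex t a') * y (X t)"
definition "r t = exp ((sg - 1) * Complex t a') * (X t * deriv y (X t))"
definition "R t = sg * s t * (PVI_J2 sg th1 th2 + 2 * PVI_J1 sg J th1 th2 * s t)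
             + (1 - sg) * (m1 (s t) * q1 (s t))"
definition "Om12 th3 thinf t = pvi_f th1 th2 th3 thinf y (X t) / (2 * (1 - X t) * y (X t))"
definition "Om21 th3 thinf t = pvi_f (- th1) (- th2) th3 thinf y (X t) / (2 * (y (X t) - X t))"

lemma s_bdd': "bdd s" using s_bdd unfolding s_def .
lemma m_bdd: "bdd (\<lambda>t. m1 (s t))" "bdd (\<lambda>t. m2 (s t))" "bdd (\<lambda>t. q1 (s t))" "bdd (\<lambda>t. q2 (s t))"
  unfolding m1_def m2_def q1_def q2_def by (intro bdd_intros s_bdd')+
lemma m_apart: "apart_zero (\<lambda>t. m1 (s t))" "apart_zero (\<lambda>t. m2 (s t))"
  "apart_zero (\<lambda>t. q1 (s t))" "apart_zero (\<lambda>t. q2 (s t))"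
  using ap unfolding s_def .
lemma p_close: "exp_close eps p (\<lambda>t. m1 (s t) * q1 (s t))"
  using p_close0 unfolding p_def s_def X_def .
lemma r_close: "exp_close eps r R"
  using r_close0 unfolding r_def R_def s_def X_def .
lemma R_bdd: "bdd R"
  unfolding R_def by (intro bdd_intros s_bdd' m_bdd)

lemma X_small: "exp_small eps X"
  using exp_small_exp_mult_ray[of eps 1 a'] eps Re_sg by (simp add: X_def[abs_def])

lemma y_eq: "y (X t) = exp ((1 - sg) * Complex t a') * p t"
  by (simp add: p_def algebra_simps flip: exp_add mult.assoc)

lemma X_eq: "X t = exp ((1 - sg) * Complex t a') * s t"
  by (simp add: s_def X_def algebra_simps flip: exp_add)

lemma p_bdd: "bdd p" by (rule exp_close_bdd[OF p_close eps(1)]) (intro bdd_intros m_bdd)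

lemma y_small: "exp_small eps (\<lambda>t. y (X t))"
  unfolding y_eq using eps by (intro exp_small_mult p_bdd exp_small_exp_mult_ray) simp

lemma ps_close: "exp_close eps (\<lambda>t. p t - s t) (\<lambda>t. m2 (s t) * q2 (s t))"
  unfolding m2_q2 by (intro exp_close_diff p_close exp_close_refl)

lemma p_apart: "apart_zero p"
  by (rule exp_close_apart[OF p_close eps(1)]) (intro apart_zero_mult m_apart)

lemma ps_apart: "apart_zero (\<lambda>t. p t - s t)"
  by (rule exp_close_apart[OF ps_close eps(1)]) (intro apart_zero_mult m_apart)

lemma regular: "eventually (\<lambda>t. y (X t) \<notin> {0, 1, X t}) at_bot"
proof -
  have "eventually (\<lambda>t. norm (y (X t)) < 1) at_bot"
    using order_tendstoD(2)[OF tendsto_norm[OF exp_small_tendsto[OF y_small eps(1)]], of 1] by simp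
  with apart_zero_nz[OF p_apart] apart_zero_nz[OF ps_apart] show ?thesis
  proof eventually_elim
    case (elim t)
    have "y (X t) - X t = exp ((1 - sg) * Complex t a') * (p t - s t)"
      unfolding y_eq by (subst X_eq) (simp add: algebra_simps)
    then have "y (X t) \<noteq> X t" using elim by (metis exp_not_eq_zero mult_eq_0_iff right_minus_eq)
    moreover have "y (X t) \<noteq> 0" unfolding y_eq using elim by simp
    moreover have "y (X t) \<noteq> 1" using elim by auto
    ultimately show ?case by simp
  qed
qed

text \<open>
  Multiplication by \<open>x\<^sup>\<sigma>\<^sup>-\<^sup>1\<close> leaves bounded functions and terms with an additional factor \<open>x\<close> or \<open>y\<close>. The
  limit does therefore not depend on the fourth parameter of \<open>pvi_f\<close>, so that \<open>l\<^sub>1\<close> and \<open>l\<^sub>2\<close> share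
  their leading terms with the entries (1,2) and (2,1) of \<open>\<Omega>\<close>.
\<close>
lemma pvi_f_eq:
  "exp ((sg - 1) * Complex t a') * pvi_f A B E C y (X t) =
    (1 - X t) * r t + (1 - C) * (p t * y (X t)) + ((B + C) * X t + (A - B - 1)) * p t - A * s t"
proof -
  have "exp ((sg - 1) * Complex t a') * X t = s t"
    by (simp add: s_def X_def algebra_simps flip: exp_add)
  then show ?thesis unfolding pvi_f_def p_def r_def
    by (simp add: algebra_simps power2_eq_square flip: \<open>exp ((sg - 1) * Complex t a') * X t = s t\<close>)
qed

lemma pvi_f_close:
  "exp_close eps (\<lambda>t. exp ((sg - 1) * Complex t a') * pvi_f A B E C y (X t))
     (\<lambda>t. R t + (A - B - 1) * (m1 (s t) * q1 (s t)) - A * s t)"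
proof -
  have "exp_close eps (\<lambda>t. (1 - X t) * r t + (1 - C) * (p t * y (X t)) + ((B + C) * X t + (A - B - 1)) * p t - A * s t)
     (\<lambda>t. (1 - 0) * R t + (1 - C) * ((m1 (s t) * q1 (s t)) * 0) + ((B + C) * 0 + (A - B - 1)) * (m1 (s t) * q1 (s t)) - A * s t)"
    using X_small y_small
    by (intro exp_close_diff exp_close_add exp_close_mult exp_close_refl eps r_close p_close
        bdd_intros R_bdd m_bdd s_bdd') (simp_all add: exp_close_zero)
  then show ?thesis unfolding pvi_f_eq by simp
qed

text \<open>
  That the numerators contain the factors \<open>q\<^sub>1\<close> and \<open>q\<^sub>2\<close> is what singles out \<open>alpha\<close> and \<open>beta\<close>: the quotients
  by \<open>y x\<^sup>\<sigma>\<^sup>-\<^sup>1 \<approx> m\<^sub>1 q\<^sub>1\<close> and \<open>(y - x) x\<^sup>\<sigma>\<^sup>-\<^sup>1 \<approx> m\<^sub>2 q\<^sub>2\<close> only involve \<open>m\<^sub>1\<close> and \<open>m\<^sub>2\<close>.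
\<close>
lemma num12: "R t + (th1 - th2 - 1) * (m1 (s t) * q1 (s t)) - th1 * s t = (th1 - th2 - sg) * (m2 (s t) * q1 (s t))"
  using sg_nz J_nz unfolding R_def m1_q1 m1_def q1_def m2_def q2_def alpha_def beta_def PVI_J1_def PVI_J2_def
  by (simp add: divide_simps) algebra

lemma num21: "R t + (- th1 - - th2 - 1) * (m1 (s t) * q1 (s t)) - (- th1) * s t = - (th1 - th2 + sg) * (m1 (s t) * q2 (s t))"
  using sg_nz J_nz unfolding R_def m1_q1 m1_def q1_def m2_def q2_def alpha_def beta_def PVI_J1_def PVI_J2_def
  by (simp add: divide_simps) algebra

end

section \<open>The gauge factors along a ray\<close>

context generic_ray begin

text \<open>
  These are also the logarithmic derivatives, with respect to \<open>log x\<close>, of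
  \<open>x\<^sup>(\<^sup>\<theta>\<^sup>1\<^sup>-\<^sup>\<theta>\<^sup>2\<^sup>-\<^sup>\<sigma>\<^sup>)\<^sup>/\<^sup>2 m\<^sub>1(s)\<close> and \<open>x\<^sup>(\<^sup>\<theta>\<^sup>2\<^sup>-\<^sup>\<theta>\<^sup>1\<^sup>-\<^sup>\<sigma>\<^sup>)\<^sup>/\<^sup>2 m\<^sub>2(s)\<close>.
\<close>
abbreviation "model12 t \<equiv> (th1 - th2 - sg) / 2 * (m2 (s t) / m1 (s t))"
abbreviation "model21 t \<equiv> - (th1 - th2 + sg) / 2 * (m1 (s t) / m2 (s t))"

lemma f12_close:
  "exp_close eps (\<lambda>t. exp ((sg - 1) * Complex t a') * pvi_f th1 th2 E C y (X t))
     (\<lambda>t. (th1 - th2 - sg) * (m2 (s t) * q1 (s t)))"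
  using pvi_f_close[of th1 th2 E C] unfolding num12 .

lemma f21_close:
  "exp_close eps (\<lambda>t. exp ((sg - 1) * Complex t a') * pvi_f (- th1) (- th2) E C y (X t))
     (\<lambda>t. - (th1 - th2 + sg) * (m1 (s t) * q2 (s t)))"
  using pvi_f_close[of "- th1" "- th2" E C] unfolding num21 .

lemma one_minus_X_close: "exp_close eps (\<lambda>t. 1 - X t) (\<lambda>_. 1)"
  using exp_close_diff[OF exp_close_refl, of eps X "\<lambda>_. 0" "\<lambda>_. 1"] X_small by (simp add: exp_close_zero)

lemma one_minus_y_close: "exp_close eps (\<lambda>t. 1 - y (X t)) (\<lambda>_. 1)"
  using exp_close_diff[OF exp_close_refl, of eps "\<lambda>t. y (X t)" "\<lambda>_. 0" "\<lambda>_. 1"] y_small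
  by (simp add: exp_close_zero)

lemma quotient12_close:
  assumes B: "exp_close eps B (\<lambda>t. 1)"
  shows "exp_close eps (\<lambda>t. pvi_f th1 th2 E C y (X t) / (2 * B t * y (X t))) model12"
proof -
  have "exp_close eps (\<lambda>t. (exp ((sg - 1) * Complex t a') * pvi_f th1 th2 E C y (X t)) / (2 * B t * p t))
     (\<lambda>t. ((th1 - th2 - sg) * (m2 (s t) * q1 (s t))) / (2 * 1 * (m1 (s t) * q1 (s t))))"
    by (intro exp_close_divide exp_close_mult f12_close B p_close exp_close_refl eps bdd_intros m_bdd
        apart_zero_mult apart_zero_const m_apart) auto
  moreover have "(\<lambda>t. (exp ((sg - 1) * Complex t a') * pvi_f th1 th2 E C y (X t)) / (2 * B t * p t))
     = (\<lambda>t. pvi_f th1 th2 E C y (X t) / (2 * B t * y (X t)))"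
    unfolding p_def by (auto simp: field_simps)
  moreover have "eventually (\<lambda>t. ((th1 - th2 - sg) * (m2 (s t) * q1 (s t))) / (2 * 1 * (m1 (s t) * q1 (s t))) = model12 t) at_bot"
    using apart_zero_nz[OF m_apart(1)] apart_zero_nz[OF m_apart(3)]
    by eventually_elim simp
  ultimately show ?thesis by (auto elim: exp_close_cong)
qed

lemma quotient21_close:
  assumes B: "exp_close eps B (\<lambda>t. 1)"
  shows "exp_close eps (\<lambda>t. pvi_f (- th1) (- th2) E C y (X t) / (2 * B t * (y (X t) - X t))) model21"
proof -
  have e: "exp ((sg - 1) * Complex t a') * (y (X t) - X t) = p t - s t" for t
    by (simp add: p_def s_def X_def algebra_simps flip: exp_add)
  have "exp_close eps (\<lambda>t. (exp ((sg - 1) * Complex t a') * pvi_f (- th1) (- th2) E C y (X t)) / (2 * B t * (p t - s t)))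
     (\<lambda>t. (- (th1 - th2 + sg) * (m1 (s t) * q2 (s t))) / (2 * 1 * (m2 (s t) * q2 (s t))))"
    by (intro exp_close_divide exp_close_mult f21_close B ps_close exp_close_refl eps bdd_intros m_bdd
        apart_zero_mult apart_zero_const m_apart) auto
  moreover have "(\<lambda>t. (exp ((sg - 1) * Complex t a') * pvi_f (- th1) (- th2) E C y (X t)) / (2 * B t * (p t - s t)))
     = (\<lambda>t. pvi_f (- th1) (- th2) E C y (X t) / (2 * B t * (y (X t) - X t)))"
    unfolding e[symmetric] by (auto simp: mult_ac)
  moreover have "eventually (\<lambda>t. (- (th1 - th2 + sg) * (m1 (s t) * q2 (s t))) / (2 * 1 * (m2 (s t) * q2 (s t))) = model21 t) at_bot"
    using apart_zero_nz[OF m_apart(2)] apart_zero_nz[OF m_apart(4)]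
    by eventually_elim simp
  ultimately show ?thesis by (auto elim: exp_close_cong)
qed

lemma Om12_close: "exp_close eps (Om12 th3 thinf) model12"
  unfolding Om12_def[abs_def] by (rule quotient12_close[OF one_minus_X_close])

lemma Om21_close: "exp_close eps (Om21 th3 thinf) model21"
  using quotient21_close[OF exp_close_refl] unfolding Om21_def[abs_def] by simp

lemma X_nz: "X t \<noteq> 0" by (simp add: X_def)

lemma l1_close: "exp_close eps (\<lambda>t. X t * pvi_l1 th1 th2 th3 y (X t)) model12"
proof -
  have "exp_close eps (\<lambda>t. (1 - X t) * (1 - y (X t))) (\<lambda>t. 1 * 1)"
    by (intro exp_close_mult one_minus_X_close one_minus_y_close eps bdd_intros)
  then have "exp_close eps (\<lambda>t. pvi_f th1 th2 th3 (th1 + th3 - th2) y (X t)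
      / (2 * ((1 - X t) * (1 - y (X t))) * y (X t))) model12"
    by (intro quotient12_close) simp
  moreover have "X t * pvi_l1 th1 th2 th3 y (X t) = pvi_f th1 th2 th3 (th1 + th3 - th2) y (X t)
      / (2 * ((1 - X t) * (1 - y (X t))) * y (X t))" for t
    using X_nz by (simp add: pvi_l1_def mult_ac)
  ultimately show ?thesis by simp
qed

lemma l2_close: "exp_close eps (\<lambda>t. X t * pvi_l2 th1 th2 th3 y (X t)) model21"
proof -
  have "exp_close eps (\<lambda>t. pvi_f (- th1) (- th2) th3 (th3 + th2 - th1) y (X t)
      / (2 * (1 - y (X t)) * (y (X t) - X t)) - X t * ((th2 - th3) / (1 - X t))) (\<lambda>t. model21 t - 0 * ((th2 - th3) / 1))"
    by (intro exp_close_diff quotient21_close one_minus_y_close exp_close_mult exp_close_divide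
        exp_close_refl one_minus_X_close eps bdd_intros bdd_divide apart_zero_const)
      (use X_small in \<open>simp_all add: exp_close_zero\<close>)
  moreover have "X t * pvi_l2 th1 th2 th3 y (X t) = pvi_f (- th1) (- th2) th3 (th3 + th2 - th1) y (X t)
      / (2 * (1 - y (X t)) * (y (X t) - X t)) - X t * ((th2 - th3) / (1 - X t))" for t
  proof -
    have "2 * X t * (y (X t) - 1) * (X t - y (X t)) = X t * (2 * (1 - y (X t)) * (y (X t) - X t))"
      by algebra
    then have A: "X t * (F / (2 * X t * (y (X t) - 1) * (X t - y (X t)))) = F / (2 * (1 - y (X t)) * (y (X t) - X t))" for F
      using X_nz by simp
    have B: "(th2 - th3) / (X t - 1) = - ((th2 - th3) / (1 - X t))"
      by (metis minus_diff_eq minus_divide_right)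
    show ?thesis
      unfolding pvi_l2_def B distrib_left A by simp
  qed
  ultimately show ?thesis by simp
qed

text \<open>
  The quotient of \<open>k\<close> and the model solution \<open>x\<^sup>c (1 + b s)\<close> satisfies a differential equation with an
  exponentially small coefficient.
\<close>
lemma log_derivative_limit:
  fixes k :: "complex \<Rightarrow> complex" and c b :: complex
  assumes k: "eventually (\<lambda>t. k (X t) \<noteq> 0 \<and> (k has_field_derivative l (X t) * k (X t)) (at (X t))) at_bot"
    and m: "apart_zero (\<lambda>t. 1 + b * s t)"
    and close: "exp_close eps (\<lambda>t. X t * l (X t)) (\<lambda>t. c + sg * b * s t / (1 + b * s t))"
  obtains kap where "kap \<noteq> 0"
    "((\<lambda>t. k (X t) * exp (- c * Complex t a') / (1 + b * s t)) \<longlongrightarrow> kap) at_bot"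
proof -
  define phi where "phi t = k (X t) * exp (- c * Complex t a') / (1 + b * s t)" for t
  define e where "e t = X t * l (X t) - (c + sg * b * s t / (1 + b * s t))" for t
  have "\<exists>kap. kap \<noteq> 0 \<and> (phi \<longlongrightarrow> kap) at_bot"
  proof (rule perturbed_constant_has_limit)
    show "eps > 0" by (rule eps)
    show "e \<in> O[at_bot](\<lambda>t. complex_of_real (exp (eps * t)))"
      using close unfolding e_def exp_close_def exp_small_def .
    show "eventually (\<lambda>t. phi t \<noteq> 0) at_bot"
      using k apart_zero_nz[OF m] by eventually_elim (simp add: phi_def)
    show "eventually (\<lambda>t. (phi has_vector_derivative e t * phi t) (at t)) at_bot"
      using k apart_zero_nz[OF m]
    proof eventually_elim
      case (elim t)
      define H where "H w = k (exp w) * exp (- c * w) / (1 + b * exp (sg * w))" for w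
      have "(k has_field_derivative l (X t) * k (X t)) (at (exp (Complex t a')))"
        using elim by (simp add: X_def)
      then have 1: "((\<lambda>w. k (exp w)) has_field_derivative (l (X t) * k (X t)) * X t) (at (Complex t a'))"
        using DERIV_chain2[of k _ exp "Complex t a'"] DERIV_exp unfolding X_def by blast
      have "(H has_field_derivative e t * phi t) (at (Complex t a'))"
        unfolding H_def
        by (rule derivative_eq_intros 1 refl)+
          (use elim in \<open>auto simp: e_def phi_def X_def[symmetric] s_def[symmetric] field_simps power2_eq_square\<close>)
      moreover have "((\<lambda>t. Complex t a') has_vector_derivative 1) (at t)"
        by (auto simp: Complex_eq intro!: derivative_eq_intros)
      ultimately have "((H \<circ> (\<lambda>t. Complex t a')) has_vector_derivative 1 * (e t * phi t)) (at t)"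
        by (rule field_vector_diff_chain_at[rotated])
      moreover have "H \<circ> (\<lambda>t. Complex t a') = phi"
        by (auto simp: H_def phi_def X_def s_def)
      ultimately show ?case by simp
    qed
  qed
  then show ?thesis using that unfolding phi_def by blast
qed

lemma k_limits:
  assumes k: "eventually (\<lambda>t. k1 (X t) \<noteq> 0 \<and> k2 (X t) \<noteq> 0 \<and>
       (k1 has_field_derivative pvi_l1 th1 th2 th3 y (X t) * k1 (X t)) (at (X t)) \<and>
       (k2 has_field_derivative pvi_l2 th1 th2 th3 y (X t) * k2 (X t)) (at (X t))) at_bot"
  obtains kap1 kap2 where "kap1 \<noteq> 0" "kap2 \<noteq> 0"
    "((\<lambda>t. k1 (X t) * exp (- ((th1 - th2 - sg) / 2) * Complex t a') / m1 (s t)) \<longlongrightarrow> kap1) at_bot"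
    "((\<lambda>t. k2 (X t) * exp (- (- (th1 - th2 + sg) / 2) * Complex t a') / m2 (s t)) \<longlongrightarrow> kap2) at_bot"
proof -
  let ?b1 = "alpha * (th1 - th2 - sg)" and ?b2 = "alpha * (th1 - th2 + sg)"
  have "eventually (\<lambda>t. model12 t = (th1 - th2 - sg) / 2 + sg * ?b1 * s t / (1 + ?b1 * s t)) at_bot"
    using apart_zero_nz[OF m_apart(1)]
    by eventually_elim (simp add: m1_def m2_def field_simps)
  then have c1: "exp_close eps (\<lambda>t. X t * pvi_l1 th1 th2 th3 y (X t))
      (\<lambda>t. (th1 - th2 - sg) / 2 + sg * ?b1 * s t / (1 + ?b1 * s t))"
    by (intro exp_close_cong[OF l1_close[of th3]]) simp_all
  have "eventually (\<lambda>t. model21 t = - (th1 - th2 + sg) / 2 + sg * ?b2 * s t / (1 + ?b2 * s t)) at_bot"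
    using apart_zero_nz[OF m_apart(2)]
    by eventually_elim (simp add: m1_def m2_def field_simps)
  then have c2: "exp_close eps (\<lambda>t. X t * pvi_l2 th1 th2 th3 y (X t))
      (\<lambda>t. - (th1 - th2 + sg) / 2 + sg * ?b2 * s t / (1 + ?b2 * s t))"
    by (intro exp_close_cong[OF l2_close[of th3]]) simp_all
  have e1: "eventually (\<lambda>t. k1 (X t) \<noteq> 0 \<and> (k1 has_field_derivative pvi_l1 th1 th2 th3 y (X t) * k1 (X t)) (at (X t))) at_bot"
    using k by eventually_elim auto
  have e2: "eventually (\<lambda>t. k2 (X t) \<noteq> 0 \<and> (k2 has_field_derivative pvi_l2 th1 th2 th3 y (X t) * k2 (X t)) (at (X t))) at_bot"
    using k by eventually_elim auto
  obtain kap1 where "kap1 \<noteq> 0"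
    "((\<lambda>t. k1 (X t) * exp (- ((th1 - th2 - sg) / 2) * Complex t a') / m1 (s t)) \<longlongrightarrow> kap1) at_bot"
    using log_derivative_limit[OF e1 _ c1] m_apart(1) unfolding m1_def by blast
  moreover obtain kap2 where "kap2 \<noteq> 0"
    "((\<lambda>t. k2 (X t) * exp (- (- (th1 - th2 + sg) / 2) * Complex t a') / m2 (s t)) \<longlongrightarrow> kap2) at_bot"
    using log_derivative_limit[OF e2 _ c2] m_apart(2) unfolding m2_def by blast
  ultimately show ?thesis using that by blast
qed

end

section \<open>Powers of diagonalisable matrices\<close>

lemma diag3_nth [simp]:
  "diag3 p q s $ 1 $ 1 = p" "diag3 p q s $ 2 $ 2 = q" "diag3 p q s $ 3 $ 3 = s"
  "diag3 p q s $ 1 $ 2 = 0" "diag3 p q s $ 1 $ 3 = 0" "diag3 p q s $ 2 $ 1 = 0"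
  "diag3 p q s $ 2 $ 3 = 0" "diag3 p q s $ 3 $ 1 = 0" "diag3 p q s $ 3 $ 2 = 0"
  by (simp_all add: diag3_def)

lemma matrix3_mult_nth: "(A ** B) $ i $ j = A$i$1 * B$1$j + A$i$2 * B$2$j + A$i$3 * B$3$j"
  for A B :: "complex^3^3"
  by (simp add: matrix_matrix_mult_def sum_3)

lemma matrix3_eq_iff:
  "A = B \<longleftrightarrow> (\<forall>i j. A$i$j = B$i$j)" for A B :: "complex^3^3"
  by (simp add: vec_eq_iff)

lemma diag3_conj_nth:
  "(A ** diag3 p q s ** B) $ i $ j = A$i$1 * p * B$1$j + A$i$2 * q * B$2$j + A$i$3 * s * B$3$j"
  for A B :: "complex^3^3"
  by (simp add: matrix3_mult_nth)

lemma diag3_mult: "diag3 p q s ** diag3 p' q' s' = diag3 (p * p') (q * q') (s * s')"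
  by (simp add: matrix3_eq_iff forall_3 matrix3_mult_nth)

lemma mat1_eq_diag3: "mat 1 = diag3 1 1 1"
  by (simp add: matrix3_eq_iff forall_3 mat_def)

lemma sums_matrixI:
  fixes f :: "nat \<Rightarrow> complex^3^3"
  assumes "\<And>i j. (\<lambda>n. f n $ i $ j) sums (A $ i $ j)"
  shows "f sums A"
  unfolding sums_def
  by (intro vec_tendstoI) (use assms in \<open>simp add: sums_def\<close>)

text \<open>
  The powers in the definition of the boundary value have non-diagonal exponents; they become
  explicit because the upper left block has distinct eigenvalues.
\<close>
lemma matrix_exp_conj_diag:
  assumes W: "W ** W' = mat 1" "W' ** W = mat 1"
  shows "matrix_exp (W ** diag3 p q s ** W') = W ** diag3 (exp p) (exp q) (exp s) ** W'"
proof -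
  have pow: "((**) (W ** diag3 p q s ** W') ^^ n) (mat 1) = W ** diag3 (p ^ n) (q ^ n) (s ^ n) ** W'" for n
  proof (induction n)
    case 0
    show ?case using W by (simp flip: mat1_eq_diag3)
  next
    case (Suc n)
    have "((**) (W ** diag3 p q s ** W') ^^ Suc n) (mat 1)
        = (W ** diag3 p q s ** W') ** (W ** diag3 (p ^ n) (q ^ n) (s ^ n) ** W')"
      using Suc by simp
    also have "\<dots> = W ** diag3 p q s ** (W' ** W) ** diag3 (p ^ n) (q ^ n) (s ^ n) ** W'"
      by (simp add: matrix_mul_assoc)
    also have "\<dots> = W ** (diag3 p q s ** diag3 (p ^ n) (q ^ n) (s ^ n)) ** W'"
      by (simp add: W matrix_mul_assoc)
    finally show ?case by (simp add: diag3_mult)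
  qed
  have "(\<lambda>n. (1 / fact n) *\<^sub>R (((**) (W ** diag3 p q s ** W') ^^ n) (mat 1)))
      sums (W ** diag3 (exp p) (exp q) (exp s) ** W')"
  proof (rule sums_matrixI)
    fix i j
    have e: "(\<lambda>n. c * (z ^ n /\<^sub>R fact n) * d) sums (c * exp z * d)" for c z d :: complex
      by (intro sums_mult sums_mult2 exp_converges)
    have "(\<lambda>n. W$i$1 * (p ^ n /\<^sub>R fact n) * W'$1$j + W$i$2 * (q ^ n /\<^sub>R fact n) * W'$2$j
        + W$i$3 * (s ^ n /\<^sub>R fact n) * W'$3$j) sums
      ((W ** diag3 (exp p) (exp q) (exp s) ** W') $ i $ j)"
      unfolding diag3_conj_nth by (intro sums_add e)
    moreover have "((1 / fact n) *\<^sub>R (((**) (W ** diag3 p q s ** W') ^^ n) (mat 1))) $ i $ j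
       = W$i$1 * (p ^ n /\<^sub>R fact n) * W'$1$j + W$i$2 * (q ^ n /\<^sub>R fact n) * W'$2$j
        + W$i$3 * (s ^ n /\<^sub>R fact n) * W'$3$j" for n
      unfolding pow by (simp add: diag3_conj_nth scaleR_add_right divide_inverse)
    ultimately show "(\<lambda>n. ((1 / fact n) *\<^sub>R (((**) (W ** diag3 p q s ** W') ^^ n) (mat 1))) $ i $ j) sums
      ((W ** diag3 (exp p) (exp q) (exp s) ** W') $ i $ j)" by simp
  qed
  then show ?thesis unfolding matrix_exp_def by (simp add: sums_iff)
qed

lemma mat_mult_nth: "(mat L ** A) $ i $ j = L * A $ i $ j" for A :: "complex^3^3"
  using exhaust_3[of i] by (auto simp: matrix3_mult_nth mat_def)

lemma matrix_pow_conj_diag: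
  assumes W: "W ** W' = mat 1" "W' ** W = mat 1"
  shows "matrix_pow L (W ** diag3 p q s ** W') = W ** diag3 (exp (L * p)) (exp (L * q)) (exp (L * s)) ** W'"
    and "matrix_pow L (- (W ** diag3 p q s ** W')) = W ** diag3 (exp (- L * p)) (exp (- L * q)) (exp (- L * s)) ** W'"
proof -
  have "mat L ** (W ** diag3 p q s ** W') = W ** diag3 (L * p) (L * q) (L * s) ** W'"
    by (simp add: matrix3_eq_iff mat_mult_nth diag3_conj_nth algebra_simps)
  then show "matrix_pow L (W ** diag3 p q s ** W') = W ** diag3 (exp (L * p)) (exp (L * q)) (exp (L * s)) ** W'"
    unfolding matrix_pow_def by (simp add: matrix_exp_conj_diag[OF W])
  have "mat L ** (- (W ** diag3 p q s ** W')) = W ** diag3 (- L * p) (- L * q) (- L * s) ** W'"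
    by (simp add: matrix3_eq_iff mat_mult_nth diag3_conj_nth algebra_simps)
  then show "matrix_pow L (- (W ** diag3 p q s ** W')) = W ** diag3 (exp (- L * p)) (exp (- L * q)) (exp (- L * s)) ** W'"
    unfolding matrix_pow_def by (simp add: matrix_exp_conj_diag[OF W])
qed

lemma matrix_pow_diag3:
  "matrix_pow L (diag3 p q s) = diag3 (exp (L * p)) (exp (L * q)) (exp (L * s))"
  "matrix_pow L (- diag3 p q s) = diag3 (exp (- L * p)) (exp (- L * q)) (exp (- L * s))"
  using matrix_pow_conj_diag[of "mat 1" "mat 1" L p q s] by simp_all

section \<open>Limits of matrices with prescribed eigenvectors\<close>

text \<open>
  Let \<open>N\<close> tend to a matrix whose upper left block is diagonal with distinct entries, and let
  \<open>(x, \<rho>, 1)\<close> and \<open>(l, \<eta>, 1)\<close> be orthogonal right and left eigenvectors of \<open>N\<close>. If only \<open>\<rho>\<close> and \<open>l\<close> are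
  known to converge, the other components are recovered as follows. Eliminating the third row of
  \<open>N\<close> by the left equation and \<open>\<eta>\<close> by orthogonality turns the third row of the right equation
  into an equation for \<open>l x\<close>, which is quadratic in \<open>x\<close> with leading coefficient proportional to
  \<open>N\<^sub>2\<^sub>1 \<rightarrow> 0\<close>. It could have a solution that escapes to infinity. The hypothesis \<open>N\<^sub>2\<^sub>1 x \<rightarrow> 0\<close> excludes
  this one and leaves the solution of the linear limit equation, whose leading coefficient is the
  difference of the two eigenvalues.
\<close>
lemma limit_matrix_from_eigenvectors:
  fixes N :: "real \<Rightarrow> complex^3^3" and Q :: "complex^3^3" and x rho l eta :: "real \<Rightarrow> complex"
  assumes N: "\<And>i j. ((\<lambda>t. N t $ i $ j) \<longlongrightarrow> Q $ i $ j) F" and F: "F \<noteq> bot"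
    and Q: "Q$1$2 = 0" "Q$2$1 = 0" "Q$1$1 \<noteq> Q$2$2"
    and right: "eventually (\<lambda>t. \<forall>i. N t $ i $ 1 * x t + N t $ i $ 2 * rho t + N t $ i $ 3
        = mu * (if i = 1 then x t else if i = 2 then rho t else 1)) F"
    and left: "eventually (\<lambda>t. \<forall>j. l t * N t $ 1 $ j + eta t * N t $ 2 $ j + N t $ 3 $ j
        = mu' * (if j = 1 then l t else if j = 2 then eta t else 1)) F"
    and orth: "eventually (\<lambda>t. l t * x t + eta t * rho t + 1 = 0) F"
    and lims: "(rho \<longlongrightarrow> 1) F" "(l \<longlongrightarrow> L) F" "L \<noteq> 0" "((\<lambda>t. N t $ 2 $ 1 * x t) \<longlongrightarrow> 0) F"
  defines "c \<equiv> (mu + mu' - Q$2$2 - Q$3$3) / (Q$2$2 - Q$1$1)"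
  shows "Q$1$3 = (mu - Q$1$1) * (c / L)" "Q$2$3 = mu - Q$2$2"
    "Q$3$1 = (mu' - Q$1$1) * L" "Q$3$2 = (mu' - Q$2$2) * (- 1 - c)"
proof -
  have N12: "((\<lambda>t. N t $ 1 $ 2) \<longlongrightarrow> 0) F" "((\<lambda>t. N t $ 2 $ 1) \<longlongrightarrow> 0) F"
    using N[of 1 2] N[of 2 1] Q by simp_all
  \<comment> \<open>the equation for \<open>l x\<close> is \<open>l x den = num\<close>\<close>
  define num where "num t = mu - N t $ 3 $ 3 + mu' - N t $ 2 $ 2 + l t * rho t * N t $ 1 $ 2
      - N t $ 2 $ 1 * x t / rho t" for t
  define den where "den t = N t $ 2 $ 2 - N t $ 1 $ 1 + N t $ 2 $ 1 * x t / rho t" for t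
  have num: "(num \<longlongrightarrow> mu - Q$3$3 + mu' - Q$2$2 + L * 1 * 0 - 0 / 1) F"
    unfolding num_def
    by (rule tendsto_diff[OF tendsto_add[OF tendsto_diff[OF tendsto_add[OF tendsto_diff[OF tendsto_const N]
          tendsto_const] N] tendsto_mult[OF tendsto_mult[OF lims(2,1)] N12(1)]] tendsto_divide[OF lims(4,1)]]) simp
  have den: "(den \<longlongrightarrow> Q$2$2 - Q$1$1 + 0 / 1) F"
    unfolding den_def
    by (rule tendsto_add[OF tendsto_diff[OF N N] tendsto_divide[OF lims(4,1)]]) simp
  have rnz: "eventually (\<lambda>t. rho t \<noteq> 0) F" using tendsto_imp_eventually_ne[OF lims(1)] by simp
  have dnz: "eventually (\<lambda>t. den t \<noteq> 0) F" using tendsto_imp_eventually_ne[OF den] Q by auto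
  have lnz: "eventually (\<lambda>t. l t \<noteq> 0) F" by (rule tendsto_imp_eventually_ne[OF lims(2,3)])
  have "eventually (\<lambda>t. num t / den t = l t * x t) F"
    using right left orth rnz dnz
  proof eventually_elim
    case (elim t)
    have r3: "N t $ 3 $ 1 * x t + N t $ 3 $ 2 * rho t + N t $ 3 $ 3 = mu"
      using elim(1)[rule_format, of 3] by simp
    have l1: "l t * N t $ 1 $ 1 + eta t * N t $ 2 $ 1 + N t $ 3 $ 1 = mu' * l t"
      using elim(2)[rule_format, of 1] by simp
    have l2: "l t * N t $ 1 $ 2 + eta t * N t $ 2 $ 2 + N t $ 3 $ 2 = mu' * eta t"
      using elim(2)[rule_format, of 2] by simp
    have o: "eta t * rho t + 1 + l t * x t = 0" using elim(3) by algebra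
    define R where "R = N t $ 2 $ 1 * x t / rho t"
    have q: "R * rho t = N t $ 2 $ 1 * x t" using elim(4) by (simp add: R_def)
    have s31: "N t $ 3 $ 1 = mu' * l t - l t * N t $ 1 $ 1 - eta t * N t $ 2 $ 1"
      using l1 by (simp add: algebra_simps)
    have s32: "N t $ 3 $ 2 = mu' * eta t - l t * N t $ 1 $ 2 - eta t * N t $ 2 $ 2"
      using l2 by (simp add: algebra_simps)
    have "(num t - l t * x t * den t) * rho t
        = rho t * (mu - N t $ 3 $ 3 - N t $ 3 $ 1 * x t - N t $ 3 $ 2 * rho t)
          + (eta t * rho t + 1 + l t * x t) * (mu' * rho t - N t $ 2 $ 2 * rho t - R * rho t)"
      unfolding num_def den_def R_def[symmetric] s31 s32 by (simp add: q algebra_simps)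
    also have "\<dots> = 0" unfolding o r3[symmetric] by simp
    finally have "(num t - l t * x t * den t) * rho t = 0" .
    then show ?case using elim(4,5) by (simp add: field_simps)
  qed
  moreover have "((\<lambda>t. num t / den t) \<longlongrightarrow> c) F"
    using tendsto_divide[OF num den] Q by (simp add: c_def algebra_simps)
  ultimately have lx: "((\<lambda>t. l t * x t) \<longlongrightarrow> c) F"
    by (rule Lim_transform_eventually[rotated])
  have "((\<lambda>t. (l t * x t) / l t) \<longlongrightarrow> c / L) F" by (intro tendsto_intros lx lims)
  moreover have "eventually (\<lambda>t. (l t * x t) / l t = x t) F" using lnz by eventually_elim simp
  ultimately have X: "(x \<longlongrightarrow> c / L) F" by (rule Lim_transform_eventually)
  have "((\<lambda>t. (- 1 - l t * x t) / rho t) \<longlongrightarrow> (- 1 - c) / 1) F" by (intro tendsto_intros lx lims) simp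
  moreover have "eventually (\<lambda>t. (- 1 - l t * x t) / rho t = eta t) F"
    using rnz orth
  proof eventually_elim
    case (elim t)
    have "eta t * rho t = - 1 - l t * x t" using elim(2) by algebra
    then show ?case using elim(1) by (simp add: nonzero_divide_eq_eq)
  qed
  ultimately have E: "(eta \<longlongrightarrow> - 1 - c) F" by (simp add: Lim_transform_eventually)
  have "((\<lambda>t. mu * x t - N t $ 1 $ 1 * x t - N t $ 1 $ 2 * rho t) \<longlongrightarrow> mu * (c / L) - Q$1$1 * (c / L) - 0 * 1) F"
    by (intro tendsto_intros N N12 X lims)
  moreover have "eventually (\<lambda>t. mu * x t - N t $ 1 $ 1 * x t - N t $ 1 $ 2 * rho t = N t $ 1 $ 3) F"
    using right proof eventually_elim
    case (elim t)
    show ?case using elim[rule_format, of 1] by (simp add: algebra_simps)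
  qed
  ultimately have "((\<lambda>t. N t $ 1 $ 3) \<longlongrightarrow> mu * (c / L) - Q$1$1 * (c / L) - 0 * 1) F"
    by (rule Lim_transform_eventually)
  from tendsto_unique[OF F N[of 1 3] this]
  show "Q$1$3 = (mu - Q$1$1) * (c / L)" by (simp add: algebra_simps)
  have "((\<lambda>t. mu * rho t - N t $ 2 $ 1 * x t - N t $ 2 $ 2 * rho t) \<longlongrightarrow> mu * 1 - 0 - Q$2$2 * 1) F"
    by (intro tendsto_intros N lims)
  moreover have "eventually (\<lambda>t. mu * rho t - N t $ 2 $ 1 * x t - N t $ 2 $ 2 * rho t = N t $ 2 $ 3) F"
    using right proof eventually_elim
    case (elim t)
    show ?case using elim[rule_format, of 2] by (simp add: algebra_simps)
  qed
  ultimately have "((\<lambda>t. N t $ 2 $ 3) \<longlongrightarrow> mu * 1 - 0 - Q$2$2 * 1) F"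
    by (rule Lim_transform_eventually)
  from tendsto_unique[OF F N[of 2 3] this]
  show "Q$2$3 = mu - Q$2$2" by (simp add: algebra_simps)
  have "((\<lambda>t. mu' * l t - l t * N t $ 1 $ 1 - eta t * N t $ 2 $ 1) \<longlongrightarrow> mu' * L - L * Q$1$1 - (- 1 - c) * 0) F"
    by (intro tendsto_intros N N12 E lims)
  moreover have "eventually (\<lambda>t. mu' * l t - l t * N t $ 1 $ 1 - eta t * N t $ 2 $ 1 = N t $ 3 $ 1) F"
    using left proof eventually_elim
    case (elim t)
    show ?case using elim[rule_format, of 1] by (simp add: algebra_simps)
  qed
  ultimately have "((\<lambda>t. N t $ 3 $ 1) \<longlongrightarrow> mu' * L - L * Q$1$1 - (- 1 - c) * 0) F"
    by (rule Lim_transform_eventually)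
  from tendsto_unique[OF F N[of 3 1] this]
  show "Q$3$1 = (mu' - Q$1$1) * L" by (simp add: algebra_simps)
  have "((\<lambda>t. mu' * eta t - l t * N t $ 1 $ 2 - eta t * N t $ 2 $ 2) \<longlongrightarrow> mu' * (- 1 - c) - L * 0 - (- 1 - c) * Q$2$2) F"
    by (intro tendsto_intros N N12 E lims)
  moreover have "eventually (\<lambda>t. mu' * eta t - l t * N t $ 1 $ 2 - eta t * N t $ 2 $ 2 = N t $ 3 $ 2) F"
    using left proof eventually_elim
    case (elim t)
    show ?case using elim[rule_format, of 2] by (simp add: algebra_simps)
  qed
  ultimately have "((\<lambda>t. N t $ 3 $ 2) \<longlongrightarrow> mu' * (- 1 - c) - L * 0 - (- 1 - c) * Q$2$2) F"
    by (rule Lim_transform_eventually)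
  from tendsto_unique[OF F N[of 3 2] this]
  show "Q$3$2 = (mu' - Q$2$2) * (- 1 - c)" by (simp add: algebra_simps)
qed

section \<open>Eigenvectors supplied by the correspondence\<close>

lemma matrix3_tendsto_mult:
  fixes A B :: "complex^3^3"
  assumes "(f \<longlongrightarrow> A) F" "(g \<longlongrightarrow> B) F"
  shows "((\<lambda>t. f t ** g t) \<longlongrightarrow> A ** B) F"
  by (intro vec_tendstoI) (unfold matrix3_mult_nth, intro tendsto_intros tendsto_vec_nth assms)

lemma delta2_nth [simp]:
  "delta 2 A $ 1 $ 1 = A $ 1 $ 1" "delta 2 A $ 2 $ 2 = A $ 2 $ 2" "delta 2 A $ 3 $ 3 = A $ 3 $ 3"
  "delta 2 A $ 1 $ 2 = A $ 1 $ 2" "delta 2 A $ 2 $ 1 = A $ 2 $ 1"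
  "delta 2 A $ 1 $ 3 = 0" "delta 2 A $ 2 $ 3 = 0" "delta 2 A $ 3 $ 1 = 0" "delta 2 A $ 3 $ 2 = 0"
  by (simp_all add: delta_def index3_def)

text \<open>
  \<open>\<Omega>\<close> for \<open>k\<^sub>1 = k\<^sub>2 = 1\<close>.
\<close>
definition normalised_Omega ::
  "complex \<Rightarrow> complex \<Rightarrow> complex \<Rightarrow> complex \<Rightarrow> (complex \<Rightarrow> complex) \<Rightarrow> complex \<Rightarrow> complex^3^3"
  where "normalised_Omega th1 th2 th3 thinf y x = vector [
    vector [- th1, pvi_f th1 th2 th3 thinf y x / (2 * (1 - x) * y x),
      pvi_f th1 (th1 - th3 - thinf) th3 thinf y x / (2 * (x - 1) * y x)],
    vector [pvi_f (- th1) (- th2) th3 thinf y x / (2 * (y x - x)), - th2,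
      pvi_f (- th2 + th3 + thinf) (- th2) th3 thinf y x / (2 * (x - y x))],
    vector [pvi_f (- th1) (- th1 + th3 - thinf) th3 thinf y x / (2 * x * (y x - 1)),
      pvi_f (th2 - th3 + thinf) th2 th3 thinf y x / (2 * x * (1 - y x)), - th3]]"

text \<open>
  In each row the two values of \<open>pvi_f\<close> differ only in terms without derivative, and the difference
  is a multiple of the common denominator.
\<close>
lemma normalised_Omega_right_eigenvector:
  fixes i :: 3 and th1 th2 th3 thinf x :: complex and y :: "complex \<Rightarrow> complex"
  assumes "x \<notin> {0, 1}" "y x \<notin> {0, 1, x}"
  defines "Om \<equiv> normalised_Omega th1 th2 th3 thinf y x"
  shows "Om$i$1 + Om$i$2 + Om$i$3 = (- th1 - th2 - th3 - thinf) / 2"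
proof -
  have q: "A / (2 * d) + B / (2 * (- d)) = c / 2" if "A - B = c * d" "d \<noteq> 0" for A B c d :: complex
  proof -
    have "A / (2 * d) + B / (2 * (- d)) = (A - B) / (2 * d)" using that by (simp add: divide_simps)
    then show ?thesis using that by simp
  qed
  have nz: "(1 - x) * y x \<noteq> 0" "y x - x \<noteq> 0" "x * (y x - 1) \<noteq> 0"
    using assms by auto
  have row1: "Om$1$2 + Om$1$3 = (th1 - th2 - th3 - thinf) / 2"
    using q[OF _ nz(1), of "pvi_f th1 th2 th3 thinf y x" "pvi_f th1 (th1 - th3 - thinf) th3 thinf y x"
        "th1 - th2 - th3 - thinf"]
    by (simp add: Om_def normalised_Omega_def pvi_f_def algebra_simps)
  have row2: "Om$2$1 + Om$2$3 = (- th1 + th2 - th3 - thinf) / 2"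
    using q[OF _ nz(2), of "pvi_f (- th1) (- th2) th3 thinf y x" "pvi_f (- th2 + th3 + thinf) (- th2) th3 thinf y x"
        "- th1 + th2 - th3 - thinf"]
    by (simp add: Om_def normalised_Omega_def pvi_f_def algebra_simps)
  have row3: "Om$3$1 + Om$3$2 = (- th1 - th2 + th3 - thinf) / 2"
    using q[OF _ nz(3), of "pvi_f (- th1) (- th1 + th3 - thinf) th3 thinf y x" "pvi_f (th2 - th3 + thinf) th2 th3 thinf y x"
        "- th1 - th2 + th3 - thinf"]
    by (simp add: Om_def normalised_Omega_def pvi_f_def algebra_simps)
  have diag: "Om$1$1 = - th1" "Om$2$2 = - th2" "Om$3$3 = - th3"
    by (simp_all add: Om_def normalised_Omega_def)
  consider "i = 1" | "i = 2" | "i = 3" using exhaust_3[of i] by blast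
  then show ?thesis
  proof cases
    case 1
    have "- th1 + (Om$1$2 + Om$1$3) = (- th1 - th2 - th3 - thinf) / 2"
      unfolding row1 by (simp add: field_simps)
    then show ?thesis by (simp add: 1 diag add.assoc)
  next
    case 2
    have "(Om$2$1 + Om$2$3) - th2 = (- th1 - th2 - th3 - thinf) / 2"
      unfolding row2 by (simp add: field_simps)
    then show ?thesis by (simp add: 2 diag algebra_simps)
  next
    case 3
    have "(Om$3$1 + Om$3$2) - th3 = (- th1 - th2 - th3 - thinf) / 2"
      unfolding row3 by (simp add: field_simps)
    then show ?thesis by (simp add: 3 diag)
  qed
qed

text \<open>
  The weights clear the denominators in each column, so that again the derivative cancels.
\<close>
lemma normalised_Omega_left_eigenvector:
  fixes j :: 3 and th1 th2 th3 thinf x :: complex and y :: "complex \<Rightarrow> complex"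
  assumes "x \<notin> {0, 1}" "y x \<notin> {0, 1, x}"
  defines "Om \<equiv> normalised_Omega th1 th2 th3 thinf y x"
  defines "z1 \<equiv> (1 - x) * y x" and "z2 \<equiv> - (y x - x)" and "z3 \<equiv> x * (y x - 1)"
  shows "z1 * Om$1$j + z2 * Om$2$j + z3 * Om$3$j
    = (thinf - th1 - th2 - th3) / 2 * (if j = 1 then z1 else if j = 2 then z2 else z3)"
proof -
  have cancel: "d * (A / (2 * d)) = A / 2" "d * (A / (2 * (- d))) = - A / 2"
    "- d * (A / (2 * d)) = - A / 2" "- d * (A / (2 * (- d))) = A / 2" if "d \<noteq> 0" for A d :: complex
    using that by simp_all
  have nz: "(1 - x) * y x \<noteq> 0" "y x - x \<noteq> 0" "x * (y x - 1) \<noteq> 0"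
    using assms by auto
  have e12: "z1 * Om$1$2 = pvi_f th1 th2 th3 thinf y x / 2"
    using cancel(1)[OF nz(1), of "pvi_f th1 th2 th3 thinf y x"]
    unfolding Om_def normalised_Omega_def z1_def by (simp only: vector_3 mult.assoc)
  have e13: "z1 * Om$1$3 = - pvi_f th1 (th1 - th3 - thinf) th3 thinf y x / 2"
  proof -
    have "2 * (x - 1) * y x = 2 * (- ((1 - x) * y x))" by (simp add: algebra_simps)
    then show ?thesis
      using cancel(2)[OF nz(1), of "pvi_f th1 (th1 - th3 - thinf) th3 thinf y x"]
      unfolding Om_def normalised_Omega_def z1_def by (simp only: vector_3)
  qed
  have e21: "z2 * Om$2$1 = - pvi_f (- th1) (- th2) th3 thinf y x / 2"
    using cancel(3)[OF nz(2)] by (simp add: Om_def normalised_Omega_def z2_def)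
  have e23: "z2 * Om$2$3 = pvi_f (- th2 + th3 + thinf) (- th2) th3 thinf y x / 2"
    using cancel(4)[OF nz(2)] by (simp add: Om_def normalised_Omega_def z2_def)
  have e31: "z3 * Om$3$1 = pvi_f (- th1) (- th1 + th3 - thinf) th3 thinf y x / 2"
    using cancel(1)[OF nz(3), of "pvi_f (- th1) (- th1 + th3 - thinf) th3 thinf y x"]
    unfolding Om_def normalised_Omega_def z3_def by (simp only: vector_3 mult.assoc)
  have e32: "z3 * Om$3$2 = - pvi_f (th2 - th3 + thinf) th2 th3 thinf y x / 2"
  proof -
    have "2 * x * (1 - y x) = 2 * (- (x * (y x - 1)))" by (simp add: algebra_simps)
    then show ?thesis
      using cancel(2)[OF nz(3), of "pvi_f (th2 - th3 + thinf) th2 th3 thinf y x"]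
      unfolding Om_def normalised_Omega_def z3_def by (simp only: vector_3)
  qed
  have diag: "Om$1$1 = - th1" "Om$2$2 = - th2" "Om$3$3 = - th3"
    by (simp_all add: Om_def normalised_Omega_def)
  consider "j = 1" | "j = 2" | "j = 3" using exhaust_3[of j] by blast
  then show ?thesis
  proof cases
    case 1
    then show ?thesis
      by (simp add: diag e21 e31) (simp add: z1_def pvi_f_def field_simps)
  next
    case 2
    then show ?thesis
      by (simp add: diag e12 e32) (simp add: z2_def pvi_f_def field_simps)
  next
    case 3
    then show ?thesis
      by (simp add: diag e13 e23) (simp add: z3_def pvi_f_def field_simps)
  qed
qed

section \<open>The boundary value along a ray\<close>

lemma conjugate_eigenvector:
  fixes A W W' :: "complex^3^3"
  assumes "W ** W' = mat 1" "A *v v = mu *s v"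
  shows "(W' ** A ** W) *v (W' *v v) = mu *s (W' *v v)"
proof -
  have "(W' ** A ** W) *v (W' *v v) = W' *v (A *v ((W ** W') *v v))"
    by (simp add: matrix_vector_mul_assoc matrix_mul_assoc)
  then show ?thesis using assms by (simp add: vector_scalar_commute)
qed

text \<open>
  The eigenvalues of the upper left block of the boundary value, with
  \<open>lam_plus - lam_minus = \<sigma>\<close>.
\<close>
definition (in jimbo_data) "lam_plus = (- th1 - th2 + sg) / 2"
definition (in jimbo_data) "lam_minus = (- th1 - th2 - sg) / 2"

definition (in jimbo_data) eigenbasis :: "complex^3^3"
  where "eigenbasis = vector [vector [th1 - th2 - sg, 1, 0], vector [th1 - th2 + sg, 1, 0], vector [0, 0, 1]]"

definition (in jimbo_data) dual_eigenbasis :: "complex^3^3"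
  where "dual_eigenbasis = vector [vector [- (1 / (2 * sg)), 1 / (2 * sg), 0],
      vector [(th1 - th2 + sg) * (1 / (2 * sg)), - (th1 - th2 - sg) * (1 / (2 * sg)), 0], vector [0, 0, 1]]"

lemma (in jimbo_data) eigenbasis_inverse:
  "eigenbasis ** dual_eigenbasis = mat 1" "dual_eigenbasis ** eigenbasis = mat 1"
proof -
  define k where "k = 1 / (2 * sg)"
  have k: "2 * sg * k = 1" using sg_nz by (simp add: k_def)
  show "eigenbasis ** dual_eigenbasis = mat 1"
    unfolding mat1_eq_diag3 matrix3_eq_iff forall_3 matrix3_mult_nth eigenbasis_def dual_eigenbasis_def k_def[symmetric]
    by (intro conjI; simp; (use k in \<open>simp add: algebra_simps\<close>)?)
  show "dual_eigenbasis ** eigenbasis = mat 1"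
    unfolding mat1_eq_diag3 matrix3_eq_iff forall_3 matrix3_mult_nth eigenbasis_def dual_eigenbasis_def k_def[symmetric]
    by (intro conjI; simp; (use k in \<open>simp add: algebra_simps\<close>)?)
qed

lemma (in jimbo_data) eigenbasis_diagonalises:
  "eigenbasis ** diag3 lam_plus lam_minus (- th3) ** dual_eigenbasis = vector [vector [- th1, (th1 - th2 - sg) / 2, 0],
     vector [- (th1 - th2 + sg) / 2, - th2, 0], vector [0, 0, - th3]]"
proof -
  define k h where "k = 1 / (2 * sg)" "h = (1 / 2 :: complex)"
  have k: "2 * sg * k = 1" "2 * h = 1" using sg_nz by (simp_all add: k_h_def)
  have half: "z / 2 = z * h" for z by (simp add: k_h_def)
  have g: "(- th1 - th2 - sg) * h * ((th1 - th2 + sg) * k) - (th1 - th2 - sg) * ((- th1 - th2 + sg) * h) * k = - th1"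
    "(th1 - th2 - sg) * ((- th1 - th2 + sg) * h) * k + (- th1 - th2 - sg) * h * ((sg - (th1 - th2)) * k)
      = (th1 - th2 - sg) * h"
    "(- th1 - th2 - sg) * h * ((th1 - th2 + sg) * k) - (th1 - th2 + sg) * ((- th1 - th2 + sg) * h) * k
      = (th2 - th1 - sg) * h"
    "(th1 - th2 + sg) * ((- th1 - th2 + sg) * h) * k + (- th1 - th2 - sg) * h * ((sg - (th1 - th2)) * k) = - th2"
    using k by algebra+
  show ?thesis
    unfolding matrix3_eq_iff forall_3 diag3_conj_nth eigenbasis_def dual_eigenbasis_def lam_plus_def lam_minus_def
      k_h_def(1)[symmetric] half
    by (intro conjI; simp add: g)
qed

text \<open>
  The matrix \<open>\<Phi>\<^sub>0'\<close> of the theorem. Its right eigenvector for \<open>\<mu>\<close> has the coordinates \<open>(alpha, 1, 1)\<close> in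
  \<open>eigenbasis\<close>.
\<close>
definition (in jimbo_data) boundary_matrix :: "complex \<Rightarrow> complex \<Rightarrow> complex^3^3"
  where "boundary_matrix th3 thinf = vector [
    vector [- th1, (th1 - th2 - sg) / 2,
      1/2 * (- th3 - thinf + sg)
          - 1 / (8 * sg\<^sup>2 * J) * (th1 - th2 - sg) * (th1 + th2 - sg) * (th3 + thinf + sg)],
    vector [(- th1 + th2 - sg) / 2, - th2,
      1/2 * (- th3 - thinf + sg)
          - 1 / (8 * sg\<^sup>2 * J) * (th1 - th2 + sg) * (th1 + th2 - sg) * (th3 + thinf + sg)],
    vector [J / 2 * (th3 - thinf + sg)
          - 1 / (8 * sg\<^sup>2) * (- th1 + th2 - sg) * (th1 + th2 + sg) * (th3 - thinf - sg),
      J / 2 * (- th3 + thinf - sg)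
          - 1 / (8 * sg\<^sup>2) * (th1 - th2 - sg) * (th1 + th2 + sg) * (th3 - thinf - sg), - th3]]"

context generic_ray begin

text \<open>
  The logarithm of \<open>T = (1 - x) / x = (u\<^sub>3 - u\<^sub>2) / (u\<^sub>2 - u\<^sub>1)\<close>, the base of the powers in the definition
  of the boundary value.
\<close>
definition "log_T t = Ln (1 - X t) - Complex t a'"

lemma X_tendsto: "(X \<longlongrightarrow> 0) at_bot" by (rule exp_small_tendsto[OF X_small eps(1)])
lemma y_tendsto: "((\<lambda>t. y (X t)) \<longlongrightarrow> 0) at_bot" by (rule exp_small_tendsto[OF y_small eps(1)])

lemma exp_Ln_tendsto: "((\<lambda>t. exp (c * Ln (1 - X t))) \<longlongrightarrow> 1) at_bot"
proof -
  have "((\<lambda>t. exp (c * Ln (1 - X t))) \<longlongrightarrow> exp (c * Ln (1 - 0))) at_bot"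
    by (intro tendsto_intros X_tendsto) simp
  then show ?thesis by simp
qed

lemma X_ne_1: "eventually (\<lambda>t. X t \<noteq> 1) at_bot"
  using tendsto_imp_eventually_ne[OF X_tendsto, of 1] by simp

lemma ratio_tendsto_1:
  assumes "exp_close eps f g" "apart_zero g" "bdd g"
  shows "((\<lambda>t. f t / g t) \<longlongrightarrow> 1) at_bot"
proof -
  have "((\<lambda>t. 1 / g t * (f t - g t)) \<longlongrightarrow> 0) at_bot"
    by (intro bdd_null_mult bdd_inverse assms(2) exp_close_tendsto[OF assms(1) eps(1)])
  then have "((\<lambda>t. 1 / g t * (f t - g t) + 1) \<longlongrightarrow> 0 + 1) at_bot" by (intro tendsto_intros)
  moreover have "eventually (\<lambda>t. 1 / g t * (f t - g t) + 1 = f t / g t) at_bot"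
    using apart_zero_nz[OF assms(2)] by eventually_elim (simp add: field_simps)
  ultimately show ?thesis by (simp add: Lim_transform_eventually)
qed

lemma p_ratio: "((\<lambda>t. p t / (m1 (s t) * q1 (s t))) \<longlongrightarrow> 1) at_bot"
  by (intro ratio_tendsto_1 p_close apart_zero_mult m_apart bdd_intros m_bdd)

lemma ps_ratio: "((\<lambda>t. (p t - s t) / (m2 (s t) * q2 (s t))) \<longlongrightarrow> 1) at_bot"
  by (intro ratio_tendsto_1 ps_close apart_zero_mult m_apart bdd_intros m_bdd)

text \<open>
  The second coordinate of the vector \<open>(m\<^sub>1(s), m\<^sub>2(s))\<close> with respect to the eigenbasis is 1 for every
  \<open>s\<close>. This is why it survives the limit although \<open>s\<close> need not converge, and perturbations by factors
  tending to 1 are harmless because \<open>m\<^sub>1\<close> and \<open>m\<^sub>2\<close> are bounded.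
\<close>
lemma model_vector_limit:
  assumes B: "(B1 \<longlongrightarrow> 1) at_bot" "(B2 \<longlongrightarrow> 1) at_bot"
  shows "((\<lambda>t. ((th1 - th2 + sg) * (m1 (s t) * B1 t) - (th1 - th2 - sg) * (m2 (s t) * B2 t)) / (2 * sg)) \<longlongrightarrow> 1) at_bot"
proof -
  have B0: "((\<lambda>t. B1 t - 1) \<longlongrightarrow> 0) at_bot" "((\<lambda>t. B2 t - 1) \<longlongrightarrow> 0) at_bot"
    using tendsto_diff[OF B(1) tendsto_const[of 1]] tendsto_diff[OF B(2) tendsto_const[of 1]] by simp_all
  have "((\<lambda>t. 1 + ((th1 - th2 + sg) / (2 * sg) * (m1 (s t) * (B1 t - 1)) - (th1 - th2 - sg) / (2 * sg) * (m2 (s t) * (B2 t - 1))))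
     \<longlongrightarrow> 1 + ((th1 - th2 + sg) / (2 * sg) * 0 - (th1 - th2 - sg) / (2 * sg) * 0)) at_bot"
    by (rule tendsto_add[OF tendsto_const tendsto_diff[OF tendsto_mult[OF tendsto_const bdd_null_mult[OF m_bdd(1) B0(1)]]
       tendsto_mult[OF tendsto_const bdd_null_mult[OF m_bdd(2) B0(2)]]]])
  moreover have "1 + ((th1 - th2 + sg) / (2 * sg) * (m1 (s t) * (B1 t - 1)) - (th1 - th2 - sg) / (2 * sg) * (m2 (s t) * (B2 t - 1)))
    = ((th1 - th2 + sg) * (m1 (s t) * B1 t) - (th1 - th2 - sg) * (m2 (s t) * B2 t)) / (2 * sg)" for t
    using sg_nz by (simp add: m1_def m2_def field_simps)
  ultimately show ?thesis by simp
qed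

lemma model_covector_limit:
  assumes B: "(B1 \<longlongrightarrow> 1) at_bot" "(B2 \<longlongrightarrow> 1) at_bot"
  shows "((\<lambda>t. (th1 - th2 + sg) * (q2 (s t) * B2 t) - (th1 - th2 - sg) * (q1 (s t) * B1 t)) \<longlongrightarrow> 2 * sg * J) at_bot"
proof -
  have B0: "((\<lambda>t. B1 t - 1) \<longlongrightarrow> 0) at_bot" "((\<lambda>t. B2 t - 1) \<longlongrightarrow> 0) at_bot"
    using tendsto_diff[OF B(1) tendsto_const[of 1]] tendsto_diff[OF B(2) tendsto_const[of 1]] by simp_all
  have "((\<lambda>t. 2 * sg * J + ((th1 - th2 + sg) * (q2 (s t) * (B2 t - 1)) - (th1 - th2 - sg) * (q1 (s t) * (B1 t - 1))))
     \<longlongrightarrow> 2 * sg * J + ((th1 - th2 + sg) * 0 - (th1 - th2 - sg) * 0)) at_bot"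
    by (rule tendsto_add[OF tendsto_const tendsto_diff[OF tendsto_mult[OF tendsto_const bdd_null_mult[OF m_bdd(4) B0(2)]]
       tendsto_mult[OF tendsto_const bdd_null_mult[OF m_bdd(3) B0(1)]]]])
  moreover have "2 * sg * J + ((th1 - th2 + sg) * (q2 (s t) * (B2 t - 1)) - (th1 - th2 - sg) * (q1 (s t) * (B1 t - 1)))
    = (th1 - th2 + sg) * (q2 (s t) * B2 t) - (th1 - th2 - sg) * (q1 (s t) * B1 t)" for t
    by (simp add: q1_def q2_def algebra_simps)
  ultimately show ?thesis by simp
qed

text \<open>
  The factors \<open>h\<^sub>1, h\<^sub>2\<close> are \<open>k\<^sub>1, k\<^sub>2\<close> times powers of \<open>u\<^sub>3 - u\<^sub>1\<close>, so that \<open>(h\<^sub>1, h\<^sub>2, 1)\<close> is an eigenvector of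
  \<open>\<Phi>\<close> itself. In coordinates with respect to the eigenbasis of \<open>\<delta>\<^sub>2 \<Phi>\<^sub>2\<close> its conjugate by the power of
  \<open>(u\<^sub>3 - u\<^sub>2) / (u\<^sub>2 - u\<^sub>1)\<close> satisfies the hypotheses of \<open>limit_matrix_from_eigenvectors\<close>.
\<close>
lemma boundary_value_of_ray:
  fixes Ph :: "real \<Rightarrow> complex^3^3" and Phi2 :: "complex^3^3"
  assumes Ph: "eventually (\<lambda>t. h1 t \<noteq> 0 \<and> h2 t \<noteq> 0 \<and>
      Ph t = diag3 (h1 t) (h2 t) 1 ** normalised_Omega th1 th2 th3 thinf y (X t) ** diag3 (1 / h1 t) (1 / h2 t) 1) at_bot"
    and h: "((\<lambda>t. h1 t * exp (- (th3 + lam_minus) * Complex t a') / m1 (s t)) \<longlongrightarrow> c1) at_bot"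
      "((\<lambda>t. h2 t * exp (- (th3 + lam_minus) * Complex t a') / m2 (s t)) \<longlongrightarrow> c2) at_bot"
    and c: "c1 \<noteq> 0" "c2 \<noteq> 0"
    and D: "((\<lambda>t. delta 2 (Ph t)) \<longlongrightarrow> delta 2 Phi2) at_bot"
    and Psi: "((\<lambda>t. matrix_pow (log_T t) (delta 2 Phi2) ** Ph t ** matrix_pow (log_T t) (- delta 2 Phi2)) \<longlongrightarrow> Phi2) at_bot"
  shows "Phi2 = diag3 c1 c2 1 ** boundary_matrix th3 thinf ** diag3 (1 / c1) (1 / c2) 1"
proof -
  define v where "v t = exp ((lam_minus + th3) * Ln (1 - X t))" for t
  define B1 where "B1 t = h1 t * exp (- (th3 + lam_minus) * Complex t a') / m1 (s t) / c1 * v t" for t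
  define B2 where "B2 t = h2 t * exp (- (th3 + lam_minus) * Complex t a') / m2 (s t) / c2 * v t" for t
  have "(B1 \<longlongrightarrow> c1 / c1 * 1) at_bot" unfolding B1_def v_def by (intro tendsto_intros h c exp_Ln_tendsto)
  then have B1: "(B1 \<longlongrightarrow> 1) at_bot" using c by simp
  have "(B2 \<longlongrightarrow> c2 / c2 * 1) at_bot" unfolding B2_def v_def by (intro tendsto_intros h c exp_Ln_tendsto)
  then have B2: "(B2 \<longlongrightarrow> 1) at_bot" using c by simp
  let ?sc = "\<lambda>t. exp (log_T t * (lam_minus + th3))"
  have sc: "?sc t = v t * exp (- (th3 + lam_minus) * Complex t a')" for t
    by (simp add: v_def log_T_def algebra_simps flip: exp_add)
  have b: "eventually (\<lambda>t. ?sc t * h1 t / c1 = m1 (s t) * B1 t \<and> ?sc t * h2 t / c2 = m2 (s t) * B2 t) at_bot"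
    using apart_zero_nz[OF m_apart(1)] apart_zero_nz[OF m_apart(2)]
    by eventually_elim (use c in \<open>simp add: sc B1_def B2_def\<close>)
  have Bnz: "eventually (\<lambda>t. B1 t \<noteq> 0 \<and> B2 t \<noteq> 0) at_bot"
    using tendsto_imp_eventually_ne[OF B1, of 0] tendsto_imp_eventually_ne[OF B2, of 0]
    by (auto intro: eventually_conj)
  have hh: "eventually (\<lambda>t. h1 t / h2 t = c1 / c2 * (m1 (s t) / m2 (s t) * (B1 t / B2 t))) at_bot"
    using b Ph Bnz apart_zero_nz[OF m_apart(1)] apart_zero_nz[OF m_apart(2)]
  proof eventually_elim
    case (elim t)
    have "h1 t / h2 t = (c1 / c2) * ((?sc t * h1 t / c1) / (?sc t * h2 t / c2))"
      using c elim(2) by simp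
    then show ?case using elim by simp
  qed
  \<comment> \<open>\<open>\<delta>\<^sub>2 \<Phi>\<^sub>2\<close> is a limit of entries in which \<open>m\<^sub>1, m\<^sub>2\<close> cancel, although \<open>h\<^sub>1 / h\<^sub>2\<close> need not converge.\<close>
  have Ph_nth: "eventually (\<lambda>t. Ph t $ 1 $ 1 = - th1 \<and> Ph t $ 2 $ 2 = - th2 \<and> Ph t $ 3 $ 3 = - th3 \<and>
      Ph t $ 1 $ 2 = h1 t / h2 t * Om12 th3 thinf t \<and> Ph t $ 2 $ 1 = h2 t / h1 t * Om21 th3 thinf t) at_bot"
    using Ph by eventually_elim
      (simp add: diag3_conj_nth matrix3_mult_nth normalised_Omega_def Om12_def Om21_def)
  have Dl: "((\<lambda>t. delta 2 (Ph t) $ i $ j) \<longlongrightarrow> delta 2 Phi2 $ i $ j) at_bot" for i j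
    by (intro tendsto_vec_nth D)
  have diag: "Phi2$1$1 = - th1" "Phi2$2$2 = - th2" "Phi2$3$3 = - th3"
  proof -
    have "((\<lambda>t. Ph t $ 1 $ 1) \<longlongrightarrow> - th1) at_bot" "((\<lambda>t. Ph t $ 2 $ 2) \<longlongrightarrow> - th2) at_bot"
      "((\<lambda>t. Ph t $ 3 $ 3) \<longlongrightarrow> - th3) at_bot"
      using Ph_nth by (auto intro!: tendsto_eventually elim: eventually_mono)
    with Dl[of 1 1] Dl[of 2 2] Dl[of 3 3] show "Phi2$1$1 = - th1" "Phi2$2$2 = - th2" "Phi2$3$3 = - th3"
      by (auto intro: tendsto_unique[rotated])
  qed
  have off12: "Phi2$1$2 = c1 / c2 * ((th1 - th2 - sg) / 2)"
  proof -
    have "((\<lambda>t. m1 (s t) / m2 (s t) * (Om12 th3 thinf t - model12 t)) \<longlongrightarrow> 0) at_bot"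
      by (intro bdd_null_mult bdd_divide m_bdd m_apart exp_close_tendsto[OF Om12_close eps(1)])
    then have "((\<lambda>t. c1 / c2 * ((B1 t / B2 t) * (m1 (s t) / m2 (s t) * (Om12 th3 thinf t - model12 t) + (th1 - th2 - sg) / 2)))
        \<longlongrightarrow> c1 / c2 * ((1 / 1) * (0 + (th1 - th2 - sg) / 2))) at_bot"
      by (intro tendsto_intros B1 B2) simp
    moreover have "eventually (\<lambda>t. c1 / c2 * ((B1 t / B2 t) * (m1 (s t) / m2 (s t) * (Om12 th3 thinf t - model12 t) + (th1 - th2 - sg) / 2))
        = Ph t $ 1 $ 2) at_bot"
      using hh Ph_nth apart_zero_nz[OF m_apart(1)] apart_zero_nz[OF m_apart(2)]
    proof eventually_elim
      case (elim t)
      have "m1 (s t) / m2 (s t) * (Om12 th3 thinf t - model12 t) + (th1 - th2 - sg) / 2 = m1 (s t) / m2 (s t) * Om12 th3 thinf t"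
        using elim by (simp add: field_simps)
      then show ?case using elim by (simp add: mult_ac)
    qed
    ultimately have "((\<lambda>t. Ph t $ 1 $ 2) \<longlongrightarrow> c1 / c2 * ((1 / 1) * (0 + (th1 - th2 - sg) / 2))) at_bot"
      by (rule Lim_transform_eventually)
    with Dl[of 1 2] show ?thesis by (auto dest: tendsto_unique[rotated])
  qed
  have off21: "Phi2$2$1 = c2 / c1 * (- (th1 - th2 + sg) / 2)"
  proof -
    have "((\<lambda>t. m2 (s t) / m1 (s t) * (Om21 th3 thinf t - model21 t)) \<longlongrightarrow> 0) at_bot"
      by (intro bdd_null_mult bdd_divide m_bdd m_apart exp_close_tendsto[OF Om21_close eps(1)])
    then have "((\<lambda>t. c2 / c1 * ((B2 t / B1 t) * (m2 (s t) / m1 (s t) * (Om21 th3 thinf t - model21 t) + - (th1 - th2 + sg) / 2)))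
        \<longlongrightarrow> c2 / c1 * ((1 / 1) * (0 + - (th1 - th2 + sg) / 2))) at_bot"
      by (intro tendsto_intros B1 B2) simp
    moreover have "eventually (\<lambda>t. c2 / c1 * ((B2 t / B1 t) * (m2 (s t) / m1 (s t) * (Om21 th3 thinf t - model21 t) + - (th1 - th2 + sg) / 2))
        = Ph t $ 2 $ 1) at_bot"
      using hh Ph_nth Bnz apart_zero_nz[OF m_apart(1)] apart_zero_nz[OF m_apart(2)]
    proof eventually_elim
      case (elim t)
      have 1: "m2 (s t) / m1 (s t) * (Om21 th3 thinf t - model21 t) + - (th1 - th2 + sg) / 2 = m2 (s t) / m1 (s t) * Om21 th3 thinf t"
        using elim by (simp add: field_simps)
      have "h2 t / h1 t = inverse (c1 / c2 * (m1 (s t) / m2 (s t) * (B1 t / B2 t)))"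
        using elim(1) by (metis inverse_divide)
      also have "\<dots> = c2 / c1 * (m2 (s t) / m1 (s t) * (B2 t / B1 t))" by simp
      finally show ?case unfolding 1 using elim(2) by (simp add: mult_ac)
    qed
    ultimately have "((\<lambda>t. Ph t $ 2 $ 1) \<longlongrightarrow> c2 / c1 * ((1 / 1) * (0 + - (th1 - th2 + sg) / 2))) at_bot"
      by (rule Lim_transform_eventually)
    with Dl[of 2 1] show ?thesis by (auto dest: tendsto_unique[rotated])
  qed
  define C C' where "C = diag3 c1 c2 1" "C' = diag3 (1 / c1) (1 / c2) 1"
  have CC': "C ** C' = mat 1" "C' ** C = mat 1"
    using c by (simp_all add: C_C'_def diag3_mult mat1_eq_diag3)
  define W W' where "W = C ** eigenbasis" "W' = dual_eigenbasis ** C'"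
  have WW': "W ** W' = mat 1" "W' ** W = mat 1"
  proof -
    have "W ** W' = C ** (eigenbasis ** dual_eigenbasis) ** C'" by (simp only: W_W'_def matrix_mul_assoc)
    then show "W ** W' = mat 1" by (simp add: eigenbasis_inverse CC')
    have "W' ** W = dual_eigenbasis ** (C' ** C) ** eigenbasis" by (simp only: W_W'_def matrix_mul_assoc)
    then show "W' ** W = mat 1" by (simp add: eigenbasis_inverse CC')
  qed
  have D2': "delta 2 Phi2 = C ** (eigenbasis ** diag3 lam_plus lam_minus (- th3) ** dual_eigenbasis) ** C'"
    unfolding eigenbasis_diagonalises using c
    by (simp add: C_C'_def matrix3_eq_iff forall_3 matrix3_mult_nth diag off12 off21)
  then have D2: "delta 2 Phi2 = W ** diag3 lam_plus lam_minus (- th3) ** W'"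
    by (simp only: W_W'_def matrix_mul_assoc)
  define M where "M t = W' ** Ph t ** W" for t
  \<comment> \<open>powers of the diagonalised \<open>\<delta>\<^sub>2 \<Phi>\<^sub>2\<close>\<close>
  define De where "De t = diag3 (exp (log_T t * lam_plus)) (exp (log_T t * lam_minus)) (exp (log_T t * (- th3)))" for t
  define De' where "De' t = diag3 (exp (- log_T t * lam_plus)) (exp (- log_T t * lam_minus)) (exp (- log_T t * (- th3)))" for t
  define N where "N t = De t ** M t ** De' t" for t
  define Q where "Q = W' ** Phi2 ** W"
  have "N t = W' ** (matrix_pow (log_T t) (delta 2 Phi2) ** Ph t ** matrix_pow (log_T t) (- delta 2 Phi2)) ** W" for t
  proof -
    have "W' ** ((W ** De t ** W') ** Ph t ** (W ** De' t ** W')) ** W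
      = (W' ** W) ** De t ** (W' ** Ph t ** W) ** De' t ** (W' ** W)" by (simp only: matrix_mul_assoc)
    then show ?thesis unfolding D2 matrix_pow_conj_diag[OF WW'] De_def[symmetric] De'_def[symmetric] N_def M_def
      by (simp add: WW')
  qed
  then have N_eq: "N = (\<lambda>t. W' ** (matrix_pow (log_T t) (delta 2 Phi2) ** Ph t ** matrix_pow (log_T t) (- delta 2 Phi2)) ** W)"
    by (rule ext)
  have "(N \<longlongrightarrow> Q) at_bot"
    unfolding Q_def N_eq by (intro matrix3_tendsto_mult tendsto_const Psi)
  then have NQ: "((\<lambda>t. N t $ i $ j) \<longlongrightarrow> Q $ i $ j) at_bot" for i j by (intro tendsto_vec_nth)
  have Q: "Q$1$1 = lam_plus" "Q$2$2 = lam_minus" "Q$1$2 = 0" "Q$2$1 = 0" "Q$3$3 = - th3"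
  proof -
    have "W' ** delta 2 Phi2 ** W = (W' ** W) ** diag3 lam_plus lam_minus (- th3) ** (W' ** W)"
      unfolding D2 by (simp only: matrix_mul_assoc)
    then have d: "W' ** delta 2 Phi2 ** W = diag3 lam_plus lam_minus (- th3)" by (simp add: WW')
    have "Q $ i $ j = (W' ** delta 2 Phi2 ** W) $ i $ j" if "i \<noteq> 3 \<and> j \<noteq> 3 \<or> i = 3 \<and> j = 3" for i j
      using that exhaust_3[of i] exhaust_3[of j]
      by (auto simp: Q_def matrix3_mult_nth W_W'_def C_C'_def eigenbasis_def dual_eigenbasis_def)
    then show "Q$1$1 = lam_plus" "Q$2$2 = lam_minus" "Q$1$2 = 0" "Q$2$1 = 0" "Q$3$3 = - th3"
      unfolding d by simp_all
  qed
  have N_nth: "N t $ i $ j = De t $ i $ i * M t $ i $ j * De' t $ j $ j" for t i j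
    using exhaust_3[of i] exhaust_3[of j] by (auto simp: N_def De_def De'_def matrix3_mult_nth)
  \<comment> \<open>The conjugated eigenvectors \<open>(x, rho, 1)\<close> and \<open>(l, eta, 1)\<close>, in the coordinates of the eigenbasis;
    the factors \<open>z1, z2\<close> come from the left eigenvector divided by its third component.\<close>
  define mu mu' where "mu = (- th1 - th2 - th3 - thinf) / 2" "mu' = (thinf - th1 - th2 - th3) / 2"
  define z1 where "z1 t = (1 - X t) * y (X t) / (X t * (y (X t) - 1))" for t
  define z2 where "z2 t = - (y (X t) - X t) / (X t * (y (X t) - 1))" for t
  define x where "x t = ?sc t * exp (log_T t * sg) * ((h2 t / c2 - h1 t / c1) / (2 * sg))" for t
  define rho where "rho t = ?sc t * (((th1 - th2 + sg) * h1 t / c1 - (th1 - th2 - sg) * h2 t / c2) / (2 * sg))" for t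
  define l where "l t = exp (- log_T t * sg) / ?sc t * (z1 t * c1 / h1 t * (th1 - th2 - sg) + z2 t * c2 / h2 t * (th1 - th2 + sg))" for t
  define eta where "eta t = (z1 t * c1 / h1 t + z2 t * c2 / h2 t) / ?sc t" for t
  have good: "eventually (\<lambda>t. X t \<notin> {0, 1} \<and> y (X t) \<notin> {0, 1, X t} \<and> h1 t \<noteq> 0 \<and> h2 t \<noteq> 0 \<and>
      Ph t = diag3 (h1 t) (h2 t) 1 ** normalised_Omega th1 th2 th3 thinf y (X t) ** diag3 (1 / h1 t) (1 / h2 t) 1) at_bot"
    using regular X_ne_1 Ph by eventually_elim (simp add: X_nz)
  have right: "eventually (\<lambda>t. \<forall>i. N t $ i $ 1 * x t + N t $ i $ 2 * rho t + N t $ i $ 3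
        = mu * (if i = 1 then x t else if i = 2 then rho t else 1)) at_bot"
    using good
  proof eventually_elim
    case (elim t)
    define Om where "Om = normalised_Omega th1 th2 th3 thinf y (X t)"
    define v where "v = (vector [h1 t, h2 t, 1] :: complex^3)"
    define u1 u2 where "u1 = (h2 t / c2 - h1 t / c1) / (2 * sg)"
      "u2 = ((th1 - th2 + sg) * h1 t / c1 - (th1 - th2 - sg) * h2 t / c2) / (2 * sg)"
    define k where "k = 1 / (2 * sg)"
    have k: "z / (2 * sg) = z * k" for z by (simp add: k_def)
    have u: "W' *v v = vector [u1, u2, 1]"
      unfolding W_W'_def C_C'_def u1_u2_def dual_eigenbasis_def k_def[symmetric] k
      by (simp add: vec_eq_iff forall_3 matrix_vector_mult_def sum_3 v_def matrix3_mult_nth divide_inverse algebra_simps)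
    have Om: "Om$i$1 + Om$i$2 + Om$i$3 = mu" for i
      using normalised_Omega_right_eigenvector[of "X t" y th1 th2 th3 thinf i] elim by (simp add: Om_def mu_mu'_def)
    have "Ph t *v v = mu *s v"
      using Om[of 1] Om[of 2] Om[of 3] elim
      by (simp add: vec_eq_iff forall_3 matrix_vector_mult_def sum_3 v_def Om_def[symmetric] diag3_conj_nth matrix3_mult_nth)
        (simp flip: distrib_left add: mult.commute)
    from conjugate_eigenvector[OF WW'(1) this] have "M t *v vector [u1, u2, 1] = mu *s vector [u1, u2, 1]"
      by (simp add: M_def u)
    then have Mu: "M t $ i $ 1 * u1 + M t $ i $ 2 * u2 + M t $ i $ 3 = mu * (if i = 1 then u1 else if i = 2 then u2 else 1)" for i
      using exhaust_3[of i] by (auto simp: vec_eq_iff forall_3 matrix_vector_mult_def sum_3)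
    have e: "De' t $ 1 $ 1 * x t = exp (log_T t * th3) * u1" "De' t $ 2 $ 2 * rho t = exp (log_T t * th3) * u2"
      "De' t $ 3 $ 3 = exp (log_T t * th3)" "De t $ 1 $ 1 * exp (log_T t * th3) * u1 = x t"
      "De t $ 2 $ 2 * exp (log_T t * th3) * u2 = rho t" "De t $ 3 $ 3 * exp (log_T t * th3) = 1"
      by (simp_all add: De_def De'_def x_def rho_def u1_u2_def[symmetric] lam_plus_def lam_minus_def flip: exp_add mult.assoc)
        (simp_all add: algebra_simps add_divide_distrib diff_divide_distrib)
    show ?case
    proof
      fix i
      have "N t $ i $ 1 * x t + N t $ i $ 2 * rho t + N t $ i $ 3
        = De t $ i $ i * (M t $ i $ 1 * (De' t $ 1 $ 1 * x t) + M t $ i $ 2 * (De' t $ 2 $ 2 * rho t) + M t $ i $ 3 * De' t $ 3 $ 3)"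
        by (simp add: N_nth algebra_simps)
      also have "\<dots> = De t $ i $ i * exp (log_T t * th3) * (M t $ i $ 1 * u1 + M t $ i $ 2 * u2 + M t $ i $ 3)"
        unfolding e(1-3) by (simp add: algebra_simps)
      also have "\<dots> = mu * (if i = 1 then x t else if i = 2 then rho t else 1)"
        unfolding Mu using exhaust_3[of i] e(4-6) by (auto simp: algebra_simps)
      finally show "N t $ i $ 1 * x t + N t $ i $ 2 * rho t + N t $ i $ 3
        = mu * (if i = 1 then x t else if i = 2 then rho t else 1)" .
    qed
  qed
  have left: "eventually (\<lambda>t. \<forall>j. l t * N t $ 1 $ j + eta t * N t $ 2 $ j + N t $ 3 $ j
        = mu' * (if j = 1 then l t else if j = 2 then eta t else 1)) at_bot"
    using good
  proof eventually_elim
    case (elim t)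
    define Om where "Om = normalised_Omega th1 th2 th3 thinf y (X t)"
    define z where "z = (vector [z1 t / h1 t, z2 t / h2 t, 1] :: complex^3)"
    define g1 g2 where "g1 = z1 t * c1 / h1 t * (th1 - th2 - sg) + z2 t * c2 / h2 t * (th1 - th2 + sg)"
      "g2 = z1 t * c1 / h1 t + z2 t * c2 / h2 t"
    have g: "transpose W *v z = vector [g1, g2, 1]"
      by (simp add: vec_eq_iff forall_3 matrix_vector_mult_def sum_3 z_def W_W'_def C_C'_def eigenbasis_def matrix3_mult_nth g1_g2_def transpose_def algebra_simps)
    have Om: "z1 t * Om$1$j + z2 t * Om$2$j + Om$3$j = mu' * (if j = 1 then z1 t else if j = 2 then z2 t else 1)" for j
    proof -
      have nz: "X t * (y (X t) - 1) \<noteq> 0" using elim by simp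
      have z: "(1 - X t) * y (X t) = z1 t * (X t * (y (X t) - 1))" "- (y (X t) - X t) = z2 t * (X t * (y (X t) - 1))"
        using nz by (simp_all add: z1_def z2_def)
      have "(z1 t * Om$1$j + z2 t * Om$2$j + Om$3$j) * Z = (mu' * (if j = 1 then z1 t else if j = 2 then z2 t else 1)) * Z"
        if "z1 t * Z * Om$1$j + z2 t * Z * Om$2$j + Z * Om$3$j
          = mu' * (if j = 1 then z1 t * Z else if j = 2 then z2 t * Z else Z)" for Z
        using that by (auto simp: algebra_simps split: if_splits)
      moreover have "z1 t * (X t * (y (X t) - 1)) * Om$1$j + z2 t * (X t * (y (X t) - 1)) * Om$2$j + X t * (y (X t) - 1) * Om$3$j
          = mu' * (if j = 1 then z1 t * (X t * (y (X t) - 1)) else if j = 2 then z2 t * (X t * (y (X t) - 1)) else X t * (y (X t) - 1))"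
        unfolding z[symmetric] Om_def mu_mu'_def
        using elim by (intro normalised_Omega_left_eigenvector) auto
      ultimately have "(z1 t * Om$1$j + z2 t * Om$2$j + Om$3$j) * (X t * (y (X t) - 1))
         = (mu' * (if j = 1 then z1 t else if j = 2 then z2 t else 1)) * (X t * (y (X t) - 1))" .
      then show ?thesis using nz by (metis mult_right_cancel)
    qed
    have "transpose (Ph t) *v z = mu' *s z"
      using Om[of 1] Om[of 2] Om[of 3] elim
      by (simp add: vec_eq_iff forall_3 matrix_vector_mult_def sum_3 z_def Om_def[symmetric] transpose_def diag3_conj_nth matrix3_mult_nth)
        (simp flip: add_divide_distrib add: mult.commute)
    moreover have "transpose W' ** transpose W = mat 1"
      by (metis WW'(1) matrix_transpose_mul transpose_mat)
    ultimately have "(transpose W ** transpose (Ph t) ** transpose W') *v (transpose W *v z) = mu' *s (transpose W *v z)"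
      by (intro conjugate_eigenvector)
    then have "transpose (M t) *v vector [g1, g2, 1] = mu' *s vector [g1, g2, 1]"
      by (simp only: M_def g matrix_transpose_mul matrix_mul_assoc)
    then have Mg: "g1 * M t $ 1 $ j + g2 * M t $ 2 $ j + M t $ 3 $ j = mu' * (if j = 1 then g1 else if j = 2 then g2 else 1)" for j
      using exhaust_3[of j] by (auto simp: vec_eq_iff forall_3 matrix_vector_mult_def sum_3 transpose_def mult.commute)
    have lam: "lam_plus = lam_minus + sg" by (simp add: lam_plus_def lam_minus_def field_simps)
    have s: "z / ?sc t = z * exp (- (log_T t * (lam_minus + th3)))" for z by (simp add: exp_minus divide_inverse)
    have lg: "l t = exp (- log_T t * sg) * exp (- (log_T t * (lam_minus + th3))) * g1"
      unfolding l_def s g1_g2_def ..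
    have eg: "eta t = exp (- (log_T t * (lam_minus + th3))) * g2"
      unfolding eta_def s g1_g2_def by (rule mult.commute)
    have E: "exp (- log_T t * sg) * exp (- (log_T t * (lam_minus + th3))) * exp (log_T t * lam_plus) = exp (- log_T t * th3)"
      "exp (- (log_T t * (lam_minus + th3))) * exp (log_T t * lam_minus) = exp (- log_T t * th3)"
      "exp (- log_T t * th3) * exp (- log_T t * lam_plus) = exp (- log_T t * sg) * exp (- (log_T t * (lam_minus + th3)))"
      "exp (- log_T t * th3) * exp (- log_T t * lam_minus) = exp (- (log_T t * (lam_minus + th3)))"
      unfolding lam exp_add[symmetric] by (simp_all add: algebra_simps)
    have e1: "l t * De t $ 1 $ 1 = exp (- log_T t * th3) * g1"
      unfolding E(1)[symmetric] lg De_def diag3_nth by (simp only: mult_ac)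
    have e2: "eta t * De t $ 2 $ 2 = exp (- log_T t * th3) * g2"
      unfolding E(2)[symmetric] eg De_def diag3_nth by (simp only: mult_ac)
    have e3: "De t $ 3 $ 3 = exp (- log_T t * th3)" by (simp add: De_def)
    have "exp (- log_T t * th3) * g1 * De' t $ 1 $ 1 = exp (- log_T t * th3) * exp (- log_T t * lam_plus) * g1"
      by (simp add: De'_def mult_ac)
    then have e4: "exp (- log_T t * th3) * g1 * De' t $ 1 $ 1 = l t" unfolding E(3) lg .
    have "exp (- log_T t * th3) * g2 * De' t $ 2 $ 2 = exp (- log_T t * th3) * exp (- log_T t * lam_minus) * g2"
      by (simp add: De'_def mult_ac)
    then have e5: "exp (- log_T t * th3) * g2 * De' t $ 2 $ 2 = eta t" unfolding E(4) eg .
    have e6: "exp (- log_T t * th3) * De' t $ 3 $ 3 = 1" by (simp add: De'_def flip: exp_add)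
    note e = e1 e2 e3 e4 e5 e6
    show ?case
    proof
      fix j
      have "l t * N t $ 1 $ j + eta t * N t $ 2 $ j + N t $ 3 $ j
        = ((l t * De t $ 1 $ 1) * M t $ 1 $ j + (eta t * De t $ 2 $ 2) * M t $ 2 $ j + De t $ 3 $ 3 * M t $ 3 $ j) * De' t $ j $ j"
        by (simp add: N_nth algebra_simps)
      also have "\<dots> = (g1 * M t $ 1 $ j + g2 * M t $ 2 $ j + M t $ 3 $ j) * exp (- log_T t * th3) * De' t $ j $ j"
        unfolding e(1-3) by (simp add: algebra_simps)
      also have "\<dots> = mu' * (if j = 1 then l t else if j = 2 then eta t else 1)"
        unfolding Mg using exhaust_3[of j] e(4-6) by (auto simp: algebra_simps)
      finally show "l t * N t $ 1 $ j + eta t * N t $ 2 $ j + N t $ 3 $ j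
        = mu' * (if j = 1 then l t else if j = 2 then eta t else 1)" .
    qed
  qed
  have orth: "eventually (\<lambda>t. l t * x t + eta t * rho t + 1 = 0) at_bot"
    using good
  proof eventually_elim
    case (elim t)
    have nz: "X t * (y (X t) - 1) \<noteq> 0" using elim by simp
    have "z1 t + z2 t + X t * (y (X t) - 1) / (X t * (y (X t) - 1))
        = ((1 - X t) * y (X t) + - (y (X t) - X t) + X t * (y (X t) - 1)) / (X t * (y (X t) - 1))"
      unfolding z1_def z2_def by (simp only: add_divide_distrib)
    also have "\<dots> = 0" by (simp add: algebra_simps)
    finally have z: "z1 t + z2 t + 1 = 0" using nz by simp
    have lx: "l t * x t = (z1 t * c1 / h1 t * (th1 - th2 - sg) + z2 t * c2 / h2 t * (th1 - th2 + sg))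
        * ((h2 t / c2 - h1 t / c1) / (2 * sg))"
      by (simp add: l_def x_def exp_minus)
    have er: "eta t * rho t = (z1 t * c1 / h1 t + z2 t * c2 / h2 t)
        * (((th1 - th2 + sg) * h1 t / c1 - (th1 - th2 - sg) * h2 t / c2) / (2 * sg))"
      by (simp add: eta_def rho_def)
    have "l t * x t + eta t * rho t = z1 t + z2 t"
      unfolding lx er using elim c sg_nz by (simp add: divide_simps) (simp add: algebra_simps)
    then show ?case using z by simp
  qed
  \<comment> \<open>The coordinates that the leading asymptotics determine: \<open>rho \<rightarrow> 1\<close> and \<open>l \<rightarrow> 2 \<sigma> J\<close>.\<close>
  have rho_eq: "rho t = ((th1 - th2 + sg) * (?sc t * h1 t / c1) - (th1 - th2 - sg) * (?sc t * h2 t / c2)) / (2 * sg)" for t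
    by (simp add: rho_def algebra_simps)
  have rho: "(rho \<longlongrightarrow> 1) at_bot"
    by (rule Lim_transform_eventually[OF model_vector_limit[OF B1 B2]])
      (use b in \<open>eventually_elim, simp add: rho_eq\<close>)
  have l: "(l \<longlongrightarrow> 2 * sg * J) at_bot"
  proof -
    define A where "A t = (1 - X t) / (1 - y (X t)) * (p t / (m1 (s t) * q1 (s t))) / B1 t" for t
    define A' where "A' t = ((p t - s t) / (m2 (s t) * q2 (s t))) / (1 - y (X t)) / B2 t" for t
    have "(A \<longlongrightarrow> (1 - 0) / (1 - 0) * 1 / 1) at_bot" unfolding A_def
      by (intro tendsto_intros X_tendsto y_tendsto p_ratio B1) simp_all
    then have A: "(A \<longlongrightarrow> 1) at_bot" by simp
    have "(A' \<longlongrightarrow> 1 / (1 - 0) / 1) at_bot" unfolding A'_def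
      by (intro tendsto_intros y_tendsto ps_ratio B2) simp_all
    then have A': "(A' \<longlongrightarrow> 1) at_bot" by simp
    have "((\<lambda>t. exp (- sg * Ln (1 - X t)) * ((th1 - th2 + sg) * (q2 (s t) * A' t) - (th1 - th2 - sg) * (q1 (s t) * A t)))
        \<longlongrightarrow> 1 * (2 * sg * J)) at_bot"
      by (intro tendsto_mult exp_Ln_tendsto model_covector_limit A A')
    then have lim: "((\<lambda>t. exp (- sg * Ln (1 - X t)) * ((th1 - th2 + sg) * (q2 (s t) * A' t) - (th1 - th2 - sg) * (q1 (s t) * A t)))
        \<longlongrightarrow> 2 * sg * J) at_bot" by simp
    have "eventually (\<lambda>t. exp (- sg * Ln (1 - X t)) * ((th1 - th2 + sg) * (q2 (s t) * A' t) - (th1 - th2 - sg) * (q1 (s t) * A t))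
        = l t) at_bot"
      using good b Bnz apart_zero_nz[OF m_apart(1)] apart_zero_nz[OF m_apart(2)]
        apart_zero_nz[OF m_apart(3)] apart_zero_nz[OF m_apart(4)]
    proof eventually_elim
      case (elim t)
      have e: "exp (- log_T t * sg) = exp (- sg * Ln (1 - X t)) * s t"
        by (simp add: log_T_def s_def algebra_simps flip: exp_add)
      have y1: "1 - y (X t) \<noteq> 0" "X t * (y (X t) - 1) \<noteq> 0" using elim by auto
      have sy: "s t * y (X t) = p t * X t"
        by (subst X_eq) (simp add: y_eq)
      have inv: "c / g / E = 1 / (E * g / c)" for c g E :: complex by (simp add: mult.commute)
      have sc1: "c1 / h1 t / ?sc t = 1 / (m1 (s t) * B1 t)" "c2 / h2 t / ?sc t = 1 / (m2 (s t) * B2 t)"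
        using elim(2) unfolding inv by simp_all
      define U V where "U = (1 - X t) / (1 - y (X t))" "V = 1 / (1 - y (X t))"
      have "s t * z1 t = - ((1 - X t) / (1 - y (X t)) * p t)"
        using y1 sy X_nz[of t] unfolding z1_def by (simp add: divide_simps) algebra
      then have sz1: "s t * (z1 t * c) = - (U * p t) * c" for c by (simp add: U_V_def flip: mult.assoc)
      have 1: "s t * (z1 t * (c1 / h1 t / ?sc t)) = - (q1 (s t) * A t)"
        unfolding sc1 A_def U_V_def(1)[symmetric] sz1 using elim(4-) by simp
      have "s t * z2 t = (p t - s t) * (1 / (1 - y (X t)))"
        using y1 sy X_nz[of t] unfolding z2_def by (simp add: divide_simps) algebra
      then have sz2: "s t * (z2 t * c) = (p t - s t) * V * c" for c by (simp add: U_V_def flip: mult.assoc)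
      have A't: "A' t = ((p t - s t) / (m2 (s t) * q2 (s t))) * V / B2 t"
        unfolding A'_def U_V_def by simp
      have 2: "s t * (z2 t * (c2 / h2 t / ?sc t)) = q2 (s t) * A' t"
        unfolding sc1 A't sz2 using elim(4-) by simp
      have "l t = exp (- sg * Ln (1 - X t)) * ((th1 - th2 - sg) * (s t * (z1 t * (c1 / h1 t / ?sc t)))
          + (th1 - th2 + sg) * (s t * (z2 t * (c2 / h2 t / ?sc t))))"
        unfolding l_def e by (simp add: divide_inverse algebra_simps)
      then show ?case unfolding 1 2 by (simp add: algebra_simps)
    qed
    with lim show ?thesis by (rule Lim_transform_eventually)
  qed
  \<comment> \<open>The power of \<open>T = (1 - x) / x\<close> by which \<open>N\<^sub>2\<^sub>1\<close> differs from \<open>M\<^sub>2\<^sub>1\<close> is compensated by the one in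
    the vector component; what remains is a bounded factor times \<open>M\<^sub>2\<^sub>1 \<rightarrow> 0\<close>.\<close>
  have Nx: "((\<lambda>t. N t $ 2 $ 1 * x t) \<longlongrightarrow> 0) at_bot"
  proof -
    have "((\<lambda>t. (W' ** delta 2 (Ph t) ** W) $ 2 $ 1) \<longlongrightarrow> (W' ** delta 2 Phi2 ** W) $ 2 $ 1) at_bot"
      by (intro tendsto_vec_nth matrix3_tendsto_mult tendsto_const D)
    moreover have "(W' ** delta 2 A ** W) $ 2 $ 1 = (W' ** A ** W) $ 2 $ 1" for A
      by (simp add: matrix3_mult_nth W_W'_def C_C'_def eigenbasis_def dual_eigenbasis_def)
    ultimately have M21: "((\<lambda>t. M t $ 2 $ 1) \<longlongrightarrow> 0) at_bot"
      using Q(4) by (simp add: M_def Q_def)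
    have "bdd (\<lambda>t. (m2 (s t) * B2 t - m1 (s t) * B1 t) * (1 / (2 * sg)))"
      by (intro bdd_intros m_bdd tendsto_bdd[OF B1] tendsto_bdd[OF B2])
    then have "((\<lambda>t. (m2 (s t) * B2 t - m1 (s t) * B1 t) * (1 / (2 * sg)) * M t $ 2 $ 1) \<longlongrightarrow> 0) at_bot"
      by (rule bdd_null_mult[OF _ M21])
    moreover have "eventually (\<lambda>t. (m2 (s t) * B2 t - m1 (s t) * B1 t) * (1 / (2 * sg)) * M t $ 2 $ 1 = N t $ 2 $ 1 * x t) at_bot"
      using b
    proof eventually_elim
      case (elim t)
      have "De t $ 2 $ 2 * De' t $ 1 $ 1 * exp (log_T t * sg) = 1"
        by (simp add: De_def De'_def lam_plus_def lam_minus_def flip: exp_add)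
          (simp add: algebra_simps add_divide_distrib diff_divide_distrib)
      moreover have "N t $ 2 $ 1 * x t = (De t $ 2 $ 2 * De' t $ 1 $ 1 * exp (log_T t * sg)) *
          (?sc t * (h2 t / c2 - h1 t / c1) * (1 / (2 * sg)) * M t $ 2 $ 1)"
        unfolding N_nth x_def by (simp only: mult_ac divide_inverse mult_1_left)
      moreover have "?sc t * (h2 t / c2 - h1 t / c1) = m2 (s t) * B2 t - m1 (s t) * B1 t"
        using elim by (simp add: right_diff_distrib)
      ultimately show ?case by simp
    qed
    ultimately show ?thesis by (rule Lim_transform_eventually)
  qed
  have ne: "Q$1$1 \<noteq> Q$2$2" using sg_nz by (simp add: Q lam_plus_def lam_minus_def)
  have J2: "2 * sg * J \<noteq> 0" using sg_nz J_nz by simp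
  note off = limit_matrix_from_eigenvectors[OF NQ _ Q(3,4) ne right left orth rho l J2 Nx, unfolded Q diff_minus_eq_add]
  have cc: "(mu + mu' - lam_minus + th3) / (lam_minus - lam_plus) = (th1 + th2 - sg) / (2 * sg)"
  proof -
    have a: "mu + mu' - lam_minus + th3 = - (th1 + th2 - sg) / 2" and b: "lam_minus - lam_plus = - sg"
      unfolding mu_mu'_def lam_plus_def lam_minus_def by (simp_all add: field_simps)
    show ?thesis unfolding a b using sg_nz by (simp add: field_simps)
  qed
  have "Q$1$3 = (mu - lam_plus) * ((th1 + th2 - sg) / (2 * sg) / (2 * sg * J))" "Q$2$3 = mu - lam_minus"
    "Q$3$1 = (mu' - lam_plus) * (2 * sg * J)" "Q$3$2 = (mu' - lam_minus) * (- 1 - (th1 + th2 - sg) / (2 * sg))"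
    using off unfolding cc by (simp_all only: trivial_limit_at_bot_linorder not_False_eq_True)
  moreover have "mu - lam_plus = - (th3 + thinf + sg) / 2" "mu - lam_minus = (- th3 - thinf + sg) / 2"
    "mu' - lam_plus = (thinf - th3 - sg) / 2" "mu' - lam_minus = (thinf - th3 + sg) / 2"
    unfolding mu_mu'_def lam_plus_def lam_minus_def by (simp_all add: field_simps)
  moreover have "(th1 + th2 - sg) / (2 * sg) / (2 * sg * J) = (th1 + th2 - sg) / (4 * sg\<^sup>2 * J)"
    by (simp add: power2_eq_square)
  moreover have "- 1 - (th1 + th2 - sg) / (2 * sg) = - ((th1 + th2 + sg) / (2 * sg))"
    using sg_nz by (simp add: field_simps)
  ultimately have Q_off: "Q$1$3 = - (th3 + thinf + sg) / 2 * ((th1 + th2 - sg) / (4 * sg\<^sup>2 * J))"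
    "Q$2$3 = (- th3 - thinf + sg) / 2" "Q$3$1 = (thinf - th3 - sg) * (sg * J)"
    "Q$3$2 = (thinf - th3 + sg) / 2 * (- ((th1 + th2 + sg) / (2 * sg)))"
    by simp_all
  have SQS: "eigenbasis ** Q ** dual_eigenbasis = boundary_matrix th3 thinf"
  proof -
    have nth: "(eigenbasis ** Q ** dual_eigenbasis) $ i $ j = (eigenbasis ** diag3 lam_plus lam_minus (- th3) ** dual_eigenbasis) $ i $ j"
      if "i \<noteq> 3 \<and> j \<noteq> 3 \<or> i = 3 \<and> j = 3" for i j
      using that exhaust_3[of i] exhaust_3[of j]
      by (auto simp: matrix3_mult_nth eigenbasis_def dual_eigenbasis_def Q)
    have block: "(eigenbasis ** Q ** dual_eigenbasis) $ i $ j = boundary_matrix th3 thinf $ i $ j"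
      if "i \<noteq> 3 \<and> j \<noteq> 3 \<or> i = 3 \<and> j = 3" for i j
      unfolding nth[OF that] eigenbasis_diagonalises
      using that exhaust_3[of i] exhaust_3[of j] by (auto simp: boundary_matrix_def)
    have "(eigenbasis ** Q ** dual_eigenbasis) $ 1 $ 3 = boundary_matrix th3 thinf $ 1 $ 3"
      using sg_nz J_nz by (simp add: matrix3_mult_nth eigenbasis_def dual_eigenbasis_def Q_off boundary_matrix_def field_simps power2_eq_square)
    moreover have "(eigenbasis ** Q ** dual_eigenbasis) $ 2 $ 3 = boundary_matrix th3 thinf $ 2 $ 3"
      using sg_nz J_nz by (simp add: matrix3_mult_nth eigenbasis_def dual_eigenbasis_def Q_off boundary_matrix_def field_simps power2_eq_square)
    moreover have "(eigenbasis ** Q ** dual_eigenbasis) $ 3 $ 1 = boundary_matrix th3 thinf $ 3 $ 1"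
      using sg_nz J_nz by (simp add: matrix3_mult_nth eigenbasis_def dual_eigenbasis_def Q_off boundary_matrix_def field_simps power2_eq_square)
    moreover have "(eigenbasis ** Q ** dual_eigenbasis) $ 3 $ 2 = boundary_matrix th3 thinf $ 3 $ 2"
      using sg_nz J_nz by (simp add: matrix3_mult_nth eigenbasis_def dual_eigenbasis_def Q_off boundary_matrix_def field_simps power2_eq_square)
    ultimately show ?thesis using block unfolding matrix3_eq_iff forall_3 by simp
  qed
  have "W ** Q ** W' = (W ** W') ** Phi2 ** (W ** W')" unfolding Q_def by (simp only: matrix_mul_assoc)
  then have "Phi2 = W ** Q ** W'" by (simp add: WW')
  also have "\<dots> = C ** (eigenbasis ** Q ** dual_eigenbasis) ** C'"
    by (simp only: W_W'_def matrix_mul_assoc)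
  finally show ?thesis unfolding SQS C_C'_def .
qed

end

section \<open>Existence of a suitable ray, and connectedness of the boundary matrix\<close>

context jimbo_data begin

text \<open>
  The direction is chosen for the four linear factors at once; the behaviour of \<open>x y'\<close> follows from
  that of \<open>y\<close> by Cauchy's inequality for the difference \<open>F\<close> from its model.
\<close>
lemma generic_solution_ray:
  assumes d: "0 < d" "d \<le> pi" and r: "0 < r"
    and gen: "PVI_generic_solution a d r sg J th1 th2 th3 thinf y"
  obtains a' eps where "\<bar>a' - a\<bar> < d" "generic_ray sg J th1 th2 y a' eps"
proof -
  have sg01: "0 \<le> Re sg" "Re sg < 1" using gen by (auto simp: PVI_generic_solution_def)
  have yhol: "y holomorphic_on sector a d \<inter> ball 0 r"
    using gen by (auto simp: PVI_generic_solution_def PVI_solution_def)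
  have op: "open (sector a d \<inter> ball 0 r)" using open_sector[OF d(2)] by auto
  obtain eps C t0 where eps: "0 < eps" "eps < 1 - Re sg" and C: "C \<ge> 0" and
    bound: "\<And>w. \<bar>Im w - a\<bar> < d \<Longrightarrow> Re w < t0 \<Longrightarrow>
       norm (exp ((sg - 1) * w) * y (exp w) - m1 (exp (sg * w)) * q1 (exp (sg * w))) \<le> C * exp (eps * Re w)"
    using generic_solution_log_coordinate[OF d(2) gen] by blast
  let ?B = "{alpha * (th1 - th2 - sg), alpha * (th1 - th2 + sg), beta * (th1 - th2 + sg) / J, beta * (th1 - th2 - sg) / J}"
  obtain a' where a': "\<bar>a' - a\<bar> < d"
    and ap: "\<And>b. b \<in> ?B \<Longrightarrow> \<exists>eta>0. eventually (\<lambda>t. norm (1 + b * exp (sg * Complex t a')) \<ge> eta) at_bot"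
    and bd: "\<exists>M. eventually (\<lambda>t. norm (exp (sg * Complex t a')) \<le> M) at_bot"
    using direction_avoiding_zeros[OF sg_nz sg01(1), of ?B d a] d(1) by blast
  define F where "F w = exp ((sg - 1) * w) * y (exp w) - m1 (exp (sg * w)) * q1 (exp (sg * w))" for w
  define t1 where "t1 = min t0 (ln r)"
  have in_dom: "exp w \<in> sector a d \<inter> ball 0 r" if "\<bar>Im w - a\<bar> < d" "Re w < t1" for w
  proof -
    have "norm (exp w) < r" using that(2) r unfolding t1_def
      by (metis exp_less_cancel_iff exp_ln min_less_iff_conj norm_exp_eq_Re)
    then show ?thesis using exp_in_sector[OF that(1) d(2)] by simp
  qed
  have y_der: "(y has_field_derivative deriv y (exp w)) (at (exp w))" if "\<bar>Im w - a\<bar> < d" "Re w < t1" for w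
    by (rule holomorphic_derivI[OF yhol op in_dom[OF that]])
  have F_der: "(F has_field_derivative
      (sg - 1) * (exp ((sg - 1) * w) * y (exp w)) + exp ((sg - 1) * w) * (exp w * deriv y (exp w))
      - sg * exp (sg * w) * (PVI_J2 sg th1 th2 + 2 * PVI_J1 sg J th1 th2 * exp (sg * w))) (at w)"
    if "\<bar>Im w - a\<bar> < d" "Re w < t1" for w
  proof -
    have yx: "((\<lambda>w. y (exp w)) has_field_derivative deriv y (exp w) * exp w) (at w)"
      by (rule DERIV_chain2[where f = y and g = exp, OF y_der[OF that] DERIV_exp])
    show ?thesis
      unfolding F_def m1_q1
      by (rule derivative_eq_intros yx refl)+ (simp add: algebra_simps power2_eq_square)
  qed
  have Fb: "norm (F w) \<le> C * exp (eps * Re w)" if "\<bar>Im w - a\<bar> < d" "Re w < t1" for w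
    using bound that unfolding F_def t1_def by simp
  have "F holomorphic_on {w. \<bar>Im w - a\<bar> < d \<and> Re w < t1}"
    by (rule holomorphic_onI)
      (use F_der in \<open>auto simp: field_differentiable_def intro: has_field_derivative_at_within\<close>)
  from deriv_on_strip_bigo[OF this Fb a' eps(1) C]
  have dF: "exp_small eps (\<lambda>t. deriv F (Complex t a'))" by (simp add: exp_small_def)
  have ev: "eventually (\<lambda>t. t < t1) at_bot" by (rule eventually_gt_at_bot)
  have Fs: "exp_small eps (\<lambda>t. F (Complex t a'))"
    unfolding exp_small_def
  proof (rule bigoI)
    show "eventually (\<lambda>t. norm (F (Complex t a')) \<le> C * norm (complex_of_real (exp (eps * t)))) at_bot"
      using ev by eventually_elim (use Fb[of "Complex _ a'"] a' in \<open>simp del: of_real_exp\<close>)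
  qed
  have aps: "apart_zero (\<lambda>t. c + b * exp (sg * Complex t a'))" if "b / c \<in> ?B" "c \<noteq> 0" for b c
  proof -
    have "apart_zero (\<lambda>t. c * (1 + b / c * exp (sg * Complex t a')))"
      using ap[OF that(1)] that(2) by (intro apart_zero_mult apart_zero_const) (auto simp: apart_zero_def)
    then show ?thesis using that(2) by (simp add: distrib_left)
  qed
  have "generic_ray sg J th1 th2 y a' eps"
  proof (unfold_locales)
    show "eps > 0" "eps < 1 - Re sg" "Re sg \<ge> 0" using eps sg01 by auto
    obtain M where "eventually (\<lambda>t. norm (exp (sg * Complex t a')) \<le> M) at_bot" using bd by blast
    then have "eventually (\<lambda>t. norm (exp (sg * Complex t a')) \<le> M * norm (1 :: complex)) at_bot" by simp
    then show "bdd (\<lambda>t. exp (sg * Complex t a'))" by (rule bigoI)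
    show "apart_zero (\<lambda>t. m1 (exp (sg * Complex t a')))" "apart_zero (\<lambda>t. m2 (exp (sg * Complex t a')))"
      "apart_zero (\<lambda>t. q1 (exp (sg * Complex t a')))" "apart_zero (\<lambda>t. q2 (exp (sg * Complex t a')))"
      unfolding m1_def m2_def q1_def q2_def using J_nz by (auto intro!: aps)
    show "exp_close eps (\<lambda>t. exp ((sg - 1) * Complex t a') * y (exp (Complex t a')))
        (\<lambda>t. m1 (exp (sg * Complex t a')) * q1 (exp (sg * Complex t a')))"
      using Fs by (simp add: exp_close_def F_def)
    have "exp_small eps (\<lambda>t. deriv F (Complex t a') + (1 - sg) * F (Complex t a'))"
      by (intro exp_small_add dF exp_small_mult' Fs bdd_const)
    then have "exp_close eps (\<lambda>t. deriv F (Complex t a') + (1 - sg) * F (Complex t a')) (\<lambda>t. 0)"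
      by (simp add: exp_close_zero)
    then have "exp_close eps (\<lambda>t. exp ((sg - 1) * Complex t a') * (exp (Complex t a') * deriv y (exp (Complex t a')))
        - (sg * exp (sg * Complex t a') * (PVI_J2 sg th1 th2 + 2 * PVI_J1 sg J th1 th2 * exp (sg * Complex t a'))
             + (1 - sg) * (m1 (exp (sg * Complex t a')) * q1 (exp (sg * Complex t a'))))) (\<lambda>t. 0)"
    proof (rule exp_close_cong)
      show "eventually (\<lambda>t. deriv F (Complex t a') + (1 - sg) * F (Complex t a') =
        exp ((sg - 1) * Complex t a') * (exp (Complex t a') * deriv y (exp (Complex t a')))
        - (sg * exp (sg * Complex t a') * (PVI_J2 sg th1 th2 + 2 * PVI_J1 sg J th1 th2 * exp (sg * Complex t a'))
             + (1 - sg) * (m1 (exp (sg * Complex t a')) * q1 (exp (sg * Complex t a'))))) at_bot"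
        using ev
      proof eventually_elim
        case (elim t)
        have d: "deriv F (Complex t a') = (sg - 1) * (exp ((sg - 1) * Complex t a') * y (exp (Complex t a')))
            + exp ((sg - 1) * Complex t a') * (exp (Complex t a') * deriv y (exp (Complex t a')))
            - sg * exp (sg * Complex t a') * (PVI_J2 sg th1 th2 + 2 * PVI_J1 sg J th1 th2 * exp (sg * Complex t a'))"
          using F_der[of "Complex t a'"] a' elim by (intro DERIV_imp_deriv) simp
        show ?case unfolding d F_def by (simp add: algebra_simps)
      qed
    qed simp
    then show "exp_close eps (\<lambda>t. exp ((sg - 1) * Complex t a') * (exp (Complex t a') * deriv y (exp (Complex t a'))))
        (\<lambda>t. sg * exp (sg * Complex t a') * (PVI_J2 sg th1 th2 + 2 * PVI_J1 sg J th1 th2 * exp (sg * Complex t a'))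
             + (1 - sg) * (m1 (exp (sg * Complex t a')) * q1 (exp (sg * Complex t a'))))"
      by (simp add: exp_close_def)
  qed
  then show ?thesis using that a' by blast
qed

text \<open>
  If the third column vanishes off the diagonal, then because of \<open>\<sigma> \<noteq> 0\<close> so do both terms in each of
  its entries, and this gives \<open>\<theta>\<^sub>1 + \<theta>\<^sub>2 = \<sigma>\<close>. In the same way a third row that vanishes off the diagonal
  gives \<open>\<theta>\<^sub>1 + \<theta>\<^sub>2 = - \<sigma>\<close>.
\<close>
lemma boundary_matrix_connected:
  "boundary_matrix th3 thinf $ 1 $ 2 \<noteq> 0 \<or> boundary_matrix th3 thinf $ 2 $ 1 \<noteq> 0"
  "boundary_matrix th3 thinf $ 1 $ 3 \<noteq> 0 \<or> boundary_matrix th3 thinf $ 2 $ 3 \<noteq> 0 \<or>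
   boundary_matrix th3 thinf $ 3 $ 1 \<noteq> 0 \<or> boundary_matrix th3 thinf $ 3 $ 2 \<noteq> 0"
proof -
  show "boundary_matrix th3 thinf $ 1 $ 2 \<noteq> 0 \<or> boundary_matrix th3 thinf $ 2 $ 1 \<noteq> 0"
  proof (rule ccontr)
    assume "\<not> ?thesis"
    then have 1: "th1 - th2 = sg" and 2: "- th1 + th2 = sg" by (auto simp: boundary_matrix_def)
    have "(th1 - th2) + (- th1 + th2) = 0" by simp
    then show False using sg_nz unfolding 1 2 by simp
  qed
  show "boundary_matrix th3 thinf $ 1 $ 3 \<noteq> 0 \<or> boundary_matrix th3 thinf $ 2 $ 3 \<noteq> 0 \<or>
   boundary_matrix th3 thinf $ 3 $ 1 \<noteq> 0 \<or> boundary_matrix th3 thinf $ 3 $ 2 \<noteq> 0"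
  proof (rule ccontr)
    let ?B = "boundary_matrix th3 thinf"
    assume "\<not> ?thesis"
    then have z: "?B$1$3 = 0" "?B$2$3 = 0" "?B$3$1 = 0" "?B$3$2 = 0" by auto
    define k where "k = 1 / (8 * sg\<^sup>2)"
    define kJ where "kJ = 1 / (8 * sg\<^sup>2 * J)"
    have k: "k \<noteq> 0" "kJ \<noteq> 0" using sg_nz J_nz by (auto simp: k_def kJ_def)
    have e: "1/2 * (- th3 - thinf + sg) - kJ * (th1 - th2 - sg) * (th1 + th2 - sg) * (th3 + thinf + sg) = 0"
      "1/2 * (- th3 - thinf + sg) - kJ * (th1 - th2 + sg) * (th1 + th2 - sg) * (th3 + thinf + sg) = 0"
      "J / 2 * (th3 - thinf + sg) - k * (- th1 + th2 - sg) * (th1 + th2 + sg) * (th3 - thinf - sg) = 0"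
      "J / 2 * (- th3 + thinf - sg) - k * (th1 - th2 - sg) * (th1 + th2 + sg) * (th3 - thinf - sg) = 0"
      using z unfolding boundary_matrix_def k_def kJ_def by (simp_all only: vector_3)
    have "kJ * (2 * sg) * ((th1 + th2 - sg) * (th3 + thinf + sg))
      = (1/2 * (- th3 - thinf + sg) - kJ * (th1 - th2 - sg) * (th1 + th2 - sg) * (th3 + thinf + sg))
        - (1/2 * (- th3 - thinf + sg) - kJ * (th1 - th2 + sg) * (th1 + th2 - sg) * (th3 + thinf + sg))"
      by (simp add: algebra_simps)
    then have "kJ * (2 * sg) * ((th1 + th2 - sg) * (th3 + thinf + sg)) = 0" unfolding e by simp
    then have c: "(th1 + th2 - sg) * (th3 + thinf + sg) = 0" using k sg_nz by simp
    then have c': "- th3 - thinf + sg = 0" using e(1) by auto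
    have "k * (2 * sg) * ((th1 + th2 + sg) * (th3 - thinf - sg))
      = (J / 2 * (th3 - thinf + sg) - k * (- th1 + th2 - sg) * (th1 + th2 + sg) * (th3 - thinf - sg))
        + (J / 2 * (- th3 + thinf - sg) - k * (th1 - th2 - sg) * (th1 + th2 + sg) * (th3 - thinf - sg))"
      by (simp add: algebra_simps add_divide_distrib diff_divide_distrib)
    then have "k * (2 * sg) * ((th1 + th2 + sg) * (th3 - thinf - sg)) = 0" unfolding e by simp
    then have r: "(th1 + th2 + sg) * (th3 - thinf - sg) = 0" using k sg_nz by simp
    then have r': "th3 - thinf + sg = 0" using e(3) J_nz by auto
    have nc: "th3 + thinf + sg = 2 * sg" using c' by (simp add: algebra_simps)
    have "th3 + thinf + sg \<noteq> 0" unfolding nc using sg_nz by simp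
    then have "th1 + th2 = sg" using c by auto
    moreover have nr: "th3 - thinf - sg = - 2 * sg" using r' by (simp add: algebra_simps)
    have "th3 - thinf - sg \<noteq> 0" unfolding nr using sg_nz by simp
    then have "th1 + th2 + sg = 0" using r by auto
    ultimately have "2 * sg = 0" by simp
    then show False using sg_nz by simp
  qed
qed

end

section \<open>From the configuration space to a ray\<close>

lemma matrix_inv_diag3:
  assumes "k1 \<noteq> 0" "k2 \<noteq> 0"
  shows "matrix_inv (diag3 k1 k2 1) = diag3 (1 / k1) (1 / k2) 1"
proof -
  have inv: "diag3 k1 k2 1 ** diag3 (1 / k1) (1 / k2) 1 = mat 1" "diag3 (1 / k1) (1 / k2) 1 ** diag3 k1 k2 1 = mat 1"
    using assms by (simp_all add: diag3_mult mat1_eq_diag3)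
  define M where "M = matrix_inv (diag3 k1 k2 1)"
  have "diag3 k1 k2 1 ** M = mat 1 \<and> M ** diag3 k1 k2 1 = mat 1"
    unfolding M_def matrix_inv_def by (rule someI) (use inv in blast)
  then have "M = M ** (diag3 k1 k2 1 ** diag3 (1 / k1) (1 / k2) 1)" "M ** diag3 k1 k2 1 = mat 1"
    using inv by simp_all
  then show ?thesis unfolding M_def[symmetric] by (simp add: matrix_mul_assoc)
qed

lemma delta1_eq: "delta 1 A = diag3 (A$1$1) (A$2$2) (A$3$3)"
  by (simp add: matrix3_eq_iff forall_3 delta_def index3_def)

lemma diag_conj_nth:
  "(diag3 a1 a2 a3 ** A ** diag3 b1 b2 b3) $ i $ j = diag3 a1 a2 a3 $ i $ i * A $ i $ j * diag3 b1 b2 b3 $ j $ j"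
  using exhaust_3[of i] exhaust_3[of j] by (auto simp: matrix3_mult_nth)

context jimbo_data begin

text \<open>
  The block is conjugate to the one of \<open>boundary_matrix\<close>, whose eigenvectors are the columns of
  \<open>eigenbasis\<close>.
\<close>
lemma eigenvalues_upper_left2:
  assumes Phi0: "Phi0 = diag3 k1 k2 1 ** boundary_matrix th3 thinf ** diag3 (1 / k1) (1 / k2) 1"
    and k: "k1 \<noteq> 0" "k2 \<noteq> 0"
  shows "eigenvalues (upper_left2 Phi0) = {lam_plus, lam_minus}"
proof -
  let ?A = "upper_left2 Phi0"
  define h where "h = (1 / 2 :: complex)"
  have h: "2 * h = 1" and half: "z / 2 = z * h" for z by (simp_all add: h_def)
  have A: "?A$1$1 = - th1" "?A$2$2 = - th2" "?A$1$2 = k1 / k2 * ((th1 - th2 - sg) * h)" "?A$2$1 = k2 / k1 * ((- th1 + th2 - sg) * h)"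
    using k unfolding half[symmetric] by (simp_all add: upper_left2_def Phi0 diag_conj_nth boundary_matrix_def)
  have prod: "?A$1$2 * ?A$2$1 = ((th1 - th2 - sg) * h) * ((- th1 + th2 - sg) * h)"
    unfolding A using k by simp
  have lams: "lam_plus = (- th1 - th2 + sg) * h" "lam_minus = (- th1 - th2 - sg) * h"
    by (simp_all add: lam_plus_def lam_minus_def half)
  have eig: "?A *v v = l *s v \<longleftrightarrow> ?A$1$1 * v$1 + ?A$1$2 * v$2 = l * v$1 \<and> ?A$2$1 * v$1 + ?A$2$2 * v$2 = l * v$2" for v l
    by (simp add: vec_eq_iff forall_2 matrix_vector_mult_def sum_2)
  have "l \<in> {lam_plus, lam_minus}" if v: "v \<noteq> 0" "?A *v v = l *s v" for l v
  proof -
    have e: "?A$1$1 * v$1 + ?A$1$2 * v$2 = l * v$1" "?A$2$1 * v$1 + ?A$2$2 * v$2 = l * v$2"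
      using v eig by auto
    have "((l - ?A$1$1) * (l - ?A$2$2) - ?A$1$2 * ?A$2$1) * v$1 = 0"
      "((l - ?A$1$1) * (l - ?A$2$2) - ?A$1$2 * ?A$2$1) * v$2 = 0"
      using e by algebra+
    moreover have "v$1 \<noteq> 0 \<or> v$2 \<noteq> 0" using v(1) by (auto simp: vec_eq_iff forall_2)
    ultimately have "(l - ?A$1$1) * (l - ?A$2$2) - ?A$1$2 * ?A$2$1 = 0" by auto
    then have "(l + th1) * (l + th2) - ((th1 - th2 - sg) * h) * ((- th1 + th2 - sg) * h) = 0"
      unfolding prod A(1,2) by simp
    moreover have "(l + th1) * (l + th2) - ((th1 - th2 - sg) * h) * ((- th1 + th2 - sg) * h) = (l - lam_plus) * (l - lam_minus)"
      unfolding lams using h by algebra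
    ultimately show ?thesis by simp
  qed
  moreover have "\<exists>v. v \<noteq> 0 \<and> ?A *v v = lam_plus *s v"
  proof (intro exI conjI)
    let ?v = "vector [k1 * (th1 - th2 - sg), k2 * (th1 - th2 + sg)] :: complex^2"
    show "?v \<noteq> 0"
    proof
      assume "?v = 0"
      then have "th1 - th2 - sg = 0" "th1 - th2 + sg = 0" using k by (auto simp: vec_eq_iff forall_2)
      then have "(th1 - th2 + sg) - (th1 - th2 - sg) = 0" by simp
      then show False using sg_nz by simp
    qed
    have 1: "- th1 * (k1 * (th1 - th2 - sg)) + k1 * ((th1 - th2 - sg) * h) * (th1 - th2 + sg)
        = (- th1 - th2 + sg) * h * (k1 * (th1 - th2 - sg))"
      and 2: "k2 * ((- th1 + th2 - sg) * h) * (th1 - th2 - sg) + - th2 * (k2 * (th1 - th2 + sg))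
        = (- th1 - th2 + sg) * h * (k2 * (th1 - th2 + sg))"
      using h by algebra+
    show "?A *v ?v = lam_plus *s ?v"
      unfolding eig A lams vector_2 using 1 2 k by (simp add: mult.assoc)
  qed
  moreover have "\<exists>v. v \<noteq> 0 \<and> ?A *v v = lam_minus *s v"
  proof (intro exI conjI)
    let ?v = "vector [k1, k2] :: complex^2"
    show "?v \<noteq> 0" using k by (auto simp: vec_eq_iff forall_2)
    have 1: "- th1 * k1 + k1 * ((th1 - th2 - sg) * h) = (- th1 - th2 - sg) * h * k1"
      and 2: "k2 * ((- th1 + th2 - sg) * h) + - th2 * k2 = (- th1 - th2 - sg) * h * k2"
      using h by algebra+
    show "?A *v ?v = lam_minus *s ?v"
      unfolding eig A lams vector_2 using 1 2 k by (simp add: mult.assoc)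
  qed
  ultimately show ?thesis unfolding eigenvalues_def by blast
qed

end

context generic_ray begin

text \<open>
  The boundary value is determined by the limit for a single choice of \<open>u\<^sub>1, u\<^sub>2\<close> and along a single ray
  of \<open>u\<^sub>3\<close>. For \<open>u\<^sub>1 = 0\<close>, \<open>u\<^sub>2 = exp (\<i> (a + b))\<close> and \<open>u\<^sub>3 = exp (- t + \<i> b')\<close> the variable \<open>x\<close> runs through
  the ray of argument \<open>a' = a + b - b'\<close>.
\<close>
lemma boundary_value_of_solution:
  fixes a b d r :: real and th3 thinf :: complex
    and Phi :: "complex^3 \<Rightarrow> complex^3^3" and Phi0 :: "complex^3^3"
  assumes dr: "0 < d" "d \<le> pi" "0 < r" and a': "\<bar>a' - a\<bar> < d"
    and cor: "corresponds a b d r th1 th2 th3 thinf y Phi"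
    and bv: "has_boundary_value a b d r Phi Phi0"
  obtains k1 k2 where "k1 \<noteq> 0" "k2 \<noteq> 0"
    "Phi0 = diag3 k1 k2 1 ** boundary_matrix th3 thinf ** diag3 (1 / k1) (1 / k2) 1"
proof -
  define b' where "b' = a + b - a'"
  define G where "G = Complex 0 (a + b)"
  define u where "u t = (vector [0, cis (a + b), exp (Complex (- t) b')] :: complex^3)" for t
  have cisG: "cis (a + b) = exp G" by (simp add: G_def cis_conv_exp Complex_eq mult.commute)
  have G_L: "Complex (- t) b' = G - Complex t a'" for t by (simp add: G_def b'_def complex_eq_iff)
  have xu: "xvar (u t) = X t" for t
    by (simp add: xvar_def u_def cisG X_def G_L exp_diff)
  have clogs: "clog b (exp (Complex (- t) b')) = Complex (- t) b'" "clog (a + b) (exp G) = G"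
    "clog a (X t) = Complex t a'" for t
    using a' dr unfolding X_def by (auto intro!: clog_exp simp: b'_def G_def)
  have conf: "u t \<in> config a b d r" if "t < ln r" for t
  proof -
    have "norm (X t) < r" using that dr(3) by (metis X_def complex.sel(1) exp_less_cancel_iff exp_ln norm_exp_eq_Re)
    moreover have "X t \<in> sector a d" unfolding X_def by (rule exp_in_sector) (use a' dr in auto)
    moreover have "exp (Complex (- t) b') \<in> sector b pi" by (rule exp_in_sector) (use a' dr in \<open>auto simp: b'_def\<close>)
    moreover have "exp G \<in> sector (a + b) pi" by (rule exp_in_sector) (auto simp: G_def)
    ultimately show ?thesis
      unfolding config_def by (simp add: xu clogs) (simp add: u_def cisG clogs, simp add: G_L)
  qed
  have ev_conf: "eventually (\<lambda>t. u t \<in> config a b d r) at_bot"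
    using eventually_gt_at_bot[of "ln r"] by eventually_elim (rule conf)
  obtain k1 k2 :: "complex \<Rightarrow> complex" where
    kd: "\<And>x. x \<in> sector a d \<inter> ball 0 r \<Longrightarrow> y x \<notin> {0, 1, x} \<Longrightarrow>
         k1 x \<noteq> 0 \<and> k2 x \<noteq> 0 \<and>
         (k1 has_field_derivative pvi_l1 th1 th2 th3 y x * k1 x) (at x) \<and>
         (k2 has_field_derivative pvi_l2 th1 th2 th3 y x * k2 x) (at x)"
    and Om: "\<And>u. u \<in> config a b d r \<Longrightarrow> (let x = xvar u; Om = Omega_of b Phi u in
         y x \<notin> {0, 1, x} \<longrightarrow>
         Om$1$2 = k1 x / k2 x * (pvi_f th1 th2 th3 thinf y x / (2 * (1 - x) * y x)) \<and>
         Om$2$1 = k2 x / k1 x * (pvi_f (- th1) (- th2) th3 thinf y x / (2 * (y x - x))) \<and>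
         Om$1$3 = k1 x * (pvi_f th1 (th1 - th3 - thinf) th3 thinf y x / (2 * (x - 1) * y x)) \<and>
         Om$3$1 = 1 / k1 x *
           (pvi_f (- th1) (- th1 + th3 - thinf) th3 thinf y x / (2 * x * (y x - 1))) \<and>
         Om$2$3 = k2 x * (pvi_f (- th2 + th3 + thinf) (- th2) th3 thinf y x / (2 * (x - y x))) \<and>
         Om$3$2 = 1 / k2 x *
           (pvi_f (th2 - th3 + thinf) th2 th3 thinf y x / (2 * x * (1 - y x))))"
    and cls: "PVI_isomonodromy_class th1 th2 th3 thinf (config a b d r) Phi"
    using cor unfolding corresponds_def by blast
  have X_dom: "X t \<in> sector a d \<inter> ball 0 r" if "u t \<in> config a b d r" for t
    using that unfolding config_def by (simp add: xu)
  have kev: "eventually (\<lambda>t. k1 (X t) \<noteq> 0 \<and> k2 (X t) \<noteq> 0 \<and>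
       (k1 has_field_derivative pvi_l1 th1 th2 th3 y (X t) * k1 (X t)) (at (X t)) \<and>
       (k2 has_field_derivative pvi_l2 th1 th2 th3 y (X t) * k2 (X t)) (at (X t))) at_bot"
    using ev_conf regular by eventually_elim (rule kd[OF X_dom])
  obtain kap1 kap2 where kap: "kap1 \<noteq> 0" "kap2 \<noteq> 0"
    and klim: "((\<lambda>t. k1 (X t) * exp (- ((th1 - th2 - sg) / 2) * Complex t a') / m1 (s t)) \<longlongrightarrow> kap1) at_bot"
    "((\<lambda>t. k2 (X t) * exp (- (- (th1 - th2 + sg) / 2) * Complex t a') / m2 (s t)) \<longlongrightarrow> kap2) at_bot"
    using k_limits[OF kev] by blast
  define h1 where "h1 t = k1 (X t) * exp ((th1 - th3) * (G - Complex t a'))" for t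
  define h2 where "h2 t = k2 (X t) * exp ((th2 - th3) * (G - Complex t a'))" for t
  define c1 where "c1 = exp ((th1 - th3) * G) * kap1"
  define c2 where "c2 = exp ((th2 - th3) * G) * kap2"
  define Ph where "Ph t = Phi (u t)" for t
  have Ph: "eventually (\<lambda>t. h1 t \<noteq> 0 \<and> h2 t \<noteq> 0 \<and>
      Ph t = diag3 (h1 t) (h2 t) 1 ** normalised_Omega th1 th2 th3 thinf y (X t) ** diag3 (1 / h1 t) (1 / h2 t) 1) at_bot"
    using ev_conf regular kev
  proof eventually_elim
    case (elim t)
    let ?N = "normalised_Omega th1 th2 th3 thinf y (X t)"
    define L where "L = G - Complex t a'"
    have dl: "delta 1 (Ph t) = - diag3 th1 th2 th3"
      using cls elim(1) unfolding PVI_isomonodromy_class_def Ph_def by blast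
    then have dg: "Ph t $ 1 $ 1 = - th1" "Ph t $ 2 $ 2 = - th2" "Ph t $ 3 $ 3 = - th3"
      unfolding delta1_eq by (auto simp: matrix3_eq_iff forall_3)
    have "- delta 1 (Ph t) = diag3 th1 th2 th3" using dl by simp
    then have "Omega_of b Phi (u t) = diag3 (exp (- L * th1)) (exp (- L * th2)) (exp (- L * th3)) ** Ph t
        ** diag3 (exp (L * th1)) (exp (L * th2)) (exp (L * th3))"
      unfolding Omega_of_def Ph_def[symmetric] dl
      by (simp add: matrix_pow_diag3 u_def clogs) (simp add: L_def G_L)
    then have O: "Omega_of b Phi (u t) $ i $ j = diag3 (exp (- L * th1)) (exp (- L * th2)) (exp (- L * th3)) $ i $ i * Ph t $ i $ j
        * diag3 (exp (L * th1)) (exp (L * th2)) (exp (L * th3)) $ j $ j" for i j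
      by (simp only: diag_conj_nth)
    have P: "Ph t $ i $ j = diag3 (exp (L * th1)) (exp (L * th2)) (exp (L * th3)) $ i $ i * Omega_of b Phi (u t) $ i $ j
        * diag3 (exp (- L * th1)) (exp (- L * th2)) (exp (- L * th3)) $ j $ j" for i j
      unfolding O using exhaust_3[of i] exhaust_3[of j] by (auto simp: exp_minus)
    have k: "k1 (X t) \<noteq> 0" "k2 (X t) \<noteq> 0" using elim by auto
    have Om_t: "Omega_of b Phi (u t) $ 1 $ 2 = k1 (X t) / k2 (X t) * ?N$1$2"
      "Omega_of b Phi (u t) $ 2 $ 1 = k2 (X t) / k1 (X t) * ?N$2$1"
      "Omega_of b Phi (u t) $ 1 $ 3 = k1 (X t) * ?N$1$3"
      "Omega_of b Phi (u t) $ 3 $ 1 = 1 / k1 (X t) * ?N$3$1"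
      "Omega_of b Phi (u t) $ 2 $ 3 = k2 (X t) * ?N$2$3"
      "Omega_of b Phi (u t) $ 3 $ 2 = 1 / k2 (X t) * ?N$3$2"
      using Om[OF elim(1)] elim(2) unfolding Let_def xu normalised_Omega_def vector_3 by blast+
    have h: "h1 t = k1 (X t) * (exp (L * th1) * exp (- L * th3))" "h2 t = k2 (X t) * (exp (L * th2) * exp (- L * th3))"
      unfolding h1_def h2_def L_def[symmetric] exp_add[symmetric] by (simp_all add: algebra_simps)
    have "Ph t = diag3 (h1 t) (h2 t) 1 ** ?N ** diag3 (1 / h1 t) (1 / h2 t) 1"
      unfolding matrix3_eq_iff forall_3 diag_conj_nth
    proof (intro conjI)
      show "Ph t $ 1 $ 1 = diag3 (h1 t) (h2 t) 1 $ 1 $ 1 * ?N $ 1 $ 1 * diag3 (1 / h1 t) (1 / h2 t) 1 $ 1 $ 1"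
        "Ph t $ 2 $ 2 = diag3 (h1 t) (h2 t) 1 $ 2 $ 2 * ?N $ 2 $ 2 * diag3 (1 / h1 t) (1 / h2 t) 1 $ 2 $ 2"
        "Ph t $ 3 $ 3 = diag3 (h1 t) (h2 t) 1 $ 3 $ 3 * ?N $ 3 $ 3 * diag3 (1 / h1 t) (1 / h2 t) 1 $ 3 $ 3"
        using k by (simp_all add: dg h normalised_Omega_def)
    qed (unfold P Om_t h, use k in \<open>simp_all add: exp_minus field_simps\<close>)
    then show ?case using k by (simp add: h1_def h2_def)
  qed
  have hl: "((\<lambda>t. h1 t * exp (- (th3 + lam_minus) * Complex t a') / m1 (s t)) \<longlongrightarrow> c1) at_bot"
    "((\<lambda>t. h2 t * exp (- (th3 + lam_minus) * Complex t a') / m2 (s t)) \<longlongrightarrow> c2) at_bot"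
  proof -
    have 1: "exp ((th1 - th3) * (G - Complex t a')) * exp (- (th3 + lam_minus) * Complex t a')
        = exp ((th1 - th3) * G) * exp (- ((th1 - th2 - sg) / 2) * Complex t a')" for t
      unfolding exp_add[symmetric] by (simp add: lam_minus_def field_simps)
    have "h1 t * exp (- (th3 + lam_minus) * Complex t a') / m1 (s t)
       = exp ((th1 - th3) * G) * (k1 (X t) * exp (- ((th1 - th2 - sg) / 2) * Complex t a') / m1 (s t))" for t
      unfolding h1_def mult.assoc 1 by simp
    then show "((\<lambda>t. h1 t * exp (- (th3 + lam_minus) * Complex t a') / m1 (s t)) \<longlongrightarrow> c1) at_bot"
      unfolding c1_def by (simp only:) (intro tendsto_mult tendsto_const klim)
    have 2: "exp ((th2 - th3) * (G - Complex t a')) * exp (- (th3 + lam_minus) * Complex t a')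
        = exp ((th2 - th3) * G) * exp (- (- (th1 - th2 + sg) / 2) * Complex t a')" for t
      unfolding exp_add[symmetric] by (simp add: lam_minus_def field_simps)
    have "h2 t * exp (- (th3 + lam_minus) * Complex t a') / m2 (s t)
       = exp ((th2 - th3) * G) * (k2 (X t) * exp (- (- (th1 - th2 + sg) / 2) * Complex t a') / m2 (s t))" for t
      unfolding h2_def mult.assoc 2 by simp
    then show "((\<lambda>t. h2 t * exp (- (th3 + lam_minus) * Complex t a') / m2 (s t)) \<longlongrightarrow> c2) at_bot"
      unfolding c2_def by (simp only:) (intro tendsto_mult tendsto_const klim)
  qed
  have c: "c1 \<noteq> 0" "c2 \<noteq> 0" using kap by (simp_all add: c1_def c2_def)
  define F where "F = inf at_infinity (principal {u3. vector [0, cis (a + b), u3] \<in> config a b d r})"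
  have lim_u: "filterlim (\<lambda>t. exp (Complex (- t) b')) F at_bot"
    unfolding F_def filterlim_inf filterlim_principal
  proof
    have "filterlim (\<lambda>t. exp (- t :: real)) at_top at_bot"
      by (rule filterlim_compose[OF exp_at_top filterlim_uminus_at_top_at_bot])
    then show "filterlim (\<lambda>t. exp (Complex (- t) b')) at_infinity at_bot"
      by (intro filterlim_norm_at_top_imp_at_infinity) simp
    show "eventually (\<lambda>t. exp (Complex (- t) b') \<in> {u3. vector [0, cis (a + b), u3] \<in> config a b d r}) at_bot"
      using ev_conf by (simp add: u_def)
  qed
  obtain Phi2f :: "complex \<Rightarrow> complex \<Rightarrow> complex^3^3" where Phi2f:
    "\<And>u1 u2. u2 - u1 \<in> sector (a + b) pi \<Longrightarrow>
        (let F = inf at_infinity (principal {u3. vector [u1, u2, u3] \<in> config a b d r});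
             D2 = delta 2 (Phi2f u1 u2);
             D1 = delta 1 Phi0
         in ((\<lambda>u3. delta 2 (Phi (vector [u1, u2, u3]))) \<longlongrightarrow> D2) F \<and>
            ((\<lambda>u3. matrix_pow (log_ratio a (vector [u1, u2, u3])) D2
                    ** Phi (vector [u1, u2, u3])
                    ** matrix_pow (log_ratio a (vector [u1, u2, u3])) (- D2))
               \<longlongrightarrow> Phi2f u1 u2) F \<and>
            matrix_pow (clog (a + b) (u2 - u1)) D1 ** Phi2f u1 u2
              ** matrix_pow (clog (a + b) (u2 - u1)) (- D1) = Phi0)"
    using bv unfolding has_boundary_value_def by blast
  define Phi2 where "Phi2 = Phi2f 0 (cis (a + b))"
  have "cis (a + b) - 0 \<in> sector (a + b) pi"
    unfolding cisG by (simp, rule exp_in_sector) (auto simp: G_def)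
  from Phi2f[OF this] have lims:
    "((\<lambda>u3. delta 2 (Phi (vector [0, cis (a + b), u3]))) \<longlongrightarrow> delta 2 Phi2) F"
    "((\<lambda>u3. matrix_pow (log_ratio a (vector [0, cis (a + b), u3])) (delta 2 Phi2)
                    ** Phi (vector [0, cis (a + b), u3])
                    ** matrix_pow (log_ratio a (vector [0, cis (a + b), u3])) (- delta 2 Phi2))
               \<longlongrightarrow> Phi2) F"
    and eq0: "matrix_pow G (delta 1 Phi0) ** Phi2 ** matrix_pow G (- delta 1 Phi0) = Phi0"
    unfolding Let_def Phi2_def[symmetric] F_def[symmetric] by (simp_all add: clogs cisG)
  have lr: "log_ratio a (u t) = log_T t" for t
    by (simp add: log_ratio_def xu clogs log_T_def)
  have D: "((\<lambda>t. delta 2 (Ph t)) \<longlongrightarrow> delta 2 Phi2) at_bot"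
    using filterlim_compose[OF lims(1) lim_u] unfolding Ph_def u_def .
  have Psi: "((\<lambda>t. matrix_pow (log_T t) (delta 2 Phi2) ** Ph t ** matrix_pow (log_T t) (- delta 2 Phi2)) \<longlongrightarrow> Phi2) at_bot"
    using filterlim_compose[OF lims(2) lim_u] unfolding Ph_def lr[symmetric] unfolding u_def .
  have Phi2: "Phi2 = diag3 c1 c2 1 ** boundary_matrix th3 thinf ** diag3 (1 / c1) (1 / c2) 1"
    by (rule boundary_value_of_ray[OF Ph hl c D Psi])
  have Phi2_nth: "Phi2 $ i $ j = diag3 c1 c2 1 $ i $ i * boundary_matrix th3 thinf $ i $ j * diag3 (1 / c1) (1 / c2) 1 $ j $ j" for i j
    unfolding Phi2 diag_conj_nth ..
  define e where "e i = Phi0 $ i $ i" for i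
  have "Phi0 = diag3 (exp (G * e 1)) (exp (G * e 2)) (exp (G * e 3)) ** Phi2
      ** diag3 (exp (- G * e 1)) (exp (- G * e 2)) (exp (- G * e 3))"
    using eq0 unfolding delta1_eq matrix_pow_diag3 e_def by simp
  then have Phi0_nth: "Phi0 $ i $ j = diag3 (exp (G * e 1)) (exp (G * e 2)) (exp (G * e 3)) $ i $ i * Phi2 $ i $ j
      * diag3 (exp (- G * e 1)) (exp (- G * e 2)) (exp (- G * e 3)) $ j $ j" for i j
    using diag_conj_nth by metis
  have "Phi0 $ i $ i = Phi2 $ i $ i" for i
    unfolding Phi0_nth using exhaust_3[of i] by (auto simp: exp_minus)
  then have ei: "e 1 = - th1" "e 2 = - th2" "e 3 = - th3"
    using c unfolding e_def Phi2_nth by (simp_all add: boundary_matrix_def)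
  have cc: "c1 = exp (G * th1) * exp (- (G * th3)) * kap1" "c2 = exp (G * th2) * exp (- (G * th3)) * kap2"
    unfolding c1_def c2_def exp_add[symmetric] by (simp_all add: algebra_simps)
  have "Phi0 = diag3 kap1 kap2 1 ** boundary_matrix th3 thinf ** diag3 (1 / kap1) (1 / kap2) 1"
    unfolding matrix3_eq_iff
  proof (intro allI)
    fix i j
    show "Phi0 $ i $ j = (diag3 kap1 kap2 1 ** boundary_matrix th3 thinf ** diag3 (1 / kap1) (1 / kap2) 1) $ i $ j"
      unfolding diag_conj_nth Phi0_nth Phi2_nth ei cc
      using exhaust_3[of i] exhaust_3[of j] kap by (auto simp: exp_minus)
  qed
  then show ?thesis using that kap by blast
qed

end

section \<open>The theorem\<close>

context jimbo_data begin

lemma eq_boundary_matrix_iff: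
  "P = boundary_matrix th3 thinf \<longleftrightarrow>
     P$1$1 = - th1 \<and> P$2$2 = - th2 \<and> P$3$3 = - th3 \<and>
     P$1$2 = (th1 - th2 - sg) / 2 \<and>
     P$2$1 = (- th1 + th2 - sg) / 2 \<and>
     P$1$3 = 1/2 * (- th3 - thinf + sg)
       - 1 / (8 * sg\<^sup>2 * J) * (th1 - th2 - sg) * (th1 + th2 - sg) * (th3 + thinf + sg) \<and>
     P$3$1 = J / 2 * (th3 - thinf + sg)
       - 1 / (8 * sg\<^sup>2) * (- th1 + th2 - sg) * (th1 + th2 + sg) * (th3 - thinf - sg) \<and>
     P$2$3 = 1/2 * (- th3 - thinf + sg)
       - 1 / (8 * sg\<^sup>2 * J) * (th1 - th2 + sg) * (th1 + th2 - sg) * (th3 + thinf + sg) \<and>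
     P$3$2 = J / 2 * (- th3 + thinf - sg)
       - 1 / (8 * sg\<^sup>2) * (th1 - th2 - sg) * (th1 + th2 + sg) * (th3 - thinf - sg)"
  unfolding matrix3_eq_iff forall_3 boundary_matrix_def vector_3 by blast

text \<open>
  Two normalisations differ by a diagonal matrix \<open>diag3 x1 x2 1\<close> that commutes with \<open>boundary_matrix\<close>.
  A nonzero entry at \<open>(i, j)\<close> forces the diagonal entries with indices \<open>i\<close> and \<open>j\<close> to agree.
\<close>
lemma unique_normalisation:
  fixes Phi0 :: "complex^3^3"
  assumes Phi0: "Phi0 = diag3 k1 k2 1 ** boundary_matrix th3 thinf ** diag3 (1 / k1) (1 / k2) 1"
    and k: "k1 \<noteq> 0" "k2 \<noteq> 0"
  shows "\<exists>!K. (\<exists>k1 k2. k1 \<noteq> 0 \<and> k2 \<noteq> 0 \<and> K = diag3 k1 k2 1) \<and>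
    matrix_inv K ** Phi0 ** K = boundary_matrix th3 thinf"
proof (rule ex1I[of _ "diag3 k1 k2 1"])
  let ?B = "boundary_matrix th3 thinf"
  have conj: "(matrix_inv (diag3 l1 l2 1) ** Phi0 ** diag3 l1 l2 1) $ i $ j
      = diag3 (k1 / l1) (k2 / l2) 1 $ i $ i * ?B $ i $ j * diag3 (l1 / k1) (l2 / k2) 1 $ j $ j"
    if l: "l1 \<noteq> 0" "l2 \<noteq> 0" for l1 l2 i j
    unfolding matrix_inv_diag3[OF l] diag_conj_nth Phi0
    using exhaust_3[of i] exhaust_3[of j] k l by auto
  show "(\<exists>k1' k2'. k1' \<noteq> 0 \<and> k2' \<noteq> 0 \<and> diag3 k1 k2 1 = diag3 k1' k2' 1) \<and>
      matrix_inv (diag3 k1 k2 1) ** Phi0 ** diag3 k1 k2 1 = ?B"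
  proof
    show "\<exists>k1' k2'. k1' \<noteq> 0 \<and> k2' \<noteq> 0 \<and> diag3 k1 k2 1 = diag3 k1' k2' 1" using k by blast
    show "matrix_inv (diag3 k1 k2 1) ** Phi0 ** diag3 k1 k2 1 = ?B"
      unfolding matrix3_eq_iff forall_3 conj[OF k] using k by simp
  qed
  fix K assume "(\<exists>k1 k2. k1 \<noteq> 0 \<and> k2 \<noteq> 0 \<and> K = diag3 k1 k2 1) \<and> matrix_inv K ** Phi0 ** K = ?B"
  then obtain l1 l2 where l: "l1 \<noteq> 0" "l2 \<noteq> 0" and K: "K = diag3 l1 l2 1"
    and eq: "matrix_inv K ** Phi0 ** K = ?B" by blast
  define x1 x2 where "x1 = k1 / l1" "x2 = k2 / l2"
  have inv: "l1 / k1 = 1 / x1" "l2 / k2 = 1 / x2" and x: "x1 \<noteq> 0" "x2 \<noteq> 0"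
    using k l by (simp_all add: x1_x2_def)
  have B: "diag3 x1 x2 1 $ i $ i * ?B $ i $ j * diag3 (1 / x1) (1 / x2) 1 $ j $ j = ?B $ i $ j" for i j
    using conj[OF l, of i j] unfolding K[symmetric] eq x1_x2_def[symmetric] inv by simp
  have "x1 = x2" using boundary_matrix_connected(1)[of th3 thinf] B[of 1 2] B[of 2 1] x
    by (auto simp: field_simps)
  moreover have "x1 = 1 \<or> x2 = 1"
    using boundary_matrix_connected(2)[of th3 thinf] B[of 1 3] B[of 2 3] B[of 3 1] B[of 3 2] x
    by (auto simp: field_simps)
  ultimately have "x1 = 1" "x2 = 1" by auto
  then have "l1 = k1" "l2 = k2" using l by (auto simp: x1_x2_def)
  then show "K = diag3 k1 k2 1" using K by simp
qed

end

theorem theorem1p4: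
  fixes a b d r :: real
    and sg J th1 th2 th3 thinf :: complex
    and y :: "complex \<Rightarrow> complex"
    and Phi :: "complex^3 \<Rightarrow> complex^3^3"
    and Phi0 :: "complex^3^3"
  assumes "0 < d" "d \<le> pi" "0 < r" "r \<le> 1"
    and "sg \<noteq> 0" "J \<noteq> 0"
    and "PVI_generic_solution a d r sg J th1 th2 th3 thinf y"
    and "corresponds a b d r th1 th2 th3 thinf y Phi"
    and "has_boundary_value a b d r Phi Phi0"
  shows "(\<exists>!K. (\<exists>k1 k2. k1 \<noteq> 0 \<and> k2 \<noteq> 0 \<and> K = diag3 k1 k2 1) \<and>
      (let P = matrix_inv K ** Phi0 ** K in
        P$1$1 = - th1 \<and> P$2$2 = - th2 \<and> P$3$3 = - th3 \<and>
        P$1$2 = (th1 - th2 - sg) / 2 \<and>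
        P$2$1 = (- th1 + th2 - sg) / 2 \<and>
        P$1$3 = 1/2 * (- th3 - thinf + sg)
          - 1 / (8 * sg\<^sup>2 * J) * (th1 - th2 - sg) * (th1 + th2 - sg) * (th3 + thinf + sg) \<and>
        P$3$1 = J / 2 * (th3 - thinf + sg)
          - 1 / (8 * sg\<^sup>2) * (- th1 + th2 - sg) * (th1 + th2 + sg) * (th3 - thinf - sg) \<and>
        P$2$3 = 1/2 * (- th3 - thinf + sg)
          - 1 / (8 * sg\<^sup>2 * J) * (th1 - th2 + sg) * (th1 + th2 - sg) * (th3 + thinf + sg) \<and>
        P$3$2 = J / 2 * (- th3 + thinf - sg)
          - 1 / (8 * sg\<^sup>2) * (th1 - th2 - sg) * (th1 + th2 + sg) * (th3 - thinf - sg)))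
    \<and> (\<exists>l1 l2. eigenvalues (upper_left2 Phi0) = {l1, l2} \<and> Re l1 \<ge> Re l2 \<and> sg = l1 - l2)
    \<and> (\<forall>l1 l2. eigenvalues (upper_left2 Phi0) = {l1, l2} \<and> Re l1 \<ge> Re l2 \<longrightarrow>
         (sg = l1 - l2 \<or> Re l1 = Re l2 \<and> sg = l2 - l1) \<and>
         (\<bar>Re (l1 - l2)\<bar> < 1 \<longleftrightarrow> 0 \<le> Re sg \<and> Re sg < 1))"
proof -
  interpret jimbo_data sg J th1 th2
    using assms by unfold_locales
  have sg: "0 \<le> Re sg" "Re sg < 1"
    using assms(7) by (simp_all add: PVI_generic_solution_def)
  obtain a' eps where a': "\<bar>a' - a\<bar> < d" and "generic_ray sg J th1 th2 y a' eps"
    using generic_solution_ray[OF assms(1-3,7)] by blast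
  then interpret generic_ray sg J th1 th2 y a' eps by simp
  obtain k1 k2 where k: "k1 \<noteq> 0" "k2 \<noteq> 0"
    and Phi0: "Phi0 = diag3 k1 k2 1 ** boundary_matrix th3 thinf ** diag3 (1 / k1) (1 / k2) 1"
    using boundary_value_of_solution[OF assms(1-3) a' assms(8,9)] by blast
  have sg_eq: "sg = lam_plus - lam_minus" by (simp add: lam_plus_def lam_minus_def field_simps)
  have ev: "eigenvalues (upper_left2 Phi0) = {lam_plus, lam_minus}"
    by (rule eigenvalues_upper_left2[OF Phi0 k])
  show ?thesis
  proof (intro conjI)
    show "\<exists>!K. (\<exists>k1 k2. k1 \<noteq> 0 \<and> k2 \<noteq> 0 \<and> K = diag3 k1 k2 1) \<and>
      (let P = matrix_inv K ** Phi0 ** K in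
        P$1$1 = - th1 \<and> P$2$2 = - th2 \<and> P$3$3 = - th3 \<and>
        P$1$2 = (th1 - th2 - sg) / 2 \<and>
        P$2$1 = (- th1 + th2 - sg) / 2 \<and>
        P$1$3 = 1/2 * (- th3 - thinf + sg)
          - 1 / (8 * sg\<^sup>2 * J) * (th1 - th2 - sg) * (th1 + th2 - sg) * (th3 + thinf + sg) \<and>
        P$3$1 = J / 2 * (th3 - thinf + sg)
          - 1 / (8 * sg\<^sup>2) * (- th1 + th2 - sg) * (th1 + th2 + sg) * (th3 - thinf - sg) \<and>
        P$2$3 = 1/2 * (- th3 - thinf + sg)
          - 1 / (8 * sg\<^sup>2 * J) * (th1 - th2 + sg) * (th1 + th2 - sg) * (th3 + thinf + sg) \<and>
        P$3$2 = J / 2 * (- th3 + thinf - sg)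
          - 1 / (8 * sg\<^sup>2) * (th1 - th2 - sg) * (th1 + th2 + sg) * (th3 - thinf - sg))"
      using unique_normalisation[OF Phi0 k] unfolding Let_def eq_boundary_matrix_iff .
    show "\<exists>l1 l2. eigenvalues (upper_left2 Phi0) = {l1, l2} \<and> Re l1 \<ge> Re l2 \<and> sg = l1 - l2"
    proof (intro exI conjI)
      show "eigenvalues (upper_left2 Phi0) = {lam_plus, lam_minus}" "sg = lam_plus - lam_minus"
        by (rule ev, rule sg_eq)
      show "Re lam_plus \<ge> Re lam_minus" using sg(1) by (simp add: lam_plus_def lam_minus_def)
    qed
    show "\<forall>l1 l2. eigenvalues (upper_left2 Phi0) = {l1, l2} \<and> Re l1 \<ge> Re l2 \<longrightarrow>
         (sg = l1 - l2 \<or> Re l1 = Re l2 \<and> sg = l2 - l1) \<and>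
         (\<bar>Re (l1 - l2)\<bar> < 1 \<longleftrightarrow> 0 \<le> Re sg \<and> Re sg < 1)"
    proof (intro allI impI)
      fix l1 l2 assume "eigenvalues (upper_left2 Phi0) = {l1, l2} \<and> Re l1 \<ge> Re l2"
      then have l: "{lam_plus, lam_minus} = {l1, l2}" "Re l1 \<ge> Re l2" using ev by auto
      then consider "l1 = lam_plus" "l2 = lam_minus" | "l1 = lam_minus" "l2 = lam_plus"
        by (auto simp: doubleton_eq_iff)
      then show "(sg = l1 - l2 \<or> Re l1 = Re l2 \<and> sg = l2 - l1) \<and>
         (\<bar>Re (l1 - l2)\<bar> < 1 \<longleftrightarrow> 0 \<le> Re sg \<and> Re sg < 1)"
      proof cases
        case 1
        have "l1 - l2 = sg" unfolding 1 by (rule sg_eq[symmetric])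
        then show ?thesis using sg by simp
      next
        case 2
        have d: "l2 - l1 = sg" unfolding 2 by (rule sg_eq[symmetric])
        then have "Re l2 - Re l1 = Re sg" by (metis minus_complex.sel(1))
        then show ?thesis using sg d l(2) by auto
      qed
    qed
  qed
qed

end
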